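(* Let $g\in L^2(\mathbb{R}^d)$, $A\in C_0^\infty(\mathbb{R}^d;\mathbb{R}^d)$ and $V\in C_0(\mathbb{R}^d;\mathbb{R})$, and let $u^m$ be defined as in the context. Then for every $0<T<\infty$, $$\sup_{0\le t\le T}\|u^m(\cdot,t)-u^0(\cdot,t)\|_{L^2(\mathbb{R}^d)}\to0\quad\text{as }m\downarrow0.$$
   Context: Let $d\ge1$. $D_0$ is the set of right-continuous paths $X:[0,\infty)\to\mathbb{R}^d$ with left limits and $X(0)=0$, with the $\sigma$-algebra generated by coordinate maps. For $m\ge0$, $\lambda^m$ is the probability measure on $D_0$ under which the coordinate process $X(t)$ is a Lévy process with $E^m[e^{i\xi\cdot X(t)}]=e^{-t(\sqrt{|\xi|^2+m^2}-m)}$ ($E^m$ = expectation under $\lambda^m$). Its Lévy measure is $n^m(dy)=n^m(|y|)dy$ on $\mathbb{R}^d\setminus\{0\}$, where $n^m(r)=2\left(\frac{m}{2\pi}\right)^{(d+1)/2}\frac{K_{(d+1)/2}(mr)}{r^{(d+1)/2}}$ for $m>0$ ($K_\nu$ the modified Bessel function of the third kind) and $n^0(r)=\frac{\Gamma((d+1)/2)}{\pi^{(d+1)/2}}r^{-(d+1)}$. For $X\in D_0$, $N_X$ is the counting measure on $(0,\infty)\times(\mathbb{R}^d\setminus\{0\})$ given by $N_X(E)=\#\{s>0:(s,X(s)-X(s-))\in E\}$, and $\widetilde{N^m_X}(ds\,dy)=N_X(ds\,dy)-ds\,n^m(dy)$; $\int_0^t$ means $\int_{(0,t]}$. For $x\in\mathbb{R}^d$,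 $t\ge0$, define ($\lambda^m$-a.s.) $$Y^m(t,x,X)=\int_0^t\!\int_{|y|\ge1}A(x+X(s-)+\tfrac12 y)\cdot y\,N_X(ds\,dy)+\int_0^t\!\int_{0<|y|<1}A(x+X(s-)+\tfrac12 y)\cdot y\,\widetilde{N^m_X}(ds\,dy)+\int_0^t ds\int_{0<|y|<1}\big[A(x+X(s)+\tfrac12 y)-A(x+X(s))\big]\cdot y\,n^m(dy),$$ $S^m(t,x,X)=iY^m(t,x,X)+\int_0^tV(x+X(s))\,ds$, and $u^m(x,t)=E^m\big[e^{-S^m(t,x,X)}g(x+X(t))\big]$. *)

theory Defs
  imports "HOL-Analysis.Analysis" "HOL-Probability.Probability"
begin

definition dderiv :: "'a::euclidean_space \<Rightarrow> ('a \<Rightarrow> 'b::real_normed_vector) \<Rightarrow> 'a \<Rightarrow> 'b" where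
  "dderiv v f = (\<lambda>x. frechet_derivative f (at x) v)"

definition smooth_fun :: "('a::euclidean_space \<Rightarrow> 'b::real_normed_vector) \<Rightarrow> bool" where
  "smooth_fun f \<longleftrightarrow> (\<forall>vs::'a list. \<forall>x. foldr dderiv vs f differentiable (at x))"

definition compact_support :: "('a::real_normed_vector \<Rightarrow> 'b::zero) \<Rightarrow> bool" where
  "compact_support f \<longleftrightarrow> compact (closure {x. f x \<noteq> 0})"

definition C0_fun :: "('a::real_normed_vector \<Rightarrow> real) \<Rightarrow> bool" where
  "C0_fun V \<longleftrightarrow> continuous_on UNIV V \<and> (V \<longlongrightarrow> 0) at_infinity"

definition L2_fun :: "('a::euclidean_space \<Rightarrow> complex) \<Rightarrow> bool" where
  "L2_fun g \<longleftrightarrow> g \<in> borel_measurable lborel \<and> integrable lborel (\<lambda>x. (cmod (g x))\<^sup>2)"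

definition D0 :: "(real \<Rightarrow> 'a::euclidean_space) set" where
  "D0 = {X. X 0 = 0 \<and> (\<forall>t<0. X t = 0) \<and>
            (\<forall>t\<ge>0. (X \<longlongrightarrow> X t) (at_right t)) \<and>
            (\<forall>t>0. \<exists>l. (X \<longlongrightarrow> l) (at_left t))}"

definition D0_sets :: "(real \<Rightarrow> 'a::euclidean_space) set set" where
  "D0_sets = sigma_sets D0 {{X \<in> D0. X t \<in> B} | t B. t \<ge> 0 \<and> B \<in> sets borel}"

text \<open>Lambda is a probability measure on D_0 under which the coordinate process is a Levy
  process with E exp(i xi.X(t)) = exp(-t(sqrt(|xi|^2+m^2)-m)); equivalently the increments over
  any partition 0 = t_0 <= ... <= t_k are independent with the prescribed laws, i.e. their
  joint characteristic function factorises as below.\<close>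
definition rel_levy_law :: "(real \<Rightarrow> 'a::euclidean_space) measure \<Rightarrow> real \<Rightarrow> bool" where
  "rel_levy_law M m \<longleftrightarrow> prob_space M \<and> space M = D0 \<and> sets M = D0_sets \<and>
     (\<forall>(k::nat) (tt::nat \<Rightarrow> real) (\<xi>::nat \<Rightarrow> 'a).
        tt 0 = 0 \<and> (\<forall>j<k. tt j \<le> tt (Suc j)) \<longrightarrow>
        (LINT X|M. cis (\<Sum>j<k. \<xi> j \<bullet> (X (tt (Suc j)) - X (tt j))))
        = (\<Prod>j<k. complex_of_real (exp (- (tt (Suc j) - tt j) * (sqrt ((norm (\<xi> j))\<^sup>2 + m\<^sup>2) - m)))))"

text \<open>Modified Bessel function of the third kind, via its standard integral representation
  K_nu(z) = int_0^oo exp(-z cosh s) cosh(nu s) ds, z > 0.\<close>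
definition besselK :: "real \<Rightarrow> real \<Rightarrow> real" where
  "besselK \<nu> z = (LBINT s:{0..}. exp (- z * cosh s) * cosh (\<nu> * s))"

definition levy_dens :: "nat \<Rightarrow> real \<Rightarrow> real \<Rightarrow> real" where
  "levy_dens d m r =
     (if m = 0 then Gamma ((real d + 1) / 2) / pi powr ((real d + 1) / 2) * r powr (- (real d + 1))
      else 2 * (m / (2 * pi)) powr ((real d + 1) / 2) * besselK ((real d + 1) / 2) (m * r)
             / r powr ((real d + 1) / 2))"

abbreviation nm :: "real \<Rightarrow> 'a::euclidean_space \<Rightarrow> real" where
  "nm m y \<equiv> levy_dens DIM('a) m (norm y)"

definition left_lim :: "(real \<Rightarrow> 'a::euclidean_space) \<Rightarrow> real \<Rightarrow> 'a" where
  "left_lim X s = Lim (at_left s) X"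

definition jump :: "(real \<Rightarrow> 'a::euclidean_space) \<Rightarrow> real \<Rightarrow> 'a" where
  "jump X s = X s - left_lim X s"

text \<open>Integral of the big jumps against N_X (a finite sum for cadlag paths).\<close>
definition Ybig :: "('a::euclidean_space \<Rightarrow> 'a) \<Rightarrow> 'a \<Rightarrow> real \<Rightarrow> (real \<Rightarrow> 'a) \<Rightarrow> real" where
  "Ybig A x t X = (\<Sum>s\<in>{s. 0 < s \<and> s \<le> t \<and> norm (jump X s) \<ge> 1}.
                     A (x + left_lim X s + (1/2) *\<^sub>R jump X s) \<bullet> jump X s)"

text \<open>Compensated integral over eps <= |y| < 1 (pathwise well defined).\<close>
definition Ytrunc :: "real \<Rightarrow> ('a::euclidean_space \<Rightarrow> 'a) \<Rightarrow> 'a \<Rightarrow> real \<Rightarrow> real \<Rightarrow> (real \<Rightarrow> 'a) \<Rightarrow> real" where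
  "Ytrunc m A x t \<epsilon> X =
     (\<Sum>s\<in>{s. 0 < s \<and> s \<le> t \<and> \<epsilon> \<le> norm (jump X s) \<and> norm (jump X s) < 1}.
         A (x + left_lim X s + (1/2) *\<^sub>R jump X s) \<bullet> jump X s)
     - (LBINT s:{0<..t}. (LBINT y:{y. \<epsilon> \<le> norm y \<and> norm y < 1}.
           (A (x + left_lim X s + (1/2) *\<^sub>R y) \<bullet> y) * nm m y))"

text \<open>The compensated integral over 0 < |y| < 1 w.r.t. (N_X - ds n^m(dy)): the L^2(lambda^m)
  limit of the truncations as eps -> 0+ (determined lambda^m-a.s.).\<close>
definition Ysmall :: "(real \<Rightarrow> 'a::euclidean_space) measure \<Rightarrow> real \<Rightarrow> ('a \<Rightarrow> 'a) \<Rightarrow> 'a \<Rightarrow> real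
                      \<Rightarrow> (real \<Rightarrow> 'a) \<Rightarrow> real" where
  "Ysmall M m A x t = (SOME Z. Z \<in> borel_measurable M \<and>
       ((\<lambda>\<epsilon>. \<integral>\<^sup>+ X. ennreal ((Ytrunc m A x t \<epsilon> X - Z X)\<^sup>2) \<partial>M) \<longlongrightarrow> 0) (at_right 0))"

definition Ydrift :: "real \<Rightarrow> ('a::euclidean_space \<Rightarrow> 'a) \<Rightarrow> 'a \<Rightarrow> real \<Rightarrow> (real \<Rightarrow> 'a) \<Rightarrow> real" where
  "Ydrift m A x t X = (LBINT s:{0<..t}. (LBINT y:{y. 0 < norm y \<and> norm y < 1}.
        ((A (x + X s + (1/2) *\<^sub>R y) - A (x + X s)) \<bullet> y) * nm m y))"

definition Yfun :: "(real \<Rightarrow> 'a::euclidean_space) measure \<Rightarrow> real \<Rightarrow> ('a \<Rightarrow> 'a) \<Rightarrow> real \<Rightarrow> 'a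
                    \<Rightarrow> (real \<Rightarrow> 'a) \<Rightarrow> real" where
  "Yfun M m A t x X = Ybig A x t X + Ysmall M m A x t X + Ydrift m A x t X"

definition Sfun :: "(real \<Rightarrow> 'a::euclidean_space) measure \<Rightarrow> real \<Rightarrow> ('a \<Rightarrow> 'a) \<Rightarrow> ('a \<Rightarrow> real)
                    \<Rightarrow> real \<Rightarrow> 'a \<Rightarrow> (real \<Rightarrow> 'a) \<Rightarrow> complex" where
  "Sfun M m A V t x X = \<i> * complex_of_real (Yfun M m A t x X)
                        + complex_of_real (LBINT s:{0<..t}. V (x + X s))"

definition ufun :: "(real \<Rightarrow> 'a::euclidean_space) measure \<Rightarrow> real \<Rightarrow> ('a \<Rightarrow> 'a) \<Rightarrow> ('a \<Rightarrow> real)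
                    \<Rightarrow> ('a \<Rightarrow> complex) \<Rightarrow> 'a \<Rightarrow> real \<Rightarrow> complex" where
  "ufun M m A V g x t = (LINT X|M. exp (- Sfun M m A V t x X) * g (x + X t))"

end

theory Submission
  imports Defs
begin

text \<open>
  Since the Levy densities are even, the compensator and the drift in the definition of Y cancel
  in the limit: Y is the L2-limit, as epsilon tends to 0, of the sums of A(x + X(s-) + y/2) . y
  over the jumps y = X(s) - X(s-) of size at least epsilon, so up to a null set it is the same
  functional of the path for every mass m.  It is also the limit in probability of the midpoint
  sums over grids of mesh t/n: the increments are independent and symmetric, which makes the
  contribution of the increments of size at most delta of order delta in mean square, uniformly
  in n.  Therefore u is the limit of expectations that only involve the increments over a grid.

  By Gaussian subordination, the increment over a time step h has for mass m the law of h G / G',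
  where G and G' are independent standard Gaussian vectors in R^d and R, weighted with
  exp (m h - (h m)^2 / (2 G'^2)).  The product of these weights over the grid has mean 1 and is at
  most exp (m t), so it differs from 1 by at most 2 (exp (m t) - 1) in mean, whatever the grid.
  The Cauchy-Schwarz inequality, Tonelli's theorem and Fatou's lemma turn this into the bound
  2 exp (t sup |V|) (exp (m t) - 1) ||g|| for the L2-norm of the difference of the solutions for
  mass m and mass 0.
\<close>

section \<open>Uniqueness of characteristic functions in several variables\<close>

text \<open>The laws for different masses are given separately, through characteristic functions of
  increments, and \<open>Ysmall\<close> is an arbitrary choice made for each of them, so the
  solutions cannot be compared on one probability space as they stand. On a finite grid they can:
  one space carries the increments for all masses, and only the density depends on m. Hence the
  detour through midpoint sums and the uniqueness theorem for characteristic functions of finite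
  families. The coupling comes from Brownian motion. Given G', the vector h G / G' is Gaussian with
  variance tau = (h / G')^2 in each direction, and tau has the law of the time at which Brownian
  motion first reaches h. The weight exp (m h - m^2 tau / 2) is the Girsanov density that adds the
  drift m; it changes the exponent |xi| of the Cauchy process into sqrt (|xi|^2 + m^2) - m. The
  small jumps need not be summable, so the sums are controlled in mean square only; this is enough,
  since Y enters u through exp (-i Y). As g is merely square integrable, u is compared at almost
  every x.\<close>

lemma char_fun_unique_density:
  fixes X :: "'s \<Rightarrow> real" and Y :: "'t \<Rightarrow> real" and p :: "'s \<Rightarrow> real" and q :: "'t \<Rightarrow> real"
  assumes [measurable]: "X \<in> borel_measurable M" "Y \<in> borel_measurable N"
    and p: "integrable M p" "\<And>w. w \<in> space M \<Longrightarrow> 0 \<le> p w"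
    and q: "integrable N q" "\<And>w. w \<in> space N \<Longrightarrow> 0 \<le> q w"
    and eq: "\<And>u. (LINT w|M. complex_of_real (p w) * cis (u * X w)) = (LINT w|N. complex_of_real (q w) * cis (u * Y w))"
    and B: "B \<in> sets borel"
  shows "(LINT w|M. p w * indicator B (X w)) = (LINT w|N. q w * indicator B (Y w))"
proof -
  have [measurable]: "p \<in> borel_measurable M" "q \<in> borel_measurable N"
    using p q by auto
  define c where "c = (LINT w|M. p w)"
  have c2: "c = (LINT w|N. q w)"
    using eq[of 0] by (simp add: c_def)
  have c0: "0 \<le> c" unfolding c_def using p by (intro integral_nonneg_AE AE_I2)
  show ?thesis
  proof (cases "c = 0")
    case True
    have "AE w in M. p w = 0"
      using True p by (subst (asm) c_def) (subst (asm) integral_nonneg_eq_0_iff_AE, auto)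
    moreover have "AE w in N. q w = 0"
      using True q by (subst (asm) c2) (subst (asm) integral_nonneg_eq_0_iff_AE, auto)
    ultimately have "(LINT w|M. p w * indicator B (X w)) = 0" "(LINT w|N. q w * indicator B (Y w)) = 0"
      by (auto intro!: integral_eq_zero_AE)
    then show ?thesis by simp
  next
    case False
    with c0 have cpos: "c > 0" by simp
    \<comment> \<open>The common total mass c > 0 normalizes both weights to probability densities,
      and the claim becomes uniqueness for the two image laws on the line. For c = 0 both weights
      vanish almost everywhere.\<close>
    have gen: "real_distribution (distr (density L (\<lambda>w. ennreal (r w / c))) borel Z) \<and>
        char (distr (density L (\<lambda>w. ennreal (r w / c))) borel Z)
          = (\<lambda>u. (LINT w|L. complex_of_real (r w) * cis (u * Z w)) / c) \<and>
        (\<forall>B\<in>sets borel. measure (distr (density L (\<lambda>w. ennreal (r w / c))) borel Z) B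
            = (LINT w|L. r w * indicator B (Z w)) / c)"
      if r: "integrable L r" "\<And>w. w \<in> space L \<Longrightarrow> 0 \<le> r w" and [measurable]: "Z \<in> borel_measurable L"
        and cr: "c = (LINT w|L. r w)" for r :: "'z \<Rightarrow> real" and L Z
    proof -
      have [measurable]: "r \<in> borel_measurable L" using r by auto
      have "prob_space (density L (\<lambda>w. ennreal (r w / c)))"
      proof (rule prob_spaceI)
        have "emeasure (density L (\<lambda>w. ennreal (r w / c))) (space (density L (\<lambda>w. ennreal (r w / c))))
           = (\<integral>\<^sup>+ w. ennreal (r w / c) \<partial>L)"
          by (subst emeasure_density) (auto intro!: nn_integral_cong)
        also have "\<dots> = ennreal (LINT w|L. r w / c)"
          using r cpos by (intro nn_integral_eq_integral) auto
        also have "\<dots> = 1" using cr cpos by simp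
        finally show "emeasure (density L (\<lambda>w. ennreal (r w / c))) (space (density L (\<lambda>w. ennreal (r w / c)))) = 1" .
      qed
      then interpret P: prob_space "density L (\<lambda>w. ennreal (r w / c))" .
      have 1: "real_distribution (distr (density L (\<lambda>w. ennreal (r w / c))) borel Z)"
        by (rule P.real_distribution_distr) simp
      have 2: "char (distr (density L (\<lambda>w. ennreal (r w / c))) borel Z) u
          = (LINT w|L. complex_of_real (r w) * cis (u * Z w)) / c" for u
      proof -
        have "char (distr (density L (\<lambda>w. ennreal (r w / c))) borel Z) u
          = (LINT w|L. (r w / c) *\<^sub>R iexp (u * Z w))"
          unfolding char_def using r cpos
          by (subst integral_distr, simp, simp, subst integral_density) (auto intro!: AE_I2)
        also have "\<dots> = (LINT w|L. (complex_of_real (r w) * cis (u * Z w)) / c)"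
          by (intro Bochner_Integration.integral_cong) (auto simp: cis_conv_exp scaleR_conv_of_real)
        finally show ?thesis by simp
      qed
      have 3: "measure (distr (density L (\<lambda>w. ennreal (r w / c))) borel Z) B
            = (LINT w|L. r w * indicator B (Z w)) / c" if [measurable]: "B \<in> sets borel" for B
      proof -
        interpret D: real_distribution "distr (density L (\<lambda>w. ennreal (r w / c))) borel Z" by (rule 1)
        have "measure (distr (density L (\<lambda>w. ennreal (r w / c))) borel Z) B
          = (LINT z|distr (density L (\<lambda>w. ennreal (r w / c))) borel Z. indicator B z)"
          by simp
        also have "\<dots> = (LINT w|L. (r w / c) *\<^sub>R indicator B (Z w))"
          using r cpos
          by (subst integral_distr, simp, simp, subst integral_density) (auto intro!: AE_I2)
        finally show ?thesis by simp
      qed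
      from 1 2 3 show ?thesis by auto
    qed
    note gM = gen[OF p assms(1) c_def] and gN = gen[OF q assms(2) c2]
    have "distr (density M (\<lambda>w. ennreal (p w / c))) borel X = distr (density N (\<lambda>w. ennreal (q w / c))) borel Y"
      using gM gN eq by (intro Levy_uniqueness) (auto simp: fun_eq_iff)
    then show ?thesis
      using gM gN B cpos by (metis (no_types, lifting) c0 divide_cancel_right False)
  qed
qed

text \<open>Complex weights define no probability law, so majorants \<open>p\<close> and
  \<open>q\<close> with equal transforms are carried along. Conjugating a weight reflects its
  transform, which yields the transforms of the real and imaginary parts; each part becomes
  nonnegative once the majorant is added.\<close>

lemma char_fun_unique_complex:
  fixes X :: "'s \<Rightarrow> real" and Y :: "'t \<Rightarrow> real" and p :: "'s \<Rightarrow> real" and q :: "'t \<Rightarrow> real"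
    and f :: "'s \<Rightarrow> complex" and g :: "'t \<Rightarrow> complex"
  assumes [measurable]: "X \<in> borel_measurable M" "Y \<in> borel_measurable N"
      "f \<in> borel_measurable M" "g \<in> borel_measurable N"
    and p: "integrable M p" "\<And>w. w \<in> space M \<Longrightarrow> cmod (f w) \<le> p w"
    and q: "integrable N q" "\<And>w. w \<in> space N \<Longrightarrow> cmod (g w) \<le> q w"
    and eq1: "\<And>u. (LINT w|M. complex_of_real (p w) * cis (u * X w)) = (LINT w|N. complex_of_real (q w) * cis (u * Y w))"
    and eq2: "\<And>u. (LINT w|M. f w * cis (u * X w)) = (LINT w|N. g w * cis (u * Y w))"
    and [measurable]: "B \<in> sets borel"
  shows "(LINT w|M. indicator B (X w) * f w) = (LINT w|N. indicator B (Y w) * g w)"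
proof -
  have fi: "integrable M f" and gi: "integrable N g"
    by (rule Bochner_Integration.integrable_bound[OF p(1)] Bochner_Integration.integrable_bound[OF q(1)];
        use p(2) q(2) in \<open>force intro!: AE_I2\<close>)+
  have cI: "integrable L (\<lambda>w. h w * cis (u * Z w))" 
    if "integrable L h" and [measurable]: "Z \<in> borel_measurable L" for L :: "'z measure" and h Z u
  proof -
    have [measurable]: "h \<in> borel_measurable L" using that by auto
    show ?thesis
      by (rule Bochner_Integration.integrable_bound[OF that(1)])
         (auto simp: norm_mult cis_conv_exp)
  qed
  have [measurable]: "p \<in> borel_measurable M" "q \<in> borel_measurable N"
    using p q by auto
  have cnj: "(LINT w|M. cnj (f w) * cis (u * X w)) = (LINT w|N. cnj (g w) * cis (u * Y w))" for u
  proof -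
    have "(LINT w|M. cnj (f w) * cis (u * X w)) = cnj (LINT w|M. f w * cis (- u * X w))"
      by (subst Bochner_Integration.integral_cnj [symmetric]) (simp add: cis_cnj)
    also have "\<dots> = cnj (LINT w|N. g w * cis (- u * Y w))"
      by (simp only: eq2)
    also have "\<dots> = (LINT w|N. cnj (g w) * cis (u * Y w))"
      by (subst Bochner_Integration.integral_cnj [symmetric]) (simp add: cis_cnj)
    finally show ?thesis .
  qed
  have re: "(LINT w|M. complex_of_real (Re (f w)) * cis (u * X w)) = (LINT w|N. complex_of_real (Re (g w)) * cis (u * Y w))" for u
  proof -
    have "(LINT w|M. complex_of_real (Re (f w)) * cis (u * X w))
      = (LINT w|M. (f w * cis (u * X w) + cnj (f w) * cis (u * X w)) / 2)"
      by (intro Bochner_Integration.integral_cong refl) (simp add: complex_add_cnj flip: distrib_right)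
    also have "\<dots> = (LINT w|N. (g w * cis (u * Y w) + cnj (g w) * cis (u * Y w)) / 2)"
      using cnj eq2 fi gi by (simp add: cI)
    also have "\<dots> = (LINT w|N. complex_of_real (Re (g w)) * cis (u * Y w))"
      by (intro Bochner_Integration.integral_cong refl) (simp add: complex_add_cnj flip: distrib_right)
    finally show ?thesis .
  qed
  have im_eq: "complex_of_real (Im z) * v = (z * v - cnj z * v) / (2 * \<i>)" for z v
    unfolding left_diff_distrib [symmetric] complex_diff_cnj by (simp add: field_simps)
  have im: "(LINT w|M. complex_of_real (Im (f w)) * cis (u * X w)) = (LINT w|N. complex_of_real (Im (g w)) * cis (u * Y w))" for u
  proof -
    have "(LINT w|M. complex_of_real (Im (f w)) * cis (u * X w))
      = (LINT w|M. (f w * cis (u * X w) - cnj (f w) * cis (u * X w)) / (2 * \<i>))"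
      by (intro Bochner_Integration.integral_cong refl) (simp add: im_eq)
    also have "\<dots> = (LINT w|N. (g w * cis (u * Y w) - cnj (g w) * cis (u * Y w)) / (2 * \<i>))"
      using cnj eq2 fi gi by (simp add: cI)
    also have "\<dots> = (LINT w|N. complex_of_real (Im (g w)) * cis (u * Y w))"
      by (intro Bochner_Integration.integral_cong refl) (simp add: im_eq)
    finally show ?thesis .
  qed
  \<comment> \<open>adding the majorants p and q makes the weights nonnegative\<close>
  have key: "(LINT w|M. a w * indicator B (X w)) = (LINT w|N. b w * indicator B (Y w))"
    if a: "integrable M a" "\<And>w. w \<in> space M \<Longrightarrow> \<bar>a w\<bar> \<le> p w"
      and b: "integrable N b" "\<And>w. w \<in> space N \<Longrightarrow> \<bar>b w\<bar> \<le> q w"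
      and e: "\<And>u. (LINT w|M. complex_of_real (a w) * cis (u * X w)) = (LINT w|N. complex_of_real (b w) * cis (u * Y w))"
    for a b
  proof -
    have pp: "(LINT w|M. p w * indicator B (X w)) = (LINT w|N. q w * indicator B (Y w))"
      using p q by (intro char_fun_unique_density eq1) (auto intro: order_trans[OF norm_ge_zero])
    have "(LINT w|M. (p w + a w) * indicator B (X w)) = (LINT w|N. (q w + b w) * indicator B (Y w))"
    proof (rule char_fun_unique_density)
      show "0 \<le> p w + a w" if "w \<in> space M" for w using a(2)[OF that] by linarith
      show "0 \<le> q w + b w" if "w \<in> space N" for w using b(2)[OF that] by linarith
    qed (use a b p q eq1 e in \<open>auto simp: distrib_right cI\<close>)
    moreover have iB: "integrable L (\<lambda>w. r w * indicator B (Z w))"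
      if "integrable L r" and [measurable]: "Z \<in> borel_measurable L" for L :: "'z measure" and r :: "'z \<Rightarrow> real" and Z
    proof -
      have [measurable]: "r \<in> borel_measurable L" using that by auto
      show ?thesis by (rule Bochner_Integration.integrable_bound[OF that(1)]) (auto simp: indicator_def)
    qed
    ultimately show ?thesis using pp a b p q by (simp add: distrib_right iB)
  qed
  have "(LINT w|M. Re (f w) * indicator B (X w)) = (LINT w|N. Re (g w) * indicator B (Y w))"
    using fi gi p q by (intro key re) (auto intro: order_trans[OF abs_Re_le_cmod])
  moreover have "(LINT w|M. Im (f w) * indicator B (X w)) = (LINT w|N. Im (g w) * indicator B (Y w))"
    using fi gi p q by (intro key im) (auto intro: order_trans[OF abs_Im_le_cmod])
  moreover have ind: "integrable L (\<lambda>w. indicator B (Z w) * h w)" 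
    if "integrable L h" and [measurable]: "Z \<in> borel_measurable L" for L :: "'z measure" and h :: "'z \<Rightarrow> complex" and Z
  proof -
    have [measurable]: "h \<in> borel_measurable L" using that by auto
    show ?thesis by (rule Bochner_Integration.integrable_bound[OF that(1)])
         (auto simp: norm_mult indicator_def)
  qed
  moreover have "Re (indicator B z * h) = Re h * indicator B z" "Im (indicator B z * h) = Im h * indicator B z" for z :: real and h :: complex
    by (auto simp: indicator_def)
  ultimately show ?thesis
    using fi gi by (auto simp: complex_eq_iff ind simp flip: integral_Re integral_Im)
qed

lemma prod_indicator_eq_of_bool:
  "finite J \<Longrightarrow> (\<Prod>i\<in>J. indicator (B i) (z i)) = (of_bool (\<forall>i\<in>J. z i \<in> B i) :: 'c::comm_semiring_1)"
  by (induction J rule: finite_induct) (auto simp: indicator_def)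

text \<open>Induction on \<open>J\<close>: one coordinate at a time is moved from the exponential to
  an indicator, everything else serving as a complex weight for
  \<open>char_fun_unique_complex\<close>. The indicators already present are the majorant; their
  transform in the new coordinate is the induction hypothesis with the remaining frequencies set to
  zero.\<close>

lemma char_fun_unique_partial:
  fixes X :: "'i \<Rightarrow> 's \<Rightarrow> real" and Y :: "'i \<Rightarrow> 't \<Rightarrow> real"
  assumes "finite_measure M" "finite_measure N"
    and X: "\<And>i. i \<in> I \<Longrightarrow> X i \<in> borel_measurable M"
    and Y: "\<And>i. i \<in> I \<Longrightarrow> Y i \<in> borel_measurable N"
    and eq: "\<And>\<xi>. (LINT w|M. cis (\<Sum>i\<in>I. \<xi> i * X i w)) = (LINT w|N. cis (\<Sum>i\<in>I. \<xi> i * Y i w))"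
    and I: "finite I"
    and J: "J \<subseteq> I" and B: "\<And>i. i \<in> J \<Longrightarrow> B i \<in> sets borel"
  shows "(LINT w|M. (\<Prod>i\<in>J. indicator (B i) (X i w)) * cis (\<Sum>i\<in>I-J. \<xi> i * X i w))
       = (LINT w|N. (\<Prod>i\<in>J. indicator (B i) (Y i w)) * cis (\<Sum>i\<in>I-J. \<xi> i * Y i w))"
  using finite_subset[OF J I] J B
proof (induction J arbitrary: \<xi> rule: finite_induct)
  case empty
  then show ?case using eq by simp
next
  case (insert j J)
  interpret M: finite_measure M by fact
  interpret N: finite_measure N by fact
  have j: "j \<in> I" "j \<notin> J" and fJ: "finite J" and fI: "finite (I - J)" using insert I by auto
  have [measurable]: "B i \<in> sets borel" if "i \<in> insert j J" for i using that insert by auto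
  have mp: "(\<lambda>w. \<Prod>i\<in>J. indicator (B i) (X i w) :: 'c::{real_normed_field,second_countable_topology}) \<in> borel_measurable M"
      "(\<lambda>w. \<Prod>i\<in>J. indicator (B i) (Y i w) :: 'c) \<in> borel_measurable N"
    using insert.prems X Y by (auto intro!: borel_measurable_prod measurable_compose[OF _ borel_measurable_indicator])
  have mc: "(\<lambda>w. cis (\<Sum>i\<in>I - insert j J. \<xi> i * X i w)) \<in> borel_measurable M"
    "(\<lambda>w. cis (\<Sum>i\<in>I - insert j J. \<xi> i * Y i w)) \<in> borel_measurable N" for \<xi>
    using X Y by (auto intro!: borel_measurable_sum borel_measurable_times simp: cis_conv_exp intro!: borel_measurable_continuous_onI[THEN measurable_compose[rotated]] continuous_intros)
  have [measurable]: "X j \<in> borel_measurable M" "Y j \<in> borel_measurable N" using X Y j by auto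
  have IH: "(LINT w|M. (\<Prod>i\<in>J. indicator (B i) (X i w)) * cis (\<Sum>i\<in>I-J. \<xi> i * X i w))
       = (LINT w|N. (\<Prod>i\<in>J. indicator (B i) (Y i w)) * cis (\<Sum>i\<in>I-J. \<xi> i * Y i w))" for \<xi>
    by (rule insert.IH) (use insert.prems in auto)
  have split: "I - J = insert j (I - insert j J)" using j by auto
  have cisj: "cis (\<Sum>i\<in>I-J. \<xi> i * Z i) = cis (\<Sum>i\<in>I - insert j J. \<xi> i * Z i) * cis (\<xi> j * Z j)" for \<xi> Z
    unfolding split using I by (subst sum.insert) (auto simp: cis_mult add.commute)
  have e: "(LINT w|M. ((\<Prod>i\<in>J. indicator (B i) (X i w)) * cis (\<Sum>i\<in>I - insert j J. \<xi> i * X i w)) * cis (u * X j w))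
     = (LINT w|N. ((\<Prod>i\<in>J. indicator (B i) (Y i w)) * cis (\<Sum>i\<in>I - insert j J. \<xi> i * Y i w)) * cis (u * Y j w))" for u \<xi>
  proof -
    have *: "(\<Sum>i\<in>I - insert j J. (\<xi>(j := u)) i * Z i) = (\<Sum>i\<in>I - insert j J. \<xi> i * Z i)" for Z
      by (intro sum.cong) auto
    show ?thesis using IH[of "\<xi>(j := u)"] by (simp add: cisj * mult.assoc)
  qed
  have bd: "cmod (prod (\<lambda>i. indicator (B i) (Z i)) J) = prod (\<lambda>i. indicator (B i) (Z i)) J" 
    "0 \<le> (prod (\<lambda>i. indicator (B i) (Z i)) J :: real)" "prod (\<lambda>i. indicator (B i) (Z i)) J \<le> (1::real)" for Z
    using fJ by (simp_all only: prod_indicator_eq_of_bool) auto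
  have "(LINT w|M. indicator (B j) (X j w) * ((\<Prod>i\<in>J. indicator (B i) (X i w)) * cis (\<Sum>i\<in>I - insert j J. \<xi> i * X i w)))
     = (LINT w|N. indicator (B j) (Y j w) * ((\<Prod>i\<in>J. indicator (B i) (Y i w)) * cis (\<Sum>i\<in>I - insert j J. \<xi> i * Y i w)))"
  proof (rule char_fun_unique_complex[where p = "\<lambda>w. \<Prod>i\<in>J. indicator (B i) (X i w)" and q = "\<lambda>w. \<Prod>i\<in>J. indicator (B i) (Y i w)"])
    show "integrable M (\<lambda>w. \<Prod>i\<in>J. indicator (B i) (X i w) :: real)"
      using mp bd by (intro M.integrable_const_bound[where B=1]) (auto simp: abs_prod)
    show "integrable N (\<lambda>w. \<Prod>i\<in>J. indicator (B i) (Y i w) :: real)"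
      using mp bd by (intro N.integrable_const_bound[where B=1]) (auto simp: abs_prod)
    have of_ind: "complex_of_real (prod (\<lambda>i. indicator (B i) (Z i)) J) = prod (\<lambda>i. indicator (B i) (Z i)) J" for Z
      using fJ by (simp add: prod_indicator_eq_of_bool)
    show "(LINT w|M. complex_of_real (\<Prod>i\<in>J. indicator (B i) (X i w)) * cis (u * X j w)) =
         (LINT w|N. complex_of_real (\<Prod>i\<in>J. indicator (B i) (Y i w)) * cis (u * Y j w))" for u
      unfolding of_ind using e[of "\<lambda>_. 0" u] by simp
    show "(\<lambda>w. (\<Prod>i\<in>J. indicator (B i) (X i w)) * cis (\<Sum>i\<in>I - insert j J. \<xi> i * X i w)) \<in> borel_measurable M"
      "(\<lambda>w. (\<Prod>i\<in>J. indicator (B i) (Y i w)) * cis (\<Sum>i\<in>I - insert j J. \<xi> i * Y i w)) \<in> borel_measurable N"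
      by (intro borel_measurable_times mp mc)+
  qed (use e bd insert.prems in \<open>auto simp: norm_mult\<close>)
  then show ?case using insert.hyps by (simp add: prod.insert_if mult.assoc)
qed

text \<open>With \<open>J = I\<close> the partial statement compares the two laws on measurable
  rectangles, and these determine a finite measure on a finite product.\<close>

lemma distr_PiM_eqI_char_fun:
  fixes X :: "'i \<Rightarrow> 's \<Rightarrow> real" and Y :: "'i \<Rightarrow> 't \<Rightarrow> real"
  assumes "finite_measure M" "finite_measure N"
    and X: "\<And>i. i \<in> I \<Longrightarrow> X i \<in> borel_measurable M"
    and Y: "\<And>i. i \<in> I \<Longrightarrow> Y i \<in> borel_measurable N"
    and I: "finite I"
    and eq: "\<And>\<xi>. (LINT w|M. cis (\<Sum>i\<in>I. \<xi> i * X i w)) = (LINT w|N. cis (\<Sum>i\<in>I. \<xi> i * Y i w))"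
  shows "distr M (PiM I (\<lambda>_. borel)) (\<lambda>w. \<lambda>i\<in>I. X i w) = distr N (PiM I (\<lambda>_. borel)) (\<lambda>w. \<lambda>i\<in>I. Y i w)"
proof -
  interpret M: finite_measure M by fact
  interpret N: finite_measure N by fact
  have mX[measurable]: "(\<lambda>w. \<lambda>i\<in>I. X i w) \<in> measurable M (PiM I (\<lambda>_. borel))" using X by (intro measurable_restrict) auto
  have mY[measurable]: "(\<lambda>w. \<lambda>i\<in>I. Y i w) \<in> measurable N (PiM I (\<lambda>_. borel))" using Y by (intro measurable_restrict) auto
  interpret DM: finite_measure "distr M (PiM I (\<lambda>_. borel)) (\<lambda>w. \<lambda>i\<in>I. X i w)"
    by (rule M.finite_measure_distr) fact
  \<comment> \<open>The sum over the empty set \<open>I - I\<close> makes the exponential factor 1;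
    it is kept to match the shape of \<open>char_fun_unique_partial\<close> at
    \<open>J = I\<close>.\<close>
  have rect: "emeasure (distr L (PiM I (\<lambda>_. borel)) (\<lambda>w. \<lambda>i\<in>I. Z i w)) (Pi\<^sub>E I B)
      = ennreal (Re (LINT w|L. (\<Prod>i\<in>I. indicator (B i) (Z i w)) * cis (\<Sum>i\<in>I-I. 0 * Z i w)))"
    if "finite_measure L" and Z: "\<And>i. i \<in> I \<Longrightarrow> Z i \<in> borel_measurable L" and B: "\<And>i. i \<in> I \<Longrightarrow> B i \<in> sets borel" 
    for L and Z :: "'i \<Rightarrow> 'z \<Rightarrow> real" and B
  proof -
    interpret L: finite_measure L by fact
    have mZ[measurable]: "(\<lambda>w. \<lambda>i\<in>I. Z i w) \<in> measurable L (PiM I (\<lambda>_. borel))" using Z by (intro measurable_restrict) auto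
    have vi: "(\<lambda>w. \<lambda>i\<in>I. Z i w) -` Pi\<^sub>E I B \<inter> space L = {w \<in> space L. \<forall>i\<in>I. Z i w \<in> B i}"
      by (auto simp: PiE_iff)
    have S: "{w \<in> space L. \<forall>i\<in>I. Z i w \<in> B i} \<in> sets L"
      using measurable_sets[OF mZ, of "Pi\<^sub>E I B"] I B by (simp add: vi sets_PiM_I_finite)
    have "emeasure (distr L (PiM I (\<lambda>_. borel)) (\<lambda>w. \<lambda>i\<in>I. Z i w)) (Pi\<^sub>E I B)
      = emeasure L {w \<in> space L. \<forall>i\<in>I. Z i w \<in> B i}"
      using I B by (subst emeasure_distr) (simp_all add: vi sets_PiM_I_finite)
    also have "\<dots> = ennreal (measure L {w \<in> space L. \<forall>i\<in>I. Z i w \<in> B i})" by (rule L.emeasure_eq_measure)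
    also have "measure L {w \<in> space L. \<forall>i\<in>I. Z i w \<in> B i} = Re (complex_of_real (LINT w|L. indicator {w \<in> space L. \<forall>i\<in>I. Z i w \<in> B i} w))"
      using S by simp
    also have "complex_of_real (LINT w|L. indicator {w \<in> space L. \<forall>i\<in>I. Z i w \<in> B i} w)
        = (LINT w|L. complex_of_real (indicator {w \<in> space L. \<forall>i\<in>I. Z i w \<in> B i} w))"
      by (rule integral_complex_of_real [symmetric])
    also have "\<dots> = (LINT w|L. (\<Prod>i\<in>I. indicator (B i) (Z i w)) * cis (\<Sum>i\<in>I-I. 0 * Z i w))"
      using I by (intro Bochner_Integration.integral_cong refl) (simp add: prod_indicator_eq_of_bool indicator_def)
    finally show ?thesis .
  qed
  show ?thesis
  proof (rule measure_eqI_PiM_finite[where A="\<lambda>_. space (PiM I (\<lambda>_. borel))", OF I])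
    fix B :: "'i \<Rightarrow> real set" assume B: "\<And>i. i \<in> I \<Longrightarrow> B i \<in> sets borel"
    show "distr M (PiM I (\<lambda>_. borel)) (\<lambda>w. \<lambda>i\<in>I. X i w) (Pi\<^sub>E I B) = distr N (PiM I (\<lambda>_. borel)) (\<lambda>w. \<lambda>i\<in>I. Y i w) (Pi\<^sub>E I B)"
      using char_fun_unique_partial[OF assms(1,2) X Y eq I order_refl, of B] B
      by (simp add: rect[OF assms(1) X] rect[OF assms(2) Y])
  next
    show "range (\<lambda>_::nat. space (PiM I (\<lambda>_. borel))) \<subseteq> prod_algebra I (\<lambda>_. borel)"
      using I by (auto simp: space_PiM intro!: prod_algebraI_finite)
  qed (auto simp: DM.emeasure_eq_measure)
qed

section \<open>Riemann-type sums along cadlag paths\<close>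

text \<open>Division by zero gives \<open>grid t 0 k = 0\<close>; statements in which the last grid
  point has to be t ask for n > 0.\<close>

definition grid :: "real \<Rightarrow> nat \<Rightarrow> nat \<Rightarrow> real" where
  "grid t n k = real k * t / real n"

definition incr :: "real \<Rightarrow> nat \<Rightarrow> (real \<Rightarrow> 'a::real_normed_vector) \<Rightarrow> nat \<Rightarrow> 'a" where
  "incr t n X k = X (grid t n (Suc k)) - X (grid t n k)"

lemma grid_nonneg: "0 \<le> t \<Longrightarrow> 0 \<le> grid t n k"
  by (simp add: grid_def)

lemma grid_le: "0 \<le> t \<Longrightarrow> k \<le> n \<Longrightarrow> grid t n k \<le> t"
  by (cases "n = 0") (auto simp: grid_def divide_simps mult_left_mono mult.commute)

lemma grid_Suc: "grid t n (Suc k) = grid t n k + t / real n"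
  by (simp add: grid_def add_divide_distrib distrib_right)

lemma D0_at_right: "X \<in> D0 \<Longrightarrow> 0 \<le> s \<Longrightarrow> (X \<longlongrightarrow> X s) (at_right s)"
  by (auto simp: D0_def)

lemma D0_continuous_right: "X \<in> D0 \<Longrightarrow> 0 \<le> s \<Longrightarrow> continuous (at s within {s..}) X"
  using D0_at_right[of X s] by (simp add: continuous_within at_within_Ici_at_right)

lemma D0_left_lim: "X \<in> D0 \<Longrightarrow> 0 < s \<Longrightarrow> (X \<longlongrightarrow> left_lim X s) (at_left s)"
proof -
  assume "X \<in> D0" "0 < s"
  then obtain l where l: "(X \<longlongrightarrow> l) (at_left s)" by (auto simp: D0_def)
  moreover have "left_lim X s = l"
    unfolding left_lim_def using l by (intro tendsto_Lim) simp_all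
  ultimately show ?thesis by simp
qed

lemma D0_local_oscillation:
  assumes X: "X \<in> D0" and s: "0 \<le> s" and \<eta>: "0 < \<eta>"
  obtains \<delta> l where "0 < \<delta>" "\<And>u. s \<le> u \<Longrightarrow> u < s + \<delta> \<Longrightarrow> dist (X u) (X s) < \<eta>"
    "\<And>u. s - \<delta> < u \<Longrightarrow> u < s \<Longrightarrow> dist (X u) l < \<eta>"
proof -
  have "\<forall>\<^sub>F u in at_right s. dist (X u) (X s) < \<eta>"
    using tendstoD[OF D0_at_right[OF X s] \<eta>] .
  then obtain b where b: "b > s" "\<And>u. s < u \<Longrightarrow> u < b \<Longrightarrow> dist (X u) (X s) < \<eta>"
    by (auto simp: eventually_at_right_field)
  have "\<exists>l. (X \<longlongrightarrow> l) (at_left s)"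
  \<comment> \<open>At time 0 the left limit exists because paths in \<open>D0\<close> are extended
    by 0 to negative times.\<close>
  proof (cases "s = 0")
    case True
    have "\<forall>\<^sub>F u in at_left (0::real). X u = 0"
      using X by (auto simp: D0_def eventually_at_filter)
    then have "(X \<longlongrightarrow> 0) (at_left s)"
      using True by (simp add: tendsto_eventually)
    then show ?thesis ..
  qed (use X s in \<open>auto simp: D0_def\<close>)
  then obtain l where "(X \<longlongrightarrow> l) (at_left s)" ..
  then have "\<forall>\<^sub>F u in at_left s. dist (X u) l < \<eta>"
    using \<eta> by (rule tendstoD)
  then obtain a where a: "a < s" "\<And>u. a < u \<Longrightarrow> u < s \<Longrightarrow> dist (X u) l < \<eta>"
    by (auto simp: eventually_at_left_field)
  show thesis
  proof (rule that[of "min (b - s) (s - a)" l])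
    show "0 < min (b - s) (s - a)" using a b by simp
    show "dist (X u) (X s) < \<eta>" if "s \<le> u" "u < s + min (b - s) (s - a)" for u
      using that b(2)[of u] \<eta> by (cases "u = s") auto
    show "dist (X u) l < \<eta>" if "s - min (b - s) (s - a) < u" "u < s" for u
      using that a(2)[of u] by auto
  qed
qed

text \<open>Compactness of [0, t]: around each s there is an interval on whose two halves the path
  varies by less than \<eta>. \<open>S\<close> consists of the centres of a finite subcover and
  \<rho> is a Lebesgue number, so a short interval lies in one of the balls and can have a large
  increment only if it straddles the centre. By right continuity the centre belongs to the right
  half, hence a < s \<le> b.\<close>

lemma D0_oscillation:
  assumes X: "X \<in> D0" and \<eta>: "0 < \<eta>"
  obtains S \<rho> where "finite S" "0 < \<rho>"
    "\<And>a b. 0 \<le> a \<Longrightarrow> a \<le> b \<Longrightarrow> b \<le> t \<Longrightarrow> b - a < \<rho> \<Longrightarrow> norm (X b - X a) < \<eta> \<or> (\<exists>s\<in>S. a < s \<and> s \<le> b)"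
    "{s. 0 < s \<and> s \<le> t \<and> \<eta> \<le> norm (jump X s)} \<subseteq> S"
proof -
  have "\<exists>\<delta> l. 0 < \<delta> \<and> (\<forall>u. s \<le> u \<longrightarrow> u < s + \<delta> \<longrightarrow> dist (X u) (X s) < \<eta>/2) \<and>
     (\<forall>u. s - \<delta> < u \<longrightarrow> u < s \<longrightarrow> dist (X u) l < \<eta>/2)" if "0 \<le> s" for s
    using D0_local_oscillation[OF X that, of "\<eta>/2"] \<eta> by (metis half_gt_zero)
  then obtain \<delta> l where \<delta>: "\<And>s. 0 \<le> s \<Longrightarrow> 0 < \<delta> s"
    and R: "\<And>s u. 0 \<le> s \<Longrightarrow> s \<le> u \<Longrightarrow> u < s + \<delta> s \<Longrightarrow> dist (X u) (X s) < \<eta>/2"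
    and L: "\<And>s u. 0 \<le> s \<Longrightarrow> s - \<delta> s < u \<Longrightarrow> u < s \<Longrightarrow> dist (X u) (l s) < \<eta>/2"
    by metis
  have "s \<in> ball s (\<delta> s)" if "s \<in> {0..t}" for s using \<delta>[of s] that by simp
  then have "{0..t} \<subseteq> (\<Union>s\<in>{0..t}. ball s (\<delta> s))" by blast
  then obtain S where S: "S \<subseteq> {0..t}" "finite S" "{0..t} \<subseteq> (\<Union>s\<in>S. ball s (\<delta> s))"
    by (rule compactE_image[OF compact_Icc, rotated 1]) auto
  have cov: "{0..t} \<subseteq> \<Union>((\<lambda>s. ball s (\<delta> s)) ` S)" using S(3) by simp
  have op: "open G" if "G \<in> (\<lambda>s. ball s (\<delta> s)) ` S" for G using that by auto
  obtain \<rho> where \<rho>: "0 < \<rho>" "\<And>x. x \<in> {0..t} \<Longrightarrow> \<exists>G\<in>(\<lambda>s. ball s (\<delta> s)) ` S. ball x \<rho> \<subseteq> G"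
    by (rule Heine_Borel_lemma[OF compact_Icc cov]) (erule op, metis)
  show thesis
  proof
    show "finite S" "0 < \<rho>" by fact+
    show "norm (X b - X a) < \<eta> \<or> (\<exists>s\<in>S. a < s \<and> s \<le> b)" 
      if ab: "0 \<le> a" "a \<le> b" "b \<le> t" "b - a < \<rho>" for a b
    proof -
      have "a \<in> {0..t}" using ab by simp
      then obtain s where s: "s \<in> S" "ball a \<rho> \<subseteq> ball s (\<delta> s)" using \<rho>(2) by (metis imageE)
      have "a \<in> ball a \<rho>" "b \<in> ball a \<rho>" using ab \<rho> by (auto simp: dist_real_def)
      then have "a \<in> ball s (\<delta> s)" "b \<in> ball s (\<delta> s)" using s(2) by blast+
      then have d: "\<bar>s - a\<bar> < \<delta> s" "\<bar>s - b\<bar> < \<delta> s" by (auto simp: dist_real_def)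
      have s0: "0 \<le> s" using s S by auto
      consider "s \<le> a" | "b < s" | "a < s" "s \<le> b" by linarith
      then show ?thesis
      proof cases
        case 1
        then have "dist (X a) (X s) < \<eta>/2" "dist (X b) (X s) < \<eta>/2" using R[OF s0] ab d by auto
        then have "dist (X b) (X a) < \<eta>" using dist_triangle2[of "X b" "X a" "X s"] by linarith
        then show ?thesis by (simp add: dist_norm)
      next
        case 2
        then have "dist (X a) (l s) < \<eta>/2" "dist (X b) (l s) < \<eta>/2" using L[OF s0] ab d by auto
        then have "dist (X b) (X a) < \<eta>" using dist_triangle2[of "X b" "X a" "l s"] by linarith
        then show ?thesis by (simp add: dist_norm)
      qed (use s(1) in auto)
    qed
    show "{s. 0 < s \<and> s \<le> t \<and> \<eta> \<le> norm (jump X s)} \<subseteq> S"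
    proof safe
      fix u assume u: "0 < u" "u \<le> t" "\<eta> \<le> norm (jump X u)"
      show "u \<in> S"
      proof (rule ccontr)
        assume "u \<notin> S"
        have "u \<in> {0..t}" using u by simp
        with S(3) have "u \<in> (\<Union>s\<in>S. ball s (\<delta> s))" by (rule subsetD)
        then obtain s where s: "s \<in> S" "u \<in> ball s (\<delta> s)" by (rule UN_E)
        have su: "s \<noteq> u" "0 \<le> s" using s S \<open>u \<notin> S\<close> by auto
        have us: "\<bar>s - u\<bar> < \<delta> s" using s by (auto simp: dist_real_def)
        have ll: "(X \<longlongrightarrow> left_lim X u) (at_left u)" using D0_left_lim[OF X u(1)] .
        \<comment> \<open>As u is not a centre, it lies strictly inside one half of a ball, together
          with all times slightly to its left; so X(u) and its left limit are both close to a single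
          value c.\<close>
        have "\<exists>c. dist (X u) c < \<eta>/2 \<and> (\<forall>\<^sub>F v in at_left u. dist (X v) c \<le> \<eta>/2)"
        proof (cases "s < u")
          case True
          have "\<forall>\<^sub>F v in at_left u. v \<in> {s<..<u}"
            using True by (rule eventually_at_left_real)
          then have "\<forall>\<^sub>F v in at_left u. dist (X v) (X s) \<le> \<eta>/2"
            by eventually_elim (use R[of s] us su in \<open>auto intro!: less_imp_le\<close>)
          then show ?thesis using True R[of s u] us su by auto
        next
          case False
          have "\<forall>\<^sub>F v in at_left u. v \<in> {s - \<delta> s<..<u}"
            using us by (intro eventually_at_left_real) auto
          then have "\<forall>\<^sub>F v in at_left u. dist (X v) (l s) \<le> \<eta>/2"
            by eventually_elim (use L[of s] us su False in \<open>auto intro!: less_imp_le\<close>)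
          then show ?thesis using False L[of s u] us su by auto
        qed
        then obtain c where c: "dist (X u) c < \<eta>/2" "\<forall>\<^sub>F v in at_left u. dist (X v) c \<le> \<eta>/2" by blast
        have "dist (left_lim X u) c \<le> \<eta>/2"
          by (rule tendsto_upperbound[OF tendsto_dist[OF ll tendsto_const] c(2)]) simp
        then have "dist (X u) (left_lim X u) < \<eta>"
          using c(1) dist_triangle2[of "X u" "left_lim X u" c] by linarith
        then show False using u by (simp add: jump_def dist_norm)
      qed
    qed
  qed
qed

lemma D0_finite_jumps:
  assumes "X \<in> D0" "0 < \<eta>"
  shows "finite {s. 0 < s \<and> s \<le> t \<and> \<eta> \<le> norm (jump X s)}"
  by (rule D0_oscillation[OF assms, of t]) (rule finite_subset)

lemma D0_countable_jumps:
  assumes "X \<in> D0"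
  shows "countable {s. 0 < s \<and> left_lim X s \<noteq> X s}"
proof -
  have "{s. 0 < s \<and> left_lim X s \<noteq> X s} \<subseteq> (\<Union>i j. {s. 0 < s \<and> s \<le> real j \<and> 1 / real (Suc i) \<le> norm (jump X s)})"
  proof safe
    fix s :: real assume s: "0 < s" "left_lim X s \<noteq> X s"
    then have "0 < norm (jump X s)" by (simp add: jump_def)
    then obtain i where "1 / real (Suc i) < norm (jump X s)" by (rule nat_approx_posE)
    moreover obtain j where "s \<le> real j" using real_arch_simple by blast
    ultimately show "s \<in> (\<Union>i j. {s. 0 < s \<and> s \<le> real j \<and> 1 / real (Suc i) \<le> norm (jump X s)})"
      using s unfolding UN_iff mem_Collect_eq by (meson UNIV_I less_imp_le)
  qed
  moreover have "countable (\<Union>i j. {s. 0 < s \<and> s \<le> real j \<and> 1 / real (Suc i) \<le> norm (jump X s)})"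
    by (intro countable_UN[OF countableI_type] countable_finite D0_finite_jumps[OF assms]) simp
  ultimately show ?thesis by (rule countable_subset)
qed

text \<open>On a fine grid, a cell that contains none of the finitely many times in \<open>S\<close>
  has an increment below \<epsilon>, which \<open>H\<close> ignores. The endpoints of a cell
  containing one of these times tend to it from the two sides, so the term of that cell tends to the
  jump term. No summability of the jumps enters.\<close>

lemma D0_jump_sum_limit:
  fixes H :: "'a::euclidean_space \<Rightarrow> 'a \<Rightarrow> 'b::real_normed_vector"
  assumes X: "X \<in> D0" and t: "0 \<le> t" and \<epsilon>: "0 < \<epsilon>"
    and H: "continuous_on UNIV (\<lambda>p. H (fst p) (snd p))"
    and H0: "\<And>a y. norm y < \<epsilon> \<Longrightarrow> H a y = 0"
  shows "(\<lambda>n. \<Sum>k<n. H (X (grid t n k)) (incr t n X k))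
     \<longlonglongrightarrow> (\<Sum>s\<in>{s. 0 < s \<and> s \<le> t \<and> \<epsilon> \<le> norm (jump X s)}. H (left_lim X s) (jump X s))"
proof -
  obtain S \<rho> where S: "finite S" and \<rho>: "0 < \<rho>"
    and osc: "\<And>a b. 0 \<le> a \<Longrightarrow> a \<le> b \<Longrightarrow> b \<le> t \<Longrightarrow> b - a < \<rho> \<Longrightarrow> norm (X b - X a) < \<epsilon> \<or> (\<exists>s\<in>S. a < s \<and> s \<le> b)"
    and jS: "{s. 0 < s \<and> s \<le> t \<and> \<epsilon> \<le> norm (jump X s)} \<subseteq> S"
    by (rule D0_oscillation[OF X \<epsilon>, of t]) (rule that)
  define S' where "S' = S \<inter> {0<..t}"
  have fS': "finite S'" using S by (simp add: S'_def)
  \<comment> \<open>Index of the cell containing s, with cells open on the left. The strict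
    inequality at the left endpoint makes the path there tend to the left limit and not to
    X(s).\<close>
  define \<kappa> where "\<kappa> n s = nat (\<lceil>s * real n / t\<rceil> - 1)" for n s
  have tpos: "0 < t" if "s \<in> S'" for s using that by (auto simp: S'_def)
  have \<kappa>: "grid t n (\<kappa> n s) < s" "s \<le> grid t n (Suc (\<kappa> n s))" "\<kappa> n s < n" if "s \<in> S'" "0 < n" for s n
  proof -
    have st: "0 < s" "s \<le> t" "0 < t" using that by (auto simp: S'_def)
    then have c: "\<lceil>s * real n / t\<rceil> \<ge> 1" using that by simp
    have r: "real (\<kappa> n s) = of_int \<lceil>s * real n / t\<rceil> - 1" using c by (simp add: \<kappa>_def)
    then have "real (\<kappa> n s) < s * real n / t" "s * real n / t \<le> real (\<kappa> n s) + 1" by linarith+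
    then show "grid t n (\<kappa> n s) < s" "s \<le> grid t n (Suc (\<kappa> n s))"
      using st that by (auto simp: grid_def divide_simps mult.commute add.commute)
    have "s * real n / t \<le> real n" using st that by (simp add: divide_simps mult.commute)
    with \<open>real (\<kappa> n s) < s * real n / t\<close> show "\<kappa> n s < n" by linarith
  qed
  have tn: "(\<lambda>n. t / real n) \<longlonglongrightarrow> 0"
    by (rule lim_const_over_n)
  have ev1: "\<forall>\<^sub>F n in sequentially. t / real n < \<rho>"
    using order_tendstoD(2)[OF tn \<rho>] .
  \<comment> \<open>Distinct times share no cell once the mesh is below their distance.\<close>
  have ev2: "\<forall>\<^sub>F n in sequentially. inj_on (\<kappa> n) S'"
  proof -
    have "\<forall>\<^sub>F n in sequentially. s \<noteq> s' \<longrightarrow> \<kappa> n s \<noteq> \<kappa> n s'" if ss: "s \<in> S'" "s' \<in> S'" for s s'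
    proof (cases "s = s'")
      case False
      then have "\<forall>\<^sub>F n in sequentially. t / real n < \<bar>s - s'\<bar>"
        using order_tendstoD(2)[OF tn, of "\<bar>s - s'\<bar>"] by simp
      then show ?thesis using eventually_gt_at_top[of 0]
      proof eventually_elim
        case (elim n)
        show ?case using \<kappa>[OF ss(1) elim(2)] \<kappa>[OF ss(2) elim(2)] elim(1)
          by (auto simp: grid_Suc)
      qed
    qed simp
    then have "\<forall>\<^sub>F n in sequentially. \<forall>s\<in>S'. \<forall>s'\<in>S'. s \<noteq> s' \<longrightarrow> \<kappa> n s \<noteq> \<kappa> n s'"
      by (intro eventually_ball_finite fS' ballI)
    then show ?thesis by eventually_elim (auto simp: inj_on_def)
  qed
  have lim: "(\<lambda>n. \<Sum>s\<in>S'. H (X (grid t n (\<kappa> n s))) (incr t n X (\<kappa> n s)))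
      \<longlonglongrightarrow> (\<Sum>s\<in>S'. H (left_lim X s) (jump X s))"
  proof (rule tendsto_sum)
    fix s assume s: "s \<in> S'"
    then have s0: "0 < s" by (auto simp: S'_def)
    have gl: "(\<lambda>n. grid t n (\<kappa> n s)) \<longlonglongrightarrow> s"
    proof (rule tendsto_sandwich)
      show "\<forall>\<^sub>F n in sequentially. s - t / real n \<le> grid t n (\<kappa> n s)"
        using eventually_gt_at_top[of 0] by eventually_elim (use \<kappa>(2)[OF s] in \<open>auto simp: grid_Suc algebra_simps\<close>)
      show "\<forall>\<^sub>F n in sequentially. grid t n (\<kappa> n s) \<le> s"
        using eventually_gt_at_top[of 0] by eventually_elim (use \<kappa>(1)[OF s] in \<open>auto simp: less_imp_le\<close>)
      show "(\<lambda>n. s - t / real n) \<longlonglongrightarrow> s" using tendsto_diff[OF tendsto_const tn, of s] by simp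
    qed simp
    have evg: "\<forall>\<^sub>F n in sequentially. grid t n (\<kappa> n s) \<in> {..<s} \<and> grid t n (\<kappa> n s) \<noteq> s"
      using eventually_gt_at_top[of 0] by eventually_elim (use \<kappa>(1)[OF s] in \<open>simp add: less_imp_neq\<close>)
    have "(\<lambda>n. X (grid t n (\<kappa> n s))) \<longlonglongrightarrow> left_lim X s"
      by (rule filterlim_compose[OF D0_left_lim[OF X s0]])
        (use gl evg in \<open>simp add: filterlim_at eventually_mono\<close>)
    moreover have "(\<lambda>n. X (grid t n (Suc (\<kappa> n s)))) \<longlonglongrightarrow> X s"
    proof (rule continuous_within_tendsto_compose[OF D0_continuous_right[OF X]])
      show "\<forall>\<^sub>F n in sequentially. grid t n (Suc (\<kappa> n s)) \<in> {s..}"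
        using eventually_gt_at_top[of 0] by eventually_elim (use \<kappa>(2)[OF s] in auto)
      show "(\<lambda>n. grid t n (Suc (\<kappa> n s))) \<longlonglongrightarrow> s"
        using tendsto_add[OF gl tn] by (simp add: grid_Suc)
    qed (use s0 in simp)
    ultimately have "(\<lambda>n. (X (grid t n (\<kappa> n s)), incr t n X (\<kappa> n s))) \<longlonglongrightarrow> (left_lim X s, jump X s)"
      unfolding incr_def jump_def by (intro tendsto_intros)
    from continuous_on_tendsto_compose[OF H this]
    show "(\<lambda>n. H (X (grid t n (\<kappa> n s))) (incr t n X (\<kappa> n s))) \<longlonglongrightarrow> H (left_lim X s) (jump X s)"
      by simp
  qed
  \<comment> \<open>\<open>S'\<close> may contain times whose jump is smaller than \<epsilon>;
    \<open>H\<close> vanishes there.\<close>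
  have "(\<Sum>s\<in>S'. H (left_lim X s) (jump X s)) = 
     (\<Sum>s\<in>{s. 0 < s \<and> s \<le> t \<and> \<epsilon> \<le> norm (jump X s)}. H (left_lim X s) (jump X s))"
    by (rule sum.mono_neutral_right) (use fS' jS H0 in \<open>auto simp: S'_def intro: leI\<close>)
  moreover have "\<forall>\<^sub>F n in sequentially. (\<Sum>s\<in>S'. H (X (grid t n (\<kappa> n s))) (incr t n X (\<kappa> n s)))
      = (\<Sum>k<n. H (X (grid t n k)) (incr t n X k))"
    using ev1 ev2 eventually_gt_at_top[of 0]
  proof eventually_elim
    case (elim n)
    have "(\<Sum>s\<in>S'. H (X (grid t n (\<kappa> n s))) (incr t n X (\<kappa> n s)))
       = (\<Sum>k\<in>\<kappa> n ` S'. H (X (grid t n k)) (incr t n X k))"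
      using elim(2) by (simp add: sum.reindex)
    also have "\<dots> = (\<Sum>k<n. H (X (grid t n k)) (incr t n X k))"
    proof (rule sum.mono_neutral_left)
      show "\<forall>k\<in>{..<n} - \<kappa> n ` S'. H (X (grid t n k)) (incr t n X k) = 0"
      proof
        fix k assume k: "k \<in> {..<n} - \<kappa> n ` S'"
        have "norm (incr t n X k) < \<epsilon> \<or> (\<exists>s\<in>S. grid t n k < s \<and> s \<le> grid t n (Suc k))"
          unfolding incr_def using k t elim(1)
          by (intro osc grid_nonneg grid_le) (auto simp: grid_Suc)
        \<comment> \<open>A cell that contains a time s of \<open>S\<close> is its cell
          \<open>\<kappa> n s\<close>, which has been excluded.\<close>
        moreover have False if s: "s \<in> S" "grid t n k < s" "s \<le> grid t n (Suc k)" for s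
        proof -
          have sS: "s \<in> S'" using s grid_nonneg[OF t, of n k] grid_le[OF t, of "Suc k" n] k by (auto simp: S'_def)
          have "\<kappa> n s = k"
          proof (rule antisym; rule ccontr)
            assume "\<not> \<kappa> n s \<le> k"
            then have "grid t n (Suc k) \<le> grid t n (\<kappa> n s)"
              using t by (auto simp: grid_def intro!: divide_right_mono mult_right_mono)
            then show False using \<kappa>[OF sS elim(3)] s by linarith
          next
            assume "\<not> k \<le> \<kappa> n s"
            then have "grid t n (Suc (\<kappa> n s)) \<le> grid t n k"
              using t by (auto simp: grid_def intro!: divide_right_mono mult_right_mono)
            then show False using \<kappa>[OF sS elim(3)] s by linarith
          qed
          then show False using k sS by auto
        qed
        ultimately show "H (X (grid t n k)) (incr t n X k) = 0" using H0 by blast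
      qed
    qed (use \<kappa>(3) elim in auto)
    finally show ?case .
  qed
  ultimately show ?thesis
    using lim by (simp add: Lim_transform_eventually)
qed

text \<open>The sum is the integral of F along the path read at \<open>\<phi> n s\<close>, which is
  s rounded up to the grid. Right continuity gives convergence at every s > 0, and F is bounded. The
  limit also supplies measurability in s, since the approximants are step functions.\<close>

lemma D0_set_integral_limit:
  fixes F :: "'a::euclidean_space \<Rightarrow> real"
  assumes X: "X \<in> D0" and t: "0 \<le> t" and F: "continuous_on UNIV F" and B: "\<And>z. \<bar>F z\<bar> \<le> B"
  shows D0_set_integrable: "set_integrable lborel {0<..t} (\<lambda>s. F (x + X s))"
    and "(\<lambda>n. \<Sum>k<n. t / real n * F (x + X (grid t n (Suc k)))) \<longlonglongrightarrow> (LBINT s:{0<..t}. F (x + X s))"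
proof -
  have "set_integrable lborel {0<..t} (\<lambda>s. F (x + X s)) \<and>
    (\<lambda>n. \<Sum>k<n. t / real n * F (x + X (grid t n (Suc k)))) \<longlonglongrightarrow> (LBINT s:{0<..t}. F (x + X s))"
  proof (cases "t = 0")
    case False
    with t have tpos: "0 < t" by simp
    define \<phi> where "\<phi> n s = t * of_int \<lceil>s * real n / t\<rceil> / real n" for n s
    have \<phi>: "s \<le> \<phi> n s" "\<phi> n s \<le> s + t / real n" if "0 < n" for n s
    proof -
      have "s = t * (s * real n / t) / real n" using tpos that by simp
      also have "\<dots> \<le> \<phi> n s" unfolding \<phi>_def using tpos by (intro divide_right_mono mult_left_mono) auto
      finally show "s \<le> \<phi> n s" .
      have "\<phi> n s \<le> t * (s * real n / t + 1) / real n" unfolding \<phi>_def using tpos 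
        by (intro divide_right_mono mult_left_mono) linarith+
      also have "\<dots> = s + t / real n" using tpos that by (simp add: field_simps)
      finally show "\<phi> n s \<le> s + t / real n" .
    qed
    have step: "(LBINT s:{0<..grid t n j}. F (x + X (\<phi> n s))) = (\<Sum>k<j. t / real n * F (x + X (grid t n (Suc k))))
       \<and> set_integrable lborel {0<..grid t n j} (\<lambda>s. F (x + X (\<phi> n s)))" 
      if n: "0 < n" for n j
    proof (induction j)
      case 0
      then show ?case by (simp add: grid_def set_lebesgue_integral_def)
    next
      case (Suc j)
      have gle: "grid t n j \<le> grid t n (Suc j)" "0 \<le> grid t n j" using t n by (auto simp: grid_Suc grid_nonneg)
      have eq: "indicator {grid t n j<..grid t n (Suc j)} s *\<^sub>R F (x + X (\<phi> n s)) 
         = indicator {grid t n j<..grid t n (Suc j)} s *\<^sub>R F (x + X (grid t n (Suc j)))" for s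
      proof (cases "s \<in> {grid t n j<..grid t n (Suc j)}")
        case True
        then have "real j < s * real n / t" "s * real n / t \<le> real (Suc j)"
          using tpos n by (auto simp: grid_def field_simps)
        then have "\<lceil>s * real n / t\<rceil> = int (Suc j)" by (simp add: ceiling_eq_iff)
        then show ?thesis by (simp add: \<phi>_def grid_def mult.commute)
      qed simp
      have i2: "set_integrable lborel {grid t n j<..grid t n (Suc j)} (\<lambda>s. F (x + X (\<phi> n s)))"
        unfolding set_integrable_def eq using gle
        by (intro integrable_scaleR_left integrable_real_indicator) auto
      have v2: "(LBINT s:{grid t n j<..grid t n (Suc j)}. F (x + X (\<phi> n s))) = t / real n * F (x + X (grid t n (Suc j)))"
        unfolding set_lebesgue_integral_def eq using gle by (simp add: grid_Suc)
      have U: "{0<..grid t n (Suc j)} = {0<..grid t n j} \<union> {grid t n j<..grid t n (Suc j)}" using gle by auto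
      show ?case using Suc i2 v2 unfolding U
        by (subst set_integral_Un) (auto intro!: set_integrable_Un)
    qed
    have full: "grid t n n = t" if "0 < n" for n using that by (simp add: grid_def)
    have conv: "(\<lambda>n. F (x + X (\<phi> n s))) \<longlonglongrightarrow> F (x + X s)" if s: "0 < s" for s
    proof -
      have "(\<lambda>n. \<phi> n s) \<longlonglongrightarrow> s"
      proof (rule tendsto_sandwich)
        show "\<forall>\<^sub>F n in sequentially. s \<le> \<phi> n s" "\<forall>\<^sub>F n in sequentially. \<phi> n s \<le> s + t / real n"
          using eventually_gt_at_top[of 0] by (eventually_elim, use \<phi> in auto)+
        show "(\<lambda>n. s + t / real n) \<longlonglongrightarrow> s"
          using tendsto_add[OF tendsto_const lim_const_over_n[of t], of s] by simp
      qed simp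
      moreover have "\<forall>\<^sub>F n in sequentially. \<phi> n s \<in> {s..}"
        using eventually_gt_at_top[of 0] by eventually_elim (use \<phi>(1) in auto)
      ultimately have "(\<lambda>n. X (\<phi> n s)) \<longlonglongrightarrow> X s"
        using s by (intro continuous_within_tendsto_compose[OF D0_continuous_right[OF X]]) auto
      then have "(\<lambda>n. x + X (\<phi> n s)) \<longlonglongrightarrow> x + X s" by (intro tendsto_intros)
      then show ?thesis by (rule continuous_on_tendsto_compose[OF F]) auto
    qed
    \<comment> \<open>The index \<open>Suc n\<close> keeps clear of n = 0, where \<phi>
      degenerates.\<close>
    have meas: "(\<lambda>s. indicator {0<..t} s *\<^sub>R F (x + X (\<phi> (Suc n) s))) \<in> borel_measurable lborel" for n
      using borel_measurable_integrable[OF step[OF zero_less_Suc, of n "Suc n", THEN conjunct2, unfolded full[OF zero_less_Suc] set_integrable_def]] .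
    have lim: "(\<lambda>n. indicator {0<..t} s *\<^sub>R F (x + X (\<phi> (Suc n) s))) \<longlonglongrightarrow> indicator {0<..t} s *\<^sub>R F (x + X s)" for s
      using LIMSEQ_Suc[OF conv, of s] by (cases "0 < s") (auto simp: indicator_def)
    have meas2: "(\<lambda>s. indicator {0<..t} s *\<^sub>R F (x + X s)) \<in> borel_measurable lborel"
      by (rule borel_measurable_LIMSEQ_metric[where f = "\<lambda>n s. indicator {0<..t} s *\<^sub>R F (x + X (\<phi> (Suc n) s))"])
        (rule meas, rule lim)
    have iB: "integrable lborel (\<lambda>s. indicator {0<..t} s * B)"
      using t by (intro integrable_mult_left) simp
    have "(\<lambda>n. LBINT s:{0<..t}. F (x + X (\<phi> (Suc n) s))) \<longlonglongrightarrow> (LBINT s:{0<..t}. F (x + X s))"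
      unfolding set_lebesgue_integral_def
    proof (rule integral_dominated_convergence[OF meas2 meas iB])
      show "AE s in lborel. (\<lambda>n. indicator {0<..t} s *\<^sub>R F (x + X (\<phi> (Suc n) s))) \<longlonglongrightarrow> indicator {0<..t} s *\<^sub>R F (x + X s)"
        using lim by simp
      show "AE s in lborel. norm (indicator {0<..t} s *\<^sub>R F (x + X (\<phi> (Suc n) s))) \<le> indicator {0<..t} s * B" for n
        using B by (intro AE_I2) (simp add: indicator_def)
    qed
    then have "(\<lambda>n. \<Sum>k<Suc n. t / real (Suc n) * F (x + X (grid t (Suc n) (Suc k)))) \<longlonglongrightarrow> (LBINT s:{0<..t}. F (x + X s))"
      by (simp only: step[OF zero_less_Suc, of n "Suc n" for n, THEN conjunct1, unfolded full[OF zero_less_Suc]])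
    then have "(\<lambda>n. \<Sum>k<n. t / real n * F (x + X (grid t n (Suc k)))) \<longlonglongrightarrow> (LBINT s:{0<..t}. F (x + X s))"
      by (rule LIMSEQ_imp_Suc)
    moreover have "set_integrable lborel {0<..t} (\<lambda>s. F (x + X s))"
      unfolding set_integrable_def
    proof (rule Bochner_Integration.integrable_bound[OF iB meas2])
      have "\<bar>F z\<bar> \<le> \<bar>B\<bar>" for z using B[of z] by linarith
      then show "AE s in lborel. norm (indicat_real {0<..t} s *\<^sub>R F (x + X s)) \<le> norm (indicat_real {0<..t} s * B)"
        by (intro AE_I2) (simp add: indicator_def)
    qed
    ultimately show ?thesis by blast
  qed (simp add: set_lebesgue_integral_def set_integrable_def)
  then show "set_integrable lborel {0<..t} (\<lambda>s. F (x + X s))"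
    "(\<lambda>n. \<Sum>k<n. t / real n * F (x + X (grid t n (Suc k)))) \<longlonglongrightarrow> (LBINT s:{0<..t}. F (x + X s))"
    by auto
qed

section \<open>Second moments of discretized stochastic integrals\<close>

text \<open>Vectors are encoded by their coordinates: the real families indexed by
  \<open>I \<times> Basis\<close> have equal joint transforms, and the measurable map
  \<open>\<Phi>\<close> recovers the vectors.\<close>

lemma distr_PiM_eqI_char_fun_euclidean:
  fixes X :: "'i \<Rightarrow> 's \<Rightarrow> 'a::euclidean_space" and Y :: "'i \<Rightarrow> 't \<Rightarrow> 'a"
  assumes "finite_measure M" "finite_measure N"
    and X: "\<And>i. i \<in> I \<Longrightarrow> X i \<in> borel_measurable M"
    and Y: "\<And>i. i \<in> I \<Longrightarrow> Y i \<in> borel_measurable N"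
    and I: "finite I"
    and eq: "\<And>\<xi>. (LINT w|M. cis (\<Sum>i\<in>I. \<xi> i \<bullet> X i w)) = (LINT w|N. cis (\<Sum>i\<in>I. \<xi> i \<bullet> Y i w))"
  shows "distr M (PiM I (\<lambda>_. borel)) (\<lambda>w. \<lambda>i\<in>I. X i w) = distr N (PiM I (\<lambda>_. borel)) (\<lambda>w. \<lambda>i\<in>I. Y i w)"
proof -
  let ?K = "I \<times> (Basis :: 'a set)"
  define U where "U = (\<lambda>p w. X (fst p) w \<bullet> snd p)"
  define W where "W = (\<lambda>p w. Y (fst p) w \<bullet> snd p)"
  have mU: "U p \<in> borel_measurable M" if "p \<in> ?K" for p
    using that unfolding U_def by (intro borel_measurable_inner X) auto
  have mW: "W p \<in> borel_measurable N" if "p \<in> ?K" for p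
    using that unfolding W_def by (intro borel_measurable_inner Y) auto
  have lin: "(\<Sum>p\<in>?K. \<xi> p * (Z (fst p) \<bullet> snd p)) = (\<Sum>i\<in>I. (\<Sum>b\<in>Basis. \<xi> (i, b) *\<^sub>R b) \<bullet> Z i)"
    for \<xi> and Z :: "'i \<Rightarrow> 'a"
  proof -
    have "(\<Sum>p\<in>?K. \<xi> p * (Z (fst p) \<bullet> snd p)) = (\<Sum>i\<in>I. \<Sum>b\<in>Basis. \<xi> (i, b) * (Z i \<bullet> b))"
      by (simp add: sum.cartesian_product case_prod_beta)
    also have "\<dots> = (\<Sum>i\<in>I. (\<Sum>b\<in>Basis. \<xi> (i, b) *\<^sub>R b) \<bullet> Z i)"
      by (intro sum.cong refl, subst inner_sum_left, intro sum.cong refl) (simp add: inner_commute)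
    finally show ?thesis .
  qed
  have D: "distr M (PiM ?K (\<lambda>_. borel)) (\<lambda>w. \<lambda>p\<in>?K. U p w) = distr N (PiM ?K (\<lambda>_. borel)) (\<lambda>w. \<lambda>p\<in>?K. W p w)"
  proof (rule distr_PiM_eqI_char_fun)
    fix \<xi> :: "'i \<times> 'a \<Rightarrow> real"
    show "(LINT w|M. cis (\<Sum>p\<in>?K. \<xi> p * U p w)) = (LINT w|N. cis (\<Sum>p\<in>?K. \<xi> p * W p w))"
      by (simp only: U_def W_def lin[of _ "\<lambda>i. X i w" for w] lin[of _ "\<lambda>i. Y i w" for w] eq)
  qed (use assms mU mW in auto)
  define \<Phi> where "\<Phi> = (\<lambda>\<omega> :: 'i \<times> 'a \<Rightarrow> real. \<lambda>i\<in>I. \<Sum>b\<in>(Basis::'a set). \<omega> (i, b) *\<^sub>R b)"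
  have \<Phi>: "\<Phi> \<in> measurable (PiM ?K (\<lambda>_. borel)) (PiM I (\<lambda>_. borel))"
    unfolding \<Phi>_def
    by (intro measurable_restrict borel_measurable_sum borel_measurable_scaleR measurable_component_singleton) auto
  have push: "distr L (PiM I (\<lambda>_. borel)) (\<lambda>w. \<lambda>i\<in>I. Z i w)
      = distr (distr L (PiM ?K (\<lambda>_. borel)) (\<lambda>w. \<lambda>p\<in>?K. Z (fst p) w \<bullet> snd p)) (PiM I (\<lambda>_. borel)) \<Phi>"
    if Z: "\<And>i. i \<in> I \<Longrightarrow> Z i \<in> borel_measurable L" for L and Z :: "'i \<Rightarrow> 'z \<Rightarrow> 'a"
  proof (subst distr_distr[OF \<Phi>])
    show "(\<lambda>w. \<lambda>p\<in>?K. Z (fst p) w \<bullet> snd p) \<in> measurable L (PiM ?K (\<lambda>_. borel))"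
      by (intro measurable_restrict borel_measurable_inner Z) auto
    have "(\<lambda>i\<in>I. Z i w) = \<Phi> (\<lambda>p\<in>?K. Z (fst p) w \<bullet> snd p)" for w
      by (auto simp: \<Phi>_def fun_eq_iff euclidean_representation)
    then show "distr L (PiM I (\<lambda>_. borel)) (\<lambda>w. \<lambda>i\<in>I. Z i w)
       = distr L (PiM I (\<lambda>_. borel)) (\<Phi> \<circ> (\<lambda>w. \<lambda>p\<in>?K. Z (fst p) w \<bullet> snd p))"
      by (simp add: comp_def)
  qed
  have "distr M (PiM I (\<lambda>_. borel)) (\<lambda>w. \<lambda>i\<in>I. X i w)
      = distr (distr M (PiM ?K (\<lambda>_. borel)) (\<lambda>w. \<lambda>p\<in>?K. U p w)) (PiM I (\<lambda>_. borel)) \<Phi>"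
    unfolding U_def by (rule push) (rule X)
  also note D
  also have "distr (distr N (PiM ?K (\<lambda>_. borel)) (\<lambda>w. \<lambda>p\<in>?K. W p w)) (PiM I (\<lambda>_. borel)) \<Phi>
      = distr N (PiM I (\<lambda>_. borel)) (\<lambda>w. \<lambda>i\<in>I. Y i w)"
    unfolding W_def by (rule push[symmetric]) (rule Y)
  finally show ?thesis .
qed

lemma square_le_one_minus_cos:
  fixes z :: real
  assumes "\<bar>z\<bar> \<le> 1"
  shows "z\<^sup>2 \<le> 4 * (1 - cos z)"
proof -
  have s: "z / 2 \<le> sin z" if z: "0 \<le> z" "z \<le> 1" for z :: real
  proof -
    have "sin 0 - 0 / 2 \<le> sin z - z / 2"
    proof (rule DERIV_nonneg_imp_nondecreasing[OF z(1)])
      fix x assume x: "0 \<le> x" "x \<le> z"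
      \<comment> \<open>Since 1 < pi / 3, the cosine is at least 1/2 on [0, 1]; integrating twice
        produces the factor 4.\<close>
      have "cos (pi / 3) \<le> cos x" using x z pi_gt3 by (intro cos_monotone_0_pi_le) auto
      then show "\<exists>y. ((\<lambda>z. sin z - z / 2) has_real_derivative y) (at x) \<and> 0 \<le> y"
        by (intro exI[of _ "cos x - 1/2"]) (auto intro!: derivative_eq_intros simp: cos_60)
    qed
    then show ?thesis by simp
  qed
  have c: "z\<^sup>2 \<le> 4 * (1 - cos z)" if z: "0 \<le> z" "z \<le> 1" for z :: real
  proof -
    have "4 * (1 - cos 0) - 0\<^sup>2 \<le> 4 * (1 - cos z) - z\<^sup>2"
    proof (rule DERIV_nonneg_imp_nondecreasing[OF z(1)])
      fix x assume x: "0 \<le> x" "x \<le> z"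
      then show "\<exists>y. ((\<lambda>z. 4 * (1 - cos z) - z\<^sup>2) has_real_derivative y) (at x) \<and> 0 \<le> y"
        using s[of x] z by (intro exI[of _ "4 * sin x - 2 * x"]) (auto intro!: derivative_eq_intros)
    qed
    then show ?thesis by simp
  qed
  show ?thesis using c[of z] c[of "- z"] assms by (cases "0 \<le> z") auto
qed

text \<open>
  Comparable with the square of norm y / delta for norm y below delta, and integrated explicitly
  by means of the characteristic function.
\<close>
definition Qcos :: "real \<Rightarrow> 'a::euclidean_space \<Rightarrow> real" where
  "Qcos \<delta> y = (\<Sum>b\<in>Basis. 1 - cos (((1 / \<delta>) *\<^sub>R b) \<bullet> y))"

lemma Qcos_bounds: "0 \<le> Qcos \<delta> y" "Qcos \<delta> (y::'a::euclidean_space) \<le> 2 * real DIM('a)"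
proof -
  show "0 \<le> Qcos \<delta> y" unfolding Qcos_def by (intro sum_nonneg) simp
  have "Qcos \<delta> y \<le> (\<Sum>b\<in>(Basis::'a set). 2)" unfolding Qcos_def
    by (intro sum_mono) (use cos_ge_minus_one in \<open>smt (verit)\<close>)
  then show "Qcos \<delta> y \<le> 2 * real DIM('a)" by simp
qed

lemma Qcos_measurable [measurable]: "Qcos \<delta> \<in> borel_measurable borel"
  unfolding Qcos_def[abs_def] by measurable

lemma norm_square_le_Qcos:
  fixes y :: "'a::euclidean_space"
  assumes "0 < \<delta>" "norm y \<le> \<delta>"
  shows "(norm y)\<^sup>2 \<le> 4 * \<delta>\<^sup>2 * Qcos \<delta> y"
proof -
  have "(norm y)\<^sup>2 = (\<Sum>b\<in>Basis. (y \<bullet> b)\<^sup>2)"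
    unfolding power2_norm_eq_inner by (subst euclidean_inner) (simp add: power2_eq_square)
  also have "\<dots> \<le> (\<Sum>b\<in>Basis. 4 * \<delta>\<^sup>2 * (1 - cos (((1 / \<delta>) *\<^sub>R b) \<bullet> y)))"
  proof (rule sum_mono)
    fix b :: 'a assume b: "b \<in> Basis"
    have "\<bar>y \<bullet> b\<bar> \<le> \<delta>" using Basis_le_norm[OF b, of y] assms by linarith
    then have "((y \<bullet> b) / \<delta>)\<^sup>2 \<le> 4 * (1 - cos ((y \<bullet> b) / \<delta>))"
      using assms by (intro square_le_one_minus_cos) (simp add: abs_divide)
    then have "\<delta>\<^sup>2 * ((y \<bullet> b) / \<delta>)\<^sup>2 \<le> \<delta>\<^sup>2 * (4 * (1 - cos ((y \<bullet> b) / \<delta>)))"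
      by (intro mult_left_mono) auto
    then show "(y \<bullet> b)\<^sup>2 \<le> 4 * \<delta>\<^sup>2 * (1 - cos (((1 / \<delta>) *\<^sub>R b) \<bullet> y))"
      using assms by (simp add: power_divide inner_commute algebra_simps)
  qed
  finally show ?thesis by (simp add: Qcos_def sum_distrib_left)
qed

lemma (in finite_measure) integrable_cis:
  assumes "f \<in> borel_measurable M"
  shows "integrable M (\<lambda>x. cis (f x))"
proof -
  have "(\<lambda>x. cis (f x)) \<in> borel_measurable M" using assms unfolding cis_conv_exp by measurable
  then show ?thesis by (intro integrable_const_bound[where B=1]) auto
qed

section \<open>Cosine moments, independence and symmetry of the increments\<close>

locale rel_levy =
  fixes M :: "(real \<Rightarrow> 'a::euclidean_space) measure" and m t :: real
  assumes law: "rel_levy_law M m" and m_nonneg: "0 \<le> m" and t_nonneg: "0 \<le> t"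
begin

sublocale prob_space M using law by (simp add: rel_levy_law_def)

lemma space_M: "space M = D0" using law by (simp add: rel_levy_law_def)

lemma coordinate_measurable: "0 \<le> s \<Longrightarrow> (\<lambda>X. X s) \<in> borel_measurable M"
proof (rule measurableI)
  fix B :: "'a set" assume "0 \<le> s" "B \<in> sets borel"
  then have "{X \<in> D0. X s \<in> B} \<in> D0_sets" unfolding D0_sets_def by (intro sigma_sets.Basic) auto
  then show "(\<lambda>X. X s) -` B \<inter> space M \<in> sets M"
    using law by (simp add: rel_levy_law_def vimage_def Int_def conj_commute)
qed simp

lemma grid_measurable [measurable]: "(\<lambda>X. X (grid t n k)) \<in> borel_measurable M"
  by (intro coordinate_measurable grid_nonneg t_nonneg)

lemma t_measurable [measurable]: "(\<lambda>X. X t) \<in> borel_measurable M"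
  by (intro coordinate_measurable t_nonneg)

lemma incr_measurable [measurable]: "(\<lambda>X. incr t n X k) \<in> borel_measurable M"
  unfolding incr_def by measurable

text \<open>The characteristic exponent, which is the symbol of the relativistic kinetic energy sqrt
  (-Laplacian + m^2) - m.\<close>

definition symb :: "'a \<Rightarrow> real" where
  "symb \<xi> = sqrt ((norm \<xi>)\<^sup>2 + m\<^sup>2) - m"

lemma symb_bounds: "0 \<le> symb \<xi>" "symb \<xi> \<le> norm \<xi>" "symb (- \<xi>) = symb \<xi>" "symb 0 = 0"
proof -
  have "m = sqrt (m\<^sup>2)" using m_nonneg by simp
  also have "\<dots> \<le> sqrt ((norm \<xi>)\<^sup>2 + m\<^sup>2)" by (intro real_sqrt_le_mono) simp
  finally show "0 \<le> symb \<xi>" by (simp add: symb_def)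
  have "sqrt ((norm \<xi>)\<^sup>2 + m\<^sup>2) \<le> norm \<xi> + m" using m_nonneg sqrt_sum_squares_le_sum[of "norm \<xi>" m] by simp
  then show "symb \<xi> \<le> norm \<xi>" by (simp add: symb_def)
qed (auto simp: symb_def m_nonneg)

lemma char_fun_incr:
  "(LINT X|M. cis (\<Sum>k<n. \<xi> k \<bullet> incr t n X k)) = (\<Prod>k<n. complex_of_real (exp (- (t / real n) * symb (\<xi> k))))"
proof -
  have "grid t n 0 = 0 \<and> (\<forall>j<n. grid t n j \<le> grid t n (Suc j))"
    using t_nonneg by (auto simp: grid_def divide_right_mono mult_right_mono)
  from law[unfolded rel_levy_law_def, THEN conjunct2, THEN conjunct2, THEN conjunct2, rule_format, OF this, of \<xi>]
  show ?thesis by (simp add: incr_def symb_def grid_Suc)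
qed

lemma expectation_cos_incr:
  assumes "k < n"
  shows "expectation (\<lambda>X. cos (\<xi> \<bullet> incr t n X k)) = exp (- (t / real n) * symb \<xi>)"
proof -
  have "(\<Sum>i<n. (if i = k then \<xi> else 0) \<bullet> incr t n X i) = \<xi> \<bullet> incr t n X k" for X
    using assms by (subst sum.remove[of _ k]) auto
  moreover have "(\<Prod>i<n. complex_of_real (exp (- (t / real n) * symb (if i = k then \<xi> else 0)))) = complex_of_real (exp (- (t / real n) * symb \<xi>))"
    using assms by (subst prod.remove[of _ k]) (auto simp: symb_bounds)
  ultimately have "(LINT X|M. cis (\<xi> \<bullet> incr t n X k)) = complex_of_real (exp (- (t / real n) * symb \<xi>))"
    using char_fun_incr[of "\<lambda>i. if i = k then \<xi> else 0" n] by simp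
  then have "Re (LINT X|M. cis (\<xi> \<bullet> incr t n X k)) = exp (- (t / real n) * symb \<xi>)" by simp
  then show ?thesis
    using integral_Re[OF integrable_cis, of "\<lambda>X. \<xi> \<bullet> incr t n X k"] by simp
qed

text \<open>Independence of two increments at the level of cosines. The product is half the sum of
  the cosines of the sum and of the difference of the arguments, and these have the same expectation
  because \<open>symb\<close> is even.\<close>

lemma expectation_cos_cos_incr:
  assumes "k < n" "j < n" "j \<noteq> k"
  shows "expectation (\<lambda>X. cos (\<xi> \<bullet> incr t n X k) * cos (\<eta> \<bullet> incr t n X j))
       = exp (- (t / real n) * symb \<xi>) * exp (- (t / real n) * symb \<eta>)"
proof -
  have two: "expectation (\<lambda>X. cos (\<xi> \<bullet> incr t n X k + \<zeta> \<bullet> incr t n X j))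
       = exp (- (t / real n) * symb \<xi>) * exp (- (t / real n) * symb \<zeta>)" for \<zeta>
  proof -
    let ?\<xi> = "\<lambda>i. if i = k then \<xi> else if i = j then \<zeta> else 0"
    have "(\<Sum>i<n. ?\<xi> i \<bullet> incr t n X i) = \<xi> \<bullet> incr t n X k + \<zeta> \<bullet> incr t n X j" for X
      using assms by (subst sum.remove[of _ k], simp, simp, subst sum.remove[of _ j]) auto
    moreover have "(\<Prod>i<n. complex_of_real (exp (- (t / real n) * symb (?\<xi> i))))
        = complex_of_real (exp (- (t / real n) * symb \<xi>) * exp (- (t / real n) * symb \<zeta>))"
      using assms by (subst prod.remove[of _ k], simp, simp, subst prod.remove[of _ j]) (auto simp: symb_bounds)
    ultimately have "(LINT X|M. cis (\<xi> \<bullet> incr t n X k + \<zeta> \<bullet> incr t n X j)) = complex_of_real (exp (- (t / real n) * symb \<xi>) * exp (- (t / real n) * symb \<zeta>))"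
      using char_fun_incr[of ?\<xi> n] by (simp only:)
    then have "Re (LINT X|M. cis (\<xi> \<bullet> incr t n X k + \<zeta> \<bullet> incr t n X j)) = exp (- (t / real n) * symb \<xi>) * exp (- (t / real n) * symb \<zeta>)" by simp
    then show ?thesis
      using integral_Re[OF integrable_cis, of "\<lambda>X. \<xi> \<bullet> incr t n X k + \<zeta> \<bullet> incr t n X j"] by simp
  qed
  have i: "integrable M (\<lambda>X. cos (\<xi> \<bullet> incr t n X k + \<zeta> \<bullet> incr t n X j))" for \<zeta>
    by (intro integrable_const_bound[where B=1]) auto
  have "expectation (\<lambda>X. cos (\<xi> \<bullet> incr t n X k) * cos (\<eta> \<bullet> incr t n X j))
     = expectation (\<lambda>X. (cos (\<xi> \<bullet> incr t n X k + \<eta> \<bullet> incr t n X j) + cos (\<xi> \<bullet> incr t n X k + (- \<eta>) \<bullet> incr t n X j)) / 2)"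
    by (intro Bochner_Integration.integral_cong refl) (simp add: cos_add cos_diff)
  also have "\<dots> = exp (- (t / real n) * symb \<xi>) * exp (- (t / real n) * symb \<eta>)"
    using i[of \<eta>] i[of "- \<eta>"] two[of \<eta>] two[of "- \<eta>"] by (simp add: symb_bounds)
  finally show ?thesis .
qed

lemma integrable_Qcos: "integrable M (\<lambda>X. Qcos \<delta> (incr t n X k))"
  by (intro integrable_const_bound[where B="2 * real DIM('a)"] AE_I2) (simp_all add: Qcos_bounds)

lemma integrable_Qcos2: "integrable M (\<lambda>X. Qcos \<delta> (incr t n X k) * Qcos \<delta> (incr t n X j))"
proof (rule integrable_const_bound[where B="(2 * real DIM('a)) * (2 * real DIM('a))"])
  have "Qcos \<delta> (u::'a) * Qcos \<delta> v \<le> (2 * real DIM('a)) * (2 * real DIM('a))" for u v :: 'a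
    by (intro mult_mono Qcos_bounds) auto
  then show "AE X in M. norm (Qcos \<delta> (incr t n X k) * Qcos \<delta> (incr t n X j)) \<le> (2 * real DIM('a)) * (2 * real DIM('a))"
    by (intro AE_I2) (simp only: real_norm_def abs_mult abs_of_nonneg[OF Qcos_bounds(1)])
qed measurable

lemma expectation_Qcos_eq:
  assumes "k < n"
  shows "expectation (\<lambda>X. Qcos \<delta> (incr t n X k)) = (\<Sum>b\<in>Basis. 1 - exp (- (t / real n) * symb ((1 / \<delta>) *\<^sub>R b)))"
proof -
  have i: "integrable M (\<lambda>X. cos (\<xi> \<bullet> incr t n X k))" for \<xi>
    by (intro integrable_const_bound[where B=1]) auto
  have e: "expectation (\<lambda>X. 1 - cos (\<xi> \<bullet> incr t n X k)) = 1 - exp (- (t / real n) * symb \<xi>)" for \<xi>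
    using i[of \<xi>] expectation_cos_incr[OF assms, of \<xi>] by (simp add: prob_space)
  have "expectation (\<lambda>X. \<Sum>b\<in>Basis. 1 - cos (((1 / \<delta>) *\<^sub>R b) \<bullet> incr t n X k))
     = (\<Sum>b\<in>Basis. expectation (\<lambda>X. 1 - cos (((1 / \<delta>) *\<^sub>R b) \<bullet> incr t n X k)))"
    by (intro Bochner_Integration.integral_sum Bochner_Integration.integrable_diff i) simp
  then show ?thesis unfolding Qcos_def by (simp only: e)
qed

text \<open>By 1 - exp (-u) \<le> u and \<open>symb \<xi> \<le> norm \<xi>\<close>, each of the d
  frequencies b / \<delta> contributes at most (t / n) / \<delta>, whatever the mass.\<close>

lemma expectation_Qcos_le:
  assumes "k < n" "0 < \<delta>"
  shows "expectation (\<lambda>X. Qcos \<delta> (incr t n X k)) \<le> real DIM('a) * (t / real n) / \<delta>"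
proof -
  have "expectation (\<lambda>X. Qcos \<delta> (incr t n X k)) \<le> (\<Sum>b\<in>(Basis::'a set). (t / real n) / \<delta>)"
    unfolding expectation_Qcos_eq[OF assms(1)]
  proof (rule sum_mono)
    fix b :: 'a assume b: "b \<in> Basis"
    have "1 - exp (- (t / real n) * symb ((1 / \<delta>) *\<^sub>R b)) \<le> (t / real n) * symb ((1 / \<delta>) *\<^sub>R b)"
      using exp_ge_add_one_self[of "- (t / real n) * symb ((1 / \<delta>) *\<^sub>R b)"] by simp
    also have "\<dots> \<le> (t / real n) * norm ((1 / \<delta>) *\<^sub>R b)"
      using t_nonneg by (intro mult_left_mono symb_bounds) auto
    also have "\<dots> = (t / real n) / \<delta>" using b assms by simp
    finally show "1 - exp (- (t / real n) * symb ((1 / \<delta>) *\<^sub>R b)) \<le> (t / real n) / \<delta>" .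
  qed
  then show ?thesis by simp
qed

text \<open>Cosine moments of two different increments factorize, hence so do those of linear
  combinations of cosines.\<close>

lemma expectation_Qcos_mult:
  assumes "k < n" "j < n" "j \<noteq> k"
  shows "expectation (\<lambda>X. Qcos \<delta> (incr t n X k) * Qcos \<delta> (incr t n X j))
       = expectation (\<lambda>X. Qcos \<delta> (incr t n X k)) * expectation (\<lambda>X. Qcos \<delta> (incr t n X j))"
proof -
  have i: "integrable M (\<lambda>X. cos (\<xi> \<bullet> incr t n X k))" for \<xi> k
    by (intro integrable_const_bound[where B=1]) auto
  have i2: "integrable M (\<lambda>X. cos (\<xi> \<bullet> incr t n X k) * cos (\<eta> \<bullet> incr t n X j))" for \<xi> \<eta>
    by (intro integrable_const_bound[where B=1]) (auto simp: abs_mult intro!: mult_le_one)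
  have e: "(1 - cos u) * (1 - cos v) = 1 - cos u - cos v + cos u * cos v" for u v :: real
    by (simp add: algebra_simps)
  have pr: "expectation (\<lambda>X. (1 - cos (\<xi> \<bullet> incr t n X k)) * (1 - cos (\<eta> \<bullet> incr t n X j)))
      = (1 - exp (- (t / real n) * symb \<xi>)) * (1 - exp (- (t / real n) * symb \<eta>))" for \<xi> \<eta>
    unfolding e using i i2 expectation_cos_incr assms expectation_cos_cos_incr[OF assms]
    by (simp add: prob_space) (simp add: algebra_simps)
  have i3: "integrable M (\<lambda>X. (1 - cos (\<xi> \<bullet> incr t n X k)) * (1 - cos (\<eta> \<bullet> incr t n X j)))" for \<xi> \<eta>
    unfolding e using i i2 by simp
  have "expectation (\<lambda>X. Qcos \<delta> (incr t n X k) * Qcos \<delta> (incr t n X j))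
    = expectation (\<lambda>X. \<Sum>b\<in>Basis. \<Sum>c\<in>Basis. (1 - cos (((1 / \<delta>) *\<^sub>R b) \<bullet> incr t n X k)) * (1 - cos (((1 / \<delta>) *\<^sub>R c) \<bullet> incr t n X j)))"
    unfolding Qcos_def sum_product ..
  also have "\<dots> = (\<Sum>b\<in>Basis. expectation (\<lambda>X. \<Sum>c\<in>Basis. (1 - cos (((1 / \<delta>) *\<^sub>R b) \<bullet> incr t n X k)) * (1 - cos (((1 / \<delta>) *\<^sub>R c) \<bullet> incr t n X j))))"
    by (intro Bochner_Integration.integral_sum Bochner_Integration.integrable_sum i3)
  also have "\<dots> = (\<Sum>b\<in>Basis. \<Sum>c\<in>Basis. expectation (\<lambda>X. (1 - cos (((1 / \<delta>) *\<^sub>R b) \<bullet> incr t n X k)) * (1 - cos (((1 / \<delta>) *\<^sub>R c) \<bullet> incr t n X j))))"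
    by (intro sum.cong refl Bochner_Integration.integral_sum i3)
  also have "\<dots> = (\<Sum>b\<in>Basis. \<Sum>c\<in>Basis. (1 - exp (- (t / real n) * symb ((1 / \<delta>) *\<^sub>R b))) * (1 - exp (- (t / real n) * symb ((1 / \<delta>) *\<^sub>R c))))"
    by (simp only: pr)
  finally show ?thesis
    unfolding expectation_Qcos_eq[OF assms(1)] expectation_Qcos_eq[OF assms(2)] sum_product .
qed

text \<open>The n diagonal terms are at most 2 d times a mean of order 1 / n, and the off-diagonal
  terms are, by independence, products of two such means; therefore the bound is free of n.\<close>

lemma expectation_sum_Qcos_square_le:
  assumes \<delta>: "0 < \<delta>"
  shows "expectation (\<lambda>X. (\<Sum>k<n. Qcos \<delta> (incr t n X k))\<^sup>2)
    \<le> 2 * (real DIM('a))\<^sup>2 * t / \<delta> + (real DIM('a))\<^sup>2 * t\<^sup>2 / \<delta>\<^sup>2"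
proof (cases "n = 0")
  case True
  then show ?thesis using t_nonneg \<delta> by simp
next
  case False
  define d where "d = real DIM('a)"
  define h where "h = t / real n"
  have h0: "0 \<le> h" using t_nonneg by (simp add: h_def)
  have q: "expectation (\<lambda>X. Qcos \<delta> (incr t n X k)) \<le> d * h / \<delta>" if "k < n" for k
    using expectation_Qcos_le[OF that \<delta>] by (simp add: d_def h_def)
  have q0: "0 \<le> expectation (\<lambda>X. Qcos \<delta> (incr t n X k))" for k
    using Qcos_bounds by (intro Bochner_Integration.integral_nonneg) auto
  have "expectation (\<lambda>X. (\<Sum>k<n. Qcos \<delta> (incr t n X k))\<^sup>2)
     = (\<Sum>k<n. \<Sum>j<n. expectation (\<lambda>X. Qcos \<delta> (incr t n X k) * Qcos \<delta> (incr t n X j)))"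
    unfolding power2_eq_square sum_product using integrable_Qcos2
    by (simp add: Bochner_Integration.integral_sum Bochner_Integration.integrable_sum)
  \<comment> \<open>The product of means is granted to the diagonal as well, so that it can be
    summed over the full square.\<close>
  also have "\<dots> \<le> (\<Sum>k<n. \<Sum>j<n. (if j = k then 2 * d * (d * h / \<delta>) else 0) + (d * h / \<delta>) * (d * h / \<delta>))"
  proof (intro sum_mono)
    fix k j assume kj: "k \<in> {..<n}" "j \<in> {..<n}"
    show "expectation (\<lambda>X. Qcos \<delta> (incr t n X k) * Qcos \<delta> (incr t n X j))
       \<le> (if j = k then 2 * d * (d * h / \<delta>) else 0) + (d * h / \<delta>) * (d * h / \<delta>)"
    proof (cases "j = k")
      case True
      have "expectation (\<lambda>X. Qcos \<delta> (incr t n X k) * Qcos \<delta> (incr t n X k)) \<le> expectation (\<lambda>X. 2 * d * Qcos \<delta> (incr t n X k))"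
        using Qcos_bounds[of \<delta>] integrable_Qcos integrable_Qcos2
        by (intro integral_mono) (auto simp: d_def intro!: mult_right_mono)
      also have "\<dots> = 2 * d * expectation (\<lambda>X. Qcos \<delta> (incr t n X k))" by simp
      also have "\<dots> \<le> 2 * d * (d * h / \<delta>)"
        using q[of k] kj by (intro mult_left_mono) (auto simp: d_def)
      finally show ?thesis using True by (simp add: add_increasing2)
    next
      case False
      have "expectation (\<lambda>X. Qcos \<delta> (incr t n X k)) * expectation (\<lambda>X. Qcos \<delta> (incr t n X j)) \<le> (d * h / \<delta>) * (d * h / \<delta>)"
        using kj q[of k] q[of j] order_trans[OF q0 q, of k] by (intro mult_mono q0) auto
      then show ?thesis using False expectation_Qcos_mult[of k n j \<delta>] kj by simp
    qed
  qed
  also have "\<dots> = real n * (2 * d * (d * h / \<delta>)) + real n * real n * ((d * h / \<delta>) * (d * h / \<delta>))"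
    by (simp add: sum.distrib sum.delta mult.assoc distrib_left)
  also have "real n * (2 * d * (d * h / \<delta>)) = 2 * d\<^sup>2 * (real n * h) / \<delta>"
    by (simp add: power2_eq_square)
  also have "real n * real n * ((d * h / \<delta>) * (d * h / \<delta>)) = d\<^sup>2 * (real n * h)\<^sup>2 / \<delta>\<^sup>2"
    by (simp add: power2_eq_square)
  also have "real n * h = t" using False by (simp add: h_def)
  finally show ?thesis by (simp add: d_def)
qed

text \<open>As \<open>symb\<close> is even, changing the sign of a single increment leaves the joint
  characteristic function, hence the joint law, unchanged. This takes the place of a conditional
  expectation given the past.\<close>

lemma expectation_flip:
  assumes k: "k < n" and F: "F \<in> borel_measurable (PiM {..<n} (\<lambda>_. borel))"
  shows "expectation (\<lambda>X. F (\<lambda>j\<in>{..<n}. incr t n X j))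
       = expectation (\<lambda>X. F (\<lambda>j\<in>{..<n}. if j = k then - incr t n X j else incr t n X j) :: real)"
proof -
  have "distr M (PiM {..<n} (\<lambda>_. borel)) (\<lambda>X. \<lambda>j\<in>{..<n}. incr t n X j)
      = distr M (PiM {..<n} (\<lambda>_. borel)) (\<lambda>X. \<lambda>j\<in>{..<n}. if j = k then - incr t n X j else incr t n X j)"
  proof (rule distr_PiM_eqI_char_fun_euclidean)
    fix \<xi> :: "nat \<Rightarrow> 'a"
    have "(\<Sum>i<n. \<xi> i \<bullet> (if i = k then - incr t n X i else incr t n X i)) = (\<Sum>i<n. (\<xi>(k := - \<xi> k)) i \<bullet> incr t n X i)" for X
      by (intro sum.cong) auto
    moreover have "(\<Prod>i<n. complex_of_real (exp (- (t / real n) * symb (\<xi> i)))) = (\<Prod>i<n. complex_of_real (exp (- (t / real n) * symb ((\<xi>(k := - \<xi> k)) i))))"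
      by (intro prod.cong) (auto simp: symb_bounds)
    ultimately show "(LINT X|M. cis (\<Sum>i<n. \<xi> i \<bullet> incr t n X i)) = (LINT X|M. cis (\<Sum>i<n. \<xi> i \<bullet> (if i = k then - incr t n X i else incr t n X i)))"
      by (simp only: char_fun_incr)
  qed (auto intro: finite_measure_axioms)
  note D = this
  have m1: "(\<lambda>X. \<lambda>j\<in>{..<n}. incr t n X j) \<in> measurable M (PiM {..<n} (\<lambda>_. borel))"
    by (intro measurable_restrict) simp
  have m2: "(\<lambda>X. \<lambda>j\<in>{..<n}. if j = k then - incr t n X j else incr t n X j) \<in> measurable M (PiM {..<n} (\<lambda>_. borel))"
    by (intro measurable_restrict) simp
  show ?thesis
    using arg_cong[OF D, of "\<lambda>N. integral\<^sup>L N F"] by (simp add: integral_distr[OF m1 F] integral_distr[OF m2 F])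
qed

lemma path_eq_sum_incr:
  assumes "X \<in> D0"
  shows "X (grid t n k) = (\<Sum>j<k. incr t n X j)"
proof (induction k)
  case 0
  then show ?case using assms by (simp add: D0_def grid_def)
next
  case (Suc k)
  then show ?case by (simp add: incr_def)
qed

end

text \<open>The weight \<kappa> selects increments by their size; \<kappa> = 1 gives the full
  midpoint sum.\<close>

definition Isum :: "real \<Rightarrow> ('a::euclidean_space \<Rightarrow> 'a) \<Rightarrow> 'a \<Rightarrow> (real \<Rightarrow> real) \<Rightarrow> nat \<Rightarrow> (real \<Rightarrow> 'a) \<Rightarrow> real" where
  "Isum t A x \<kappa> n X = (\<Sum>k<n. \<kappa> (norm (incr t n X k)) * (A (x + X (grid t n k) + (1/2) *\<^sub>R incr t n X k) \<bullet> incr t n X k))"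

section \<open>Mean-square bound for the increments of size at most delta\<close>

locale rel_levy_potential = rel_levy M m t for M :: "(real \<Rightarrow> 'a::euclidean_space) measure" and m t +
  fixes A :: "'a \<Rightarrow> 'a" and a L :: real and x :: 'a
  assumes A_cont: "continuous_on UNIV A" and A_bound: "norm (A z) \<le> a"
    and A_lip: "norm (A z - A w) \<le> L * norm (z - w)" and L_nonneg: "0 \<le> L"
begin

lemma A_measurable [measurable]: "A \<in> borel_measurable borel"
  using A_cont by (rule borel_measurable_continuous_onI)

lemma a_nonneg: "0 \<le> a"
  using order_trans[OF norm_ge_zero A_bound] .

text \<open>Read off at the end of \<open>second_moment_Isum\<close>: 8 a^2 d t is twice the bound 4
  a^2 d t for the orthogonal part, and the rest comes from the Lipschitz remainder, after \<delta>^3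
  and \<delta>^2 have been replaced by \<delta>.\<close>

definition C_mom :: real where
  "C_mom = 8 * a\<^sup>2 * real DIM('a) * t + 8 * L\<^sup>2 * (real DIM('a))\<^sup>2 * (2 * t + t\<^sup>2)"

lemma C_mom_nonneg: "0 \<le> C_mom"
  using t_nonneg by (simp add: C_mom_def)

lemma Isum_measurable [measurable]:
  assumes [measurable]: "\<kappa> \<in> borel_measurable borel"
  shows "Isum t A x \<kappa> n \<in> borel_measurable M"
  unfolding Isum_def[abs_def] by measurable

text \<open>The midpoint value of A is split into the value at the left endpoint (\<open>p\<close>)
  and the Lipschitz correction (\<open>r\<close>). The terms of \<open>p\<close> are pairwise
  orthogonal, so only the diagonal survives; those of \<open>r\<close> are quadratic in the
  increment and are small without cancellation. In both, the squared norm of an increment is traded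
  for 4 \<delta>^2 times its \<open>Qcos\<close>.\<close>

lemma second_moment_Isum:
  assumes \<delta>: "0 < \<delta>" "\<delta> \<le> 1" and [measurable]: "\<kappa> \<in> borel_measurable borel"
    and \<kappa>: "\<And>r. 0 \<le> \<kappa> r" "\<And>r. \<kappa> r \<le> 1" "\<And>r. \<delta> < r \<Longrightarrow> \<kappa> r = 0"
  shows "(\<integral>\<^sup>+ X. ennreal ((Isum t A x \<kappa> n X)\<^sup>2) \<partial>M) \<le> ennreal (C_mom * \<delta>)"
proof (cases "n = 0")
  case True
  then show ?thesis by (simp add: Isum_def)
next
  case False
  define d where "d = real DIM('a)"
  define D where "D k X = incr t n X k" for k and X :: "real \<Rightarrow> 'a"
  define p where "p k X = (A (x + X (grid t n k)) \<bullet> D k X) * \<kappa> (norm (D k X))" for k X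
  define r where "r k X = ((A (x + X (grid t n k) + (1/2) *\<^sub>R D k X) - A (x + X (grid t n k))) \<bullet> D k X) * \<kappa> (norm (D k X))" for k X
  define Q where "Q k X = Qcos \<delta> (D k X)" for k X
  have Dm[measurable]: "D k \<in> borel_measurable M" for k unfolding D_def by measurable
  have pm[measurable]: "p k \<in> borel_measurable M" for k unfolding p_def by measurable
  have rm[measurable]: "r k \<in> borel_measurable M" for k unfolding r_def by measurable
  have Qm[measurable]: "Q k \<in> borel_measurable M" for k unfolding Q_def by measurable
  have I: "Isum t A x \<kappa> n X = (\<Sum>k<n. p k X) + (\<Sum>k<n. r k X)" for X
    unfolding Isum_def p_def r_def D_def sum.distrib[symmetric]
    by (intro sum.cong refl) (simp add: inner_diff_left algebra_simps)
  have Q0: "0 \<le> Q k X" "Q k X \<le> 2 * d" for k X using Qcos_bounds by (auto simp: Q_def d_def)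
  have D2: "(norm (D k X))\<^sup>2 * \<kappa> (norm (D k X)) \<le> 4 * \<delta>\<^sup>2 * Q k X" for k X
  proof (cases "norm (D k X) \<le> \<delta>")
    case True
    have "(norm (D k X))\<^sup>2 * \<kappa> (norm (D k X)) \<le> (norm (D k X))\<^sup>2 * 1"
      by (intro mult_left_mono \<kappa>) auto
    also have "\<dots> \<le> 4 * \<delta>\<^sup>2 * Q k X" using norm_square_le_Qcos[OF \<delta>(1) True] by (simp add: Q_def)
    finally show ?thesis .
  qed (use \<kappa>(3) Q0 in auto)
  have pb: "(p k X)\<^sup>2 \<le> a\<^sup>2 * (4 * \<delta>\<^sup>2 * Q k X)" for k X
  proof -
    have "\<bar>A (x + X (grid t n k)) \<bullet> D k X\<bar> \<le> a * norm (D k X)"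
      by (rule order_trans[OF Cauchy_Schwarz_ineq2]) (intro mult_right_mono A_bound, simp)
    then have "\<bar>A (x + X (grid t n k)) \<bullet> D k X\<bar>\<^sup>2 \<le> (a * norm (D k X))\<^sup>2" by (intro power_mono) auto
    then have "(A (x + X (grid t n k)) \<bullet> D k X)\<^sup>2 * (\<kappa> (norm (D k X)))\<^sup>2 \<le> (a * norm (D k X))\<^sup>2 * \<kappa> (norm (D k X))"
      using \<kappa>(1,2)[of "norm (D k X)"] by (intro mult_mono) (auto simp: power2_eq_square mult_left_le)
    also have "\<dots> = a\<^sup>2 * ((norm (D k X))\<^sup>2 * \<kappa> (norm (D k X)))" by (simp add: power_mult_distrib)
    also have "\<dots> \<le> a\<^sup>2 * (4 * \<delta>\<^sup>2 * Q k X)" using D2 by (intro mult_left_mono) auto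
    finally show ?thesis by (simp add: p_def power_mult_distrib)
  qed
  have rb: "\<bar>r k X\<bar> \<le> 2 * L * \<delta>\<^sup>2 * Q k X" for k X
  proof -
    have "norm (A (x + X (grid t n k) + (1/2) *\<^sub>R D k X) - A (x + X (grid t n k))) \<le> L * (norm (D k X) / 2)"
      using A_lip[of "x + X (grid t n k) + (1/2) *\<^sub>R D k X" "x + X (grid t n k)"] by simp
    then have "\<bar>r k X\<bar> \<le> (L * (norm (D k X) / 2) * norm (D k X)) * \<kappa> (norm (D k X))"
      unfolding r_def abs_mult using \<kappa>(1)
      by (intro mult_mono order_trans[OF Cauchy_Schwarz_ineq2] mult_right_mono) (auto simp: L_nonneg)
    also have "\<dots> = L / 2 * ((norm (D k X))\<^sup>2 * \<kappa> (norm (D k X)))" by (simp add: power2_eq_square)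
    also have "\<dots> \<le> L / 2 * (4 * \<delta>\<^sup>2 * Q k X)" using D2 L_nonneg by (intro mult_left_mono) auto
    finally show ?thesis by (simp add: mult_ac)
  qed
  have Qi: "integrable M (Q k)" for k unfolding Q_def D_def by (rule integrable_Qcos)
  have pint: "integrable M (\<lambda>X. p k X * p j X)" for k j
  proof (rule integrable_const_bound[where B="a\<^sup>2 * (4 * \<delta>\<^sup>2 * (2 * d))"])
    have b: "(p k X)\<^sup>2 \<le> a\<^sup>2 * (4 * \<delta>\<^sup>2 * (2 * d))" for k X
      by (rule order_trans[OF pb]) (intro mult_left_mono Q0, auto)
    have "\<bar>p k X * p j X\<bar> \<le> a\<^sup>2 * (4 * \<delta>\<^sup>2 * (2 * d))" for X
    proof -
      have "\<bar>p k X * p j X\<bar> \<le> ((p k X)\<^sup>2 + (p j X)\<^sup>2) / 2"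
        using sum_squares_bound[of "\<bar>p k X\<bar>" "\<bar>p j X\<bar>"] by (simp add: abs_mult)
      also have "\<dots> \<le> (a\<^sup>2 * (4 * \<delta>\<^sup>2 * (2 * d)) + a\<^sup>2 * (4 * \<delta>\<^sup>2 * (2 * d))) / 2"
        by (intro divide_right_mono add_mono b) simp
      finally show ?thesis by (simp add: mult_ac)
    qed
    then show "AE X in M. norm (p k X * p j X) \<le> a\<^sup>2 * (4 * \<delta>\<^sup>2 * (2 * d))" by simp
  qed measurable
  \<comment> \<open>changing the sign of the k-th increment preserves the law and changes the sign of the product\<close>
  have cross: "expectation (\<lambda>X. p j X * p k X) = 0" if jk: "j < k" "k < n" for j k
  proof -
    \<comment> \<open>\<open>p i\<close> as a function of the increments alone: the position at the
      i-th grid point is the sum of the increments before it. So \<open>G j\<close> with j < k does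
      not see the k-th increment, while \<open>G k\<close> is odd in it.\<close>
    define G where "G i f = (A (x + (\<Sum>l<i. f l)) \<bullet> f i) * \<kappa> (norm (f i))" for i and f :: "nat \<Rightarrow> 'a"
    have Gm: "G i \<in> borel_measurable (PiM {..<n} (\<lambda>_. borel))" if "i < n" for i
    proof -
      have c: "(\<lambda>f. f l) \<in> borel_measurable (PiM {..<n} (\<lambda>_. borel :: 'a measure))" if "l < n" for l
        using that by (intro measurable_component_singleton) simp
      show ?thesis
        unfolding G_def using that
        by (intro borel_measurable_times borel_measurable_inner measurable_compose[OF _ A_measurable]
            measurable_compose[OF _ assms(3)] borel_measurable_add borel_measurable_const borel_measurable_sum
            borel_measurable_norm c) auto
    qed
    have F: "(\<lambda>f. G j f * G k f) \<in> borel_measurable (PiM {..<n} (\<lambda>_. borel))"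
      using Gm jk by (intro borel_measurable_times) auto
    have pG: "p i X = G i (\<lambda>l\<in>{..<n}. incr t n X l)" if "X \<in> space M" "i < n" for i X
      using that path_eq_sum_incr[of X n i] by (simp add: p_def G_def D_def space_M)
    have fl: "G j (\<lambda>l\<in>{..<n}. if l = k then - incr t n X l else incr t n X l) = G j (\<lambda>l\<in>{..<n}. incr t n X l)"
      "G k (\<lambda>l\<in>{..<n}. if l = k then - incr t n X l else incr t n X l) = - G k (\<lambda>l\<in>{..<n}. incr t n X l)" for X
      using jk by (auto simp: G_def)
    have "expectation (\<lambda>X. p j X * p k X) = expectation (\<lambda>X. G j (\<lambda>l\<in>{..<n}. incr t n X l) * G k (\<lambda>l\<in>{..<n}. incr t n X l))"
      using pG jk by (intro Bochner_Integration.integral_cong) auto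
    also have "\<dots> = expectation (\<lambda>X. - (G j (\<lambda>l\<in>{..<n}. incr t n X l) * G k (\<lambda>l\<in>{..<n}. incr t n X l)))"
      using expectation_flip[OF jk(2) F] by (simp only: fl mult_minus_right)
    also have "\<dots> = - expectation (\<lambda>X. p j X * p k X)"
      using pG jk unfolding Bochner_Integration.integral_minus
      by (intro arg_cong[where f=uminus] Bochner_Integration.integral_cong) auto
    finally show ?thesis by simp
  qed
  have cross': "expectation (\<lambda>X. p j X * p k X) = 0" if "j \<noteq> k" "k < n" "j < n" for j k
    using cross[of j k] cross[of k j] that by (cases "j < k") (auto simp: mult.commute)
  have EP: "expectation (\<lambda>X. (\<Sum>k<n. p k X)\<^sup>2) \<le> 4 * a\<^sup>2 * d * t * \<delta>"
  proof -
    have "expectation (\<lambda>X. (\<Sum>k<n. p k X)\<^sup>2) = (\<Sum>k<n. \<Sum>j<n. expectation (\<lambda>X. p k X * p j X))"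
      unfolding power2_eq_square sum_product using pint
      by (simp add: Bochner_Integration.integral_sum Bochner_Integration.integrable_sum)
    also have "\<dots> \<le> (\<Sum>k<n. \<Sum>j<n. if j = k then 4 * a\<^sup>2 * \<delta>\<^sup>2 * (d * (t / real n) / \<delta>) else 0)"
    proof (intro sum_mono)
      fix k j assume kj: "k \<in> {..<n}" "j \<in> {..<n}"
      show "expectation (\<lambda>X. p k X * p j X) \<le> (if j = k then 4 * a\<^sup>2 * \<delta>\<^sup>2 * (d * (t / real n) / \<delta>) else 0)"
      proof (cases "j = k")
        case True
        have "expectation (\<lambda>X. p k X * p k X) \<le> expectation (\<lambda>X. a\<^sup>2 * (4 * \<delta>\<^sup>2 * Q k X))"
          using pint Qi pb by (intro integral_mono) (auto simp: power2_eq_square)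
        also have "\<dots> = 4 * a\<^sup>2 * \<delta>\<^sup>2 * expectation (Q k)" by simp
        also have "\<dots> \<le> 4 * a\<^sup>2 * \<delta>\<^sup>2 * (d * (t / real n) / \<delta>)"
          using expectation_Qcos_le[of k n \<delta>] kj \<delta> unfolding Q_def D_def d_def
          by (intro mult_left_mono) auto
        finally show ?thesis using True by simp
      qed (use cross'[of k j] kj in auto)
    qed
    also have "\<dots> = real n * (4 * a\<^sup>2 * \<delta>\<^sup>2 * (d * (t / real n) / \<delta>))" by (simp add: sum.delta)
    also have "\<dots> = 4 * a\<^sup>2 * d * t * \<delta>" using False \<delta> by (simp add: field_simps power2_eq_square)
    finally show ?thesis .
  qed
  have Q2i: "integrable M (\<lambda>X. (\<Sum>k<n. Q k X)\<^sup>2)"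
    unfolding power2_eq_square sum_product Q_def D_def by (intro Bochner_Integration.integrable_sum integrable_Qcos2)
  have p2i: "integrable M (\<lambda>X. (\<Sum>k<n. p k X)\<^sup>2)"
    unfolding power2_eq_square sum_product by (intro Bochner_Integration.integrable_sum pint)
  have bd: "(Isum t A x \<kappa> n X)\<^sup>2 \<le> 2 * (\<Sum>k<n. p k X)\<^sup>2 + 2 * (2 * L * \<delta>\<^sup>2)\<^sup>2 * (\<Sum>k<n. Q k X)\<^sup>2" for X
  proof -
    have "\<bar>\<Sum>k<n. r k X\<bar> \<le> (\<Sum>k<n. 2 * L * \<delta>\<^sup>2 * Q k X)"
      by (rule order_trans[OF sum_abs]) (intro sum_mono rb)
    then have "\<bar>\<Sum>k<n. r k X\<bar> \<le> 2 * L * \<delta>\<^sup>2 * (\<Sum>k<n. Q k X)" by (simp add: sum_distrib_left)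
    then have "\<bar>\<Sum>k<n. r k X\<bar>\<^sup>2 \<le> (2 * L * \<delta>\<^sup>2 * (\<Sum>k<n. Q k X))\<^sup>2" by (intro power_mono) auto
    then have "(\<Sum>k<n. r k X)\<^sup>2 \<le> (2 * L * \<delta>\<^sup>2)\<^sup>2 * (\<Sum>k<n. Q k X)\<^sup>2" by (simp only: power2_abs power_mult_distrib)
    then have R: "2 * (\<Sum>k<n. r k X)\<^sup>2 \<le> 2 * ((2 * L * \<delta>\<^sup>2)\<^sup>2 * (\<Sum>k<n. Q k X)\<^sup>2)" by (rule mult_left_mono) simp
    have sq: "(u + v)\<^sup>2 \<le> 2 * u\<^sup>2 + 2 * v\<^sup>2" for u v :: real
      using sum_squares_bound[of u v] by (simp add: power2_sum)
    show ?thesis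
      using order_trans[OF sq add_left_mono[OF R]] unfolding I by (simp only: mult.assoc)
  qed
  have "(\<integral>\<^sup>+ X. ennreal ((Isum t A x \<kappa> n X)\<^sup>2) \<partial>M)
    \<le> (\<integral>\<^sup>+ X. ennreal (2 * (\<Sum>k<n. p k X)\<^sup>2 + 2 * (2 * L * \<delta>\<^sup>2)\<^sup>2 * (\<Sum>k<n. Q k X)\<^sup>2) \<partial>M)"
    by (intro nn_integral_mono ennreal_leI bd)
  also have "\<dots> = ennreal (expectation (\<lambda>X. 2 * (\<Sum>k<n. p k X)\<^sup>2 + 2 * (2 * L * \<delta>\<^sup>2)\<^sup>2 * (\<Sum>k<n. Q k X)\<^sup>2))"
    using p2i Q2i by (intro nn_integral_eq_integral) auto
  also have "\<dots> \<le> ennreal (C_mom * \<delta>)"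
  proof (rule ennreal_leI)
    have e: "expectation (\<lambda>X. (\<Sum>k<n. Q k X)\<^sup>2) \<le> 2 * d\<^sup>2 * t / \<delta> + d\<^sup>2 * t\<^sup>2 / \<delta>\<^sup>2"
      using expectation_sum_Qcos_square_le[OF \<delta>(1), of n] by (simp add: Q_def D_def d_def)
    have "expectation (\<lambda>X. 2 * (\<Sum>k<n. p k X)\<^sup>2 + 2 * (2 * L * \<delta>\<^sup>2)\<^sup>2 * (\<Sum>k<n. Q k X)\<^sup>2)
      = 2 * expectation (\<lambda>X. (\<Sum>k<n. p k X)\<^sup>2) + 2 * (2 * L * \<delta>\<^sup>2)\<^sup>2 * expectation (\<lambda>X. (\<Sum>k<n. Q k X)\<^sup>2)"
      using p2i Q2i by simp
    also have "\<dots> \<le> 2 * (4 * a\<^sup>2 * d * t * \<delta>) + 2 * (2 * L * \<delta>\<^sup>2)\<^sup>2 * (2 * d\<^sup>2 * t / \<delta> + d\<^sup>2 * t\<^sup>2 / \<delta>\<^sup>2)"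
      using EP e by (intro add_mono mult_left_mono) auto
    also have "\<dots> = 8 * a\<^sup>2 * d * t * \<delta> + 8 * L\<^sup>2 * d\<^sup>2 * (2 * t * \<delta>^3 + t\<^sup>2 * \<delta>\<^sup>2)"
      using \<delta> by (simp add: field_simps power2_eq_square power3_eq_cube)
    also have "\<dots> \<le> 8 * a\<^sup>2 * d * t * \<delta> + 8 * L\<^sup>2 * d\<^sup>2 * (2 * t * \<delta> + t\<^sup>2 * \<delta>)"
      using \<delta> t_nonneg power_decreasing[of 1 3 \<delta>] power_decreasing[of 1 2 \<delta>]
      by (intro add_left_mono mult_left_mono add_mono) auto
    also have "\<dots> = C_mom * \<delta>" by (simp add: C_mom_def d_def algebra_simps)
    finally show "expectation (\<lambda>X. 2 * (\<Sum>k<n. p k X)\<^sup>2 + 2 * (2 * L * \<delta>\<^sup>2)\<^sup>2 * (\<Sum>k<n. Q k X)\<^sup>2) \<le> C_mom * \<delta>" .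
  qed
  finally show ?thesis .
qed

end

section \<open>Bounds for the potentials\<close>

lemma continuous_compact_support_bounded:
  fixes f :: "'a::euclidean_space \<Rightarrow> 'b::real_normed_vector"
  assumes "continuous_on UNIV f" "compact K" "\<And>x. x \<notin> K \<Longrightarrow> f x = 0"
  obtains B where "0 \<le> B" "\<And>x. norm (f x) \<le> B"
proof -
  have "bounded (f ` K)"
    using assms by (intro compact_imp_bounded compact_continuous_image) (auto intro: continuous_on_subset)
  then obtain B where "\<And>x. x \<in> K \<Longrightarrow> norm (f x) \<le> B" by (auto simp: bounded_iff)
  then have "norm (f x) \<le> max B 0" for x using assms(3)[of x] by (cases "x \<in> K") (auto simp: le_max_iff_disj)
  then show thesis by (intro that[of "max B 0"]) auto
qed

lemma onorm_le_sum_Basis: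
  fixes f :: "'a::euclidean_space \<Rightarrow> 'b::real_normed_vector"
  assumes "linear f"
  shows "onorm f \<le> (\<Sum>b\<in>Basis. norm (f b))"
proof (rule onorm_bound)
  show "norm (f x) \<le> (\<Sum>b\<in>Basis. norm (f b)) * norm x" for x
  proof -
    have "f x = f (\<Sum>b\<in>Basis. (x \<bullet> b) *\<^sub>R b)" by (simp add: euclidean_representation)
    also have "\<dots> = (\<Sum>b\<in>Basis. (x \<bullet> b) *\<^sub>R f b)"
      using assms by (simp add: linear_sum linear_cmul)
    finally have "norm (f x) \<le> (\<Sum>b\<in>Basis. norm ((x \<bullet> b) *\<^sub>R f b))" by (simp only: norm_sum)
    also have "\<dots> \<le> (\<Sum>b\<in>Basis. norm (f b) * norm x)"
      by (intro sum_mono) (simp add: Basis_le_norm mult_right_mono mult.commute[of _ "norm x"])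
    finally show ?thesis by (simp add: sum_distrib_right)
  qed
qed (simp add: sum_nonneg)

text \<open>The directional derivatives of A are themselves differentiable, hence continuous, and
  vanish off the compact support. Their bounds along the basis add up to a bound L for the operator
  norm of the derivative, and the mean value inequality makes L a Lipschitz constant.\<close>

lemma smooth_compact_support_bounds:
  fixes A :: "'a::euclidean_space \<Rightarrow> 'b::euclidean_space"
  assumes "smooth_fun A" "compact_support A"
  obtains a L where "continuous_on UNIV A" "0 \<le> a" "\<And>x. norm (A x) \<le> a"
    "0 \<le> L" "\<And>x y. norm (A x - A y) \<le> L * norm (x - y)"
proof -
  define K where "K = closure {x. A x \<noteq> 0}"
  have K: "compact K" using assms(2) by (simp add: K_def compact_support_def)
  have out: "A x = 0" if "x \<notin> K" for x
    using that closure_subset[of "{x. A x \<noteq> 0}"] by (auto simp: K_def)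
  have diff: "A differentiable (at x)" for x
    using assms(1) unfolding smooth_fun_def by (metis foldr.simps(1) id_apply)
  then have cA: "continuous_on UNIV A"
    by (simp add: continuous_at_imp_continuous_on differentiable_imp_continuous_within)
  have "dderiv b A differentiable (at x)" for b x
    using assms(1)[unfolded smooth_fun_def, rule_format, of "[b]" x] by simp
  then have cD: "continuous_on UNIV (dderiv b A)" for b
    by (simp add: continuous_at_imp_continuous_on differentiable_imp_continuous_within)
  have outD: "dderiv b A x = 0" if "x \<notin> K" for b x
  proof -
    have "open (- K)" unfolding K_def by (intro open_Compl closed_closure)
    then have "(A has_derivative (\<lambda>_. 0)) (at x)"
      using that out by (intro has_derivative_transform_within_open[OF has_derivative_const[of 0]]) auto
    then show ?thesis by (simp add: dderiv_def frechet_derivative_at[symmetric])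
  qed
  have "\<exists>B. \<forall>x. norm (dderiv b A x) \<le> B" for b
    by (rule continuous_compact_support_bounded[OF cD K outD]) blast+
  then obtain B where B: "\<And>b x. norm (dderiv b A x) \<le> B b" by metis
  obtain a where a: "0 \<le> a" "\<And>x. norm (A x) \<le> a"
    using continuous_compact_support_bounded[OF cA K out] by metis
  define L where "L = (\<Sum>b\<in>Basis. B b)"
  have fd: "(A has_derivative frechet_derivative A (at x)) (at x)" for x
    using diff by (simp add: frechet_derivative_works)
  have "onorm (frechet_derivative A (at x)) \<le> L" for x
  proof -
    have "onorm (frechet_derivative A (at x)) \<le> (\<Sum>b\<in>Basis. norm (frechet_derivative A (at x) b))"
      using fd by (intro onorm_le_sum_Basis has_derivative_linear)
    also have "\<dots> \<le> L" unfolding L_def using B by (intro sum_mono) (simp add: dderiv_def)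
    finally show ?thesis .
  qed
  then have lip: "norm (A x - A y) \<le> L * norm (x - y)" for x y
    using fd by (intro differentiable_bound[of UNIV A "\<lambda>x. frechet_derivative A (at x)"]) auto
  have "0 \<le> L" unfolding L_def by (intro sum_nonneg) (meson B norm_ge_zero order_trans)
  then show thesis using that cA a lip by blast
qed

lemma C0_fun_bounded:
  assumes "C0_fun V"
  obtains B where "0 \<le> B" "\<And>x::'a::euclidean_space. \<bar>V x\<bar> \<le> B"
proof -
  have V: "continuous_on UNIV V" "(V \<longlongrightarrow> 0) at_infinity" using assms by (auto simp: C0_fun_def)
  have "\<forall>\<^sub>F x in at_infinity. dist (V x) 0 < 1" using tendstoD[OF V(2), of 1] by simp
  then obtain R where R: "\<And>x. R \<le> norm x \<Longrightarrow> \<bar>V x\<bar> < 1" by (auto simp: eventually_at_infinity)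
  have "bounded (V ` cball 0 R)"
    using V by (intro compact_imp_bounded compact_continuous_image) (auto intro: continuous_on_subset)
  then obtain B where "\<And>x. norm x \<le> R \<Longrightarrow> \<bar>V x\<bar> \<le> B" by (force simp: bounded_iff)
  then have "\<bar>V x\<bar> \<le> max B 1" for x using R[of x] by (cases "norm x \<le> R") (auto simp: le_max_iff_disj)
  then show thesis by (intro that[of "max B 1"]) auto
qed

section \<open>A Gaussian integral\<close>

text \<open>The substitution w = v - c / v maps the half-line onto the real line with Jacobian 1 + c
  / v^2, so \<open>E\<close> integrated against this Jacobian gives the full Gaussian integral. The
  inversion of v to c / v preserves \<open>E\<close> and exchanges the two summands of the Jacobian,
  so each contributes one half.\<close>

lemma Cauchy_Schlomilch:
  fixes c :: real
  assumes c: "0 < c"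
  defines "E \<equiv> \<lambda>v::real. exp (- (v - c / v)\<^sup>2 / 2)"
  shows "E absolutely_integrable_on {0<..}" "integral {0<..} E = sqrt (2 * pi) / 2"
proof -
  define N where "N = (\<lambda>w::real. exp (- w\<^sup>2 / 2))"
  have N: "N absolutely_integrable_on UNIV" "integral UNIV N = sqrt (2 * pi)"
  proof -
    have e: "N = (\<lambda>w. sqrt (2 * pi) * std_normal_density w)"
      by (simp add: N_def std_normal_density_def fun_eq_iff)
    have i: "integrable lborel N" unfolding e by (intro integrable_mult_right) simp
    then show a: "N absolutely_integrable_on UNIV"
      unfolding set_integrable_def by (simp add: integrable_completion)
    have "integral UNIV N = (LINT x|lebesgue. N x)"
      using set_lebesgue_integral_eq_integral(2)[OF a] by (simp add: set_lebesgue_integral_def)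
    also have "\<dots> = (LINT x|lborel. N x)" using i by (intro integral_completion) auto
    also have "\<dots> = sqrt (2 * pi)" unfolding e by simp
    finally show "integral UNIV N = sqrt (2 * pi)" .
  qed
  have S: "{0::real<..} \<in> sets lebesgue" by simp
  have img: "(\<lambda>v. v - c / v) ` {0<..} = UNIV"
  proof -
    have "w \<in> (\<lambda>v. v - c / v) ` {0<..}" for w
    proof
      \<comment> \<open>The positive root of v^2 - w v - c = 0.\<close>
      define v where "v = (w + sqrt (w\<^sup>2 + 4 * c)) / 2"
      have "\<bar>w\<bar> < sqrt (w\<^sup>2 + 4 * c)" using c by (intro real_less_rsqrt) simp
      then show v: "v \<in> {0<..}" by (auto simp: v_def)
      have "2 * v - w = sqrt (w\<^sup>2 + 4 * c)" by (simp add: v_def field_simps)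
      then have "(2 * v - w)\<^sup>2 = w\<^sup>2 + 4 * c" using c by simp
      then have "v * v - c = w * v" by (simp add: power2_eq_square algebra_simps)
      then show "w = v - c / v" using v by (simp add: field_simps)
    qed
    then show ?thesis by auto
  qed
  have inj: "inj_on (\<lambda>v. v - c / v) {0<..}"
  proof (rule strict_mono_on_imp_inj_on)
    show "strict_mono_on {0<..} (\<lambda>v. v - c / v)"
      using c by (intro strict_mono_onI) (auto intro!: diff_strict_mono divide_strict_left_mono mult_pos_pos)
  qed
  have d1: "((\<lambda>v. v - c / v) has_field_derivative (1 + c / v\<^sup>2)) (at v within {0<..})" if "v \<in> {0<..}" for v
    using that by (auto intro!: derivative_eq_intros simp: power2_eq_square)
  have "(\<lambda>v. \<bar>1 + c / v\<^sup>2\<bar> * N (v - c / v)) absolutely_integrable_on {0<..} \<and>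
        integral {0<..} (\<lambda>v. \<bar>1 + c / v\<^sup>2\<bar> * N (v - c / v)) = sqrt (2 * pi)"
    by (subst has_absolute_integral_change_of_variables_1'[OF S d1 inj]) (use N img in auto)
  moreover have "\<bar>1 + c / v\<^sup>2\<bar> * N (v - c / v) = (1 + c / v\<^sup>2) * E v" for v
    using c by (simp add: N_def E_def abs_of_nonneg add_nonneg_nonneg)
  ultimately have T: "(\<lambda>v. (1 + c / v\<^sup>2) * E v) absolutely_integrable_on {0<..}"
      "integral {0<..} (\<lambda>v. (1 + c / v\<^sup>2) * E v) = sqrt (2 * pi)" by auto
  have mE: "E \<in> borel_measurable borel" unfolding E_def by measurable
  show EI: "E absolutely_integrable_on {0<..}"
    unfolding set_integrable_def
  proof (rule Bochner_Integration.integrable_bound[OF T(1)[unfolded set_integrable_def]])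
    show "(\<lambda>x. indicat_real {0<..} x *\<^sub>R E x) \<in> borel_measurable lebesgue"
      by (rule measurable_completion) (use mE in measurable)
    have "E v \<le> (1 + c / v\<^sup>2) * E v" for v
      using c by (simp add: E_def)
    then show "AE x in lebesgue. norm (indicat_real {0<..} x *\<^sub>R E x) \<le> norm (indicat_real {0<..} x *\<^sub>R ((1 + c / x\<^sup>2) * E x))"
      by (intro AE_I2) (auto simp: indicator_def E_def abs_mult intro: order_trans[OF _ abs_ge_self])
  qed
  have img2: "(\<lambda>v. c / v) ` {0<..} = {0<..}"
  proof -
    have "v \<in> (\<lambda>v. c / v) ` {0<..}" if "0 < v" for v
      by (rule image_eqI[of _ _ "c / v"]) (use that c in auto)
    then show ?thesis using c by auto
  qed
  have inj2: "inj_on (\<lambda>v. c / v) {0<..}" using c by (auto simp: inj_on_def)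
  have d2: "((\<lambda>v. c / v) has_field_derivative (- (c / v\<^sup>2))) (at v within {0<..})" if "v \<in> {0<..}" for v
    using that by (auto intro!: derivative_eq_intros simp: power2_eq_square)
  have "(\<lambda>v. \<bar>- (c / v\<^sup>2)\<bar> * E (c / v)) absolutely_integrable_on {0<..} \<and>
        integral {0<..} (\<lambda>v. \<bar>- (c / v\<^sup>2)\<bar> * E (c / v)) = integral {0<..} E"
    by (subst has_absolute_integral_change_of_variables_1'[OF S d2 inj2]) (use EI img2 in auto)
  moreover have "(\<lambda>v. \<bar>- (c / v\<^sup>2)\<bar> * E (c / v)) = (\<lambda>v. (c / v\<^sup>2) * E v)"
    using c by (auto simp: fun_eq_iff E_def power2_commute[of "c / v" for v])
  ultimately have U: "(\<lambda>v. (c / v\<^sup>2) * E v) absolutely_integrable_on {0<..}"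
      "integral {0<..} (\<lambda>v. (c / v\<^sup>2) * E v) = integral {0<..} E" by auto
  have "sqrt (2 * pi) = integral {0<..} (\<lambda>v. E v + (c / v\<^sup>2) * E v)"
    using T(2) by (simp add: distrib_right)
  also have "\<dots> = integral {0<..} E + integral {0<..} (\<lambda>v. (c / v\<^sup>2) * E v)"
    using EI U(1) by (intro Henstock_Kurzweil_Integration.integral_add) (auto intro: set_lebesgue_integral_eq_integral(1))
  also note U(2)
  finally show "integral {0<..} E = sqrt (2 * pi) / 2" by simp
qed

text \<open>Completing the square, v^2 / 2 + c^2 / (2 v^2) = c + (v - c / v)^2 / 2, reduces the
  integral to \<open>Cauchy_Schlomilch\<close> on each half-line. It is the Laplace transform, at
  c^2 / 2, of the hitting time of level 1 by Brownian motion, which is distributed as 1 /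
  v^2.\<close>

lemma integral_std_normal_exp_inverse_square:
  assumes c: "0 \<le> c"
  shows "(LINT v|lborel. std_normal_density v * exp (- c\<^sup>2 / (2 * v\<^sup>2))) = exp (- c)"
proof (cases "c = 0")
  case False
  with c have c: "0 < c" by simp
  define E where "E = (\<lambda>v::real. exp (- (v - c / v)\<^sup>2 / 2))"
  note CS = Cauchy_Schlomilch[OF c, folded E_def]
  have mE[measurable]: "E \<in> borel_measurable borel" unfolding E_def by measurable
  define k where "k = exp (- c) / sqrt (2 * pi)"
  have eq: "std_normal_density v * exp (- c\<^sup>2 / (2 * v\<^sup>2)) = k * E v" if "v \<noteq> 0" for v
  proof -
    have "- v\<^sup>2 / 2 + - c\<^sup>2 / (2 * v\<^sup>2) = - c + - (v - c / v)\<^sup>2 / 2"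
      using that by (simp add: field_simps power2_eq_square)
    then have "exp (- v\<^sup>2 / 2) * exp (- c\<^sup>2 / (2 * v\<^sup>2)) = exp (- c) * exp (- (v - c / v)\<^sup>2 / 2)"
      by (simp only: mult_exp_exp)
    then have "1 / sqrt (2 * pi) * (exp (- v\<^sup>2 / 2) * exp (- c\<^sup>2 / (2 * v\<^sup>2))) = 1 / sqrt (2 * pi) * (exp (- c) * exp (- (v - c / v)\<^sup>2 / 2))"
      by (rule arg_cong)
    then show ?thesis
      unfolding std_normal_density_def k_def E_def by (simp only: mult.assoc [symmetric] times_divide_eq_left mult_1_left)
  qed
  have iE: "integrable lborel (\<lambda>v. indicat_real {0<..} v * E v)"
    using CS(1) by (simp add: set_integrable_def integrable_completion)
  have vE: "(LINT v|lborel. indicat_real {0<..} v * E v) = sqrt (2 * pi) / 2"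
  proof -
    have "(LINT v|lborel. indicat_real {0<..} v * E v) = (LINT v|lebesgue. indicat_real {0<..} v * E v)"
      by (intro integral_completion[symmetric]) auto
    also have "\<dots> = integral {0<..} E"
      using set_lebesgue_integral_eq_integral(2)[OF CS(1)] by (simp add: set_lebesgue_integral_def)
    finally show ?thesis using CS(2) by simp
  qed
  have r: "indicat_real {0<..} (- v) * E (- v) = indicat_real {..<0} v * E v" for v
    by (simp add: E_def indicator_def power2_eq_square algebra_simps)
  have iE2: "integrable lborel (\<lambda>v. indicat_real {..<0} v * E v)"
    using lborel_integrable_real_affine[OF iE, of "-1" 0] by (simp add: r)
  have vE2: "(LINT v|lborel. indicat_real {..<0} v * E v) = sqrt (2 * pi) / 2"
    using lborel_integral_real_affine[of "-1" "\<lambda>v. indicat_real {0<..} v * E v" 0] by (simp add: r vE)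
  have "(LINT v|lborel. std_normal_density v * exp (- c\<^sup>2 / (2 * v\<^sup>2)))
     = (LINT v|lborel. k * (indicat_real {0<..} v * E v + indicat_real {..<0} v * E v))"
  proof (rule integral_cong_AE)
    \<comment> \<open>At v = 0 the quotient takes the default value 0 and the factorization fails,
      but only on a null set.\<close>
    have "AE v in lborel. v \<noteq> (0::real)" by (rule AE_lborel_singleton)
    then show "AE v in lborel. std_normal_density v * exp (- c\<^sup>2 / (2 * v\<^sup>2))
      = k * (indicat_real {0<..} v * E v + indicat_real {..<0} v * E v)"
      by eventually_elim (subst eq, assumption, auto simp: indicator_def)
  qed auto
  also have "\<dots> = k * sqrt (2 * pi)"
    using iE iE2 vE vE2 by simp
  finally show ?thesis by (simp add: k_def)
qed simp

section \<open>The Levy densities\<close>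

lemma powr_le_exp:
  fixes w N :: real
  assumes "0 < N" "0 < w"
  shows "w powr N \<le> N powr N * exp w"
proof -
  have "w / N \<le> exp (w / N)" using exp_ge_add_one_self[of "w / N"] by linarith
  then have "(w / N) powr N \<le> exp (w / N) powr N" using assms by (intro powr_mono2) auto
  also have "\<dots> = exp w" using assms by (simp add: exp_powr_real)
  finally show ?thesis using assms by (simp add: powr_divide divide_le_eq mult.commute)
qed

lemma besselK_nonneg: "0 \<le> besselK \<nu> z"
  unfolding besselK_def set_lebesgue_integral_def
  by (intro Bochner_Integration.integral_nonneg) (simp add: indicator_def)

lemma besselK_measurable [measurable]: "besselK \<nu> \<in> borel_measurable borel"
  unfolding besselK_def[abs_def] set_lebesgue_integral_def cosh_def by measurable

text \<open>
  The exponent is worse by 1/2 than the true order of the singularity, which is still good enough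
  for the integrability of the second moment of the Levy density near 0.
\<close>
lemma besselK_le:
  assumes "0 \<le> \<nu>" "0 < z"
  shows "besselK \<nu> z \<le> 2 * (2 * \<nu> + 1) powr (\<nu> + 1/2) * z powr (- (\<nu> + 1/2))"
proof -
  \<comment> \<open>N exceeds \<nu> by 1/2, so that the decay exp (- N s) obtained from
    \<open>powr_le_exp\<close> beats the growth exp (\<nu> s) of the hyperbolic cosine and leaves
    exp (- s / 2), a multiple of an exponential density.\<close>
  define N where "N = \<nu> + 1/2"
  have N: "0 < N" using assms by (simp add: N_def)
  define C where "C = (2 * N / z) powr N"
  have iD: "integrable lborel (exponential_density (1/2))" and vD: "(LINT s|lborel. exponential_density (1/2) s) = 1"
  proof -
    have "(\<integral>\<^sup>+ s. ennreal (exponential_density (1/2) s) \<partial>lborel) = 1"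
      using prob_space.emeasure_space_1[OF prob_space_exponential_density[of "1/2"]] by (simp add: emeasure_density)
    then have "has_bochner_integral lborel (exponential_density (1/2)) 1"
      by (intro has_bochner_integral_nn_integral) (auto simp: exponential_density_def)
    then show "integrable lborel (exponential_density (1/2))" "(LINT s|lborel. exponential_density (1/2) s) = 1"
      by (auto simp: has_bochner_integral_iff)
  qed
  have bd: "exp (- z * cosh s) * cosh (\<nu> * s) \<le> C * exp (- s / 2)" if s: "0 \<le> s" for s
  proof -
    have w: "0 < z * exp s / 2" using assms by simp
    have "z * exp s / 2 \<le> z * cosh s" using assms by (simp add: cosh_def)
    then have "exp (- z * cosh s) \<le> exp (- (z * exp s / 2))" by simp
    also have "\<dots> \<le> N powr N * (z * exp s / 2) powr (- N)"
    proof -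
      have "(z * exp s / 2) powr N * exp (- (z * exp s / 2)) \<le> N powr N"
        using powr_le_exp[OF N w] by (simp add: exp_minus field_simps)
      moreover have "0 < (z * exp s / 2) powr N" using w assms by simp
      ultimately show ?thesis by (simp add: powr_minus divide_inverse[symmetric] pos_le_divide_eq mult.commute del: powr_gt_zero zero_less_mult_iff)
    qed
    also have "(z * exp s / 2) powr (- N) = (2 / z) powr N * exp (- N * s)"
      using assms by (simp add: powr_minus powr_divide powr_mult exp_powr_real exp_minus field_simps)
    also have "N powr N * ((2 / z) powr N * exp (- N * s)) = C * exp (- N * s)"
      using assms N by (simp add: C_def powr_mult powr_divide)
    finally have 1: "exp (- z * cosh s) \<le> C * exp (- N * s)" .
    have "0 \<le> \<nu> * s" using assms s by simp
    then have "exp (- (\<nu> * s)) \<le> exp (\<nu> * s)" by simp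
    then have 2: "cosh (\<nu> * s) \<le> exp (\<nu> * s)" by (simp add: cosh_def)
    have "exp (- z * cosh s) * cosh (\<nu> * s) \<le> (C * exp (- N * s)) * exp (\<nu> * s)"
      using 1 2 by (intro mult_mono) (auto simp: C_def)
    also have "\<dots> = C * exp (- s / 2)"
      by (simp add: N_def mult_exp_exp algebra_simps)
    finally show ?thesis .
  qed
  have "besselK \<nu> z \<le> (LINT s|lborel. (2 * C) * exponential_density (1/2) s)"
    unfolding besselK_def set_lebesgue_integral_def
  proof (rule integral_mono')
    show "integrable lborel (\<lambda>s. 2 * C * exponential_density (1/2) s)" using iD by simp
    show "indicat_real {0..} s *\<^sub>R (exp (- z * cosh s) * cosh (\<nu> * s)) \<le> 2 * C * exponential_density (1 / 2) s" for s
      using bd[of s] by (auto simp: indicator_def exponential_density_def)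
  qed (auto simp: exponential_density_def C_def)
  also have "\<dots> = 2 * C" using vD by simp
  also have "C = (2 * \<nu> + 1) powr (\<nu> + 1/2) * z powr (- (\<nu> + 1/2))"
  proof -
    have "C = (2 * N) powr N / z powr N" using assms N by (simp add: C_def powr_divide)
    also have "\<dots> = (2 * N) powr N * z powr (- N)" by (simp only: powr_minus divide_inverse)
    also have "2 * N = 2 * \<nu> + 1" by (simp add: N_def)
    finally show ?thesis by (simp only: N_def)
  qed
  finally show ?thesis by simp
qed

lemma levy_dens_nonneg: "0 \<le> m \<Longrightarrow> 0 \<le> levy_dens d m r"
  by (auto simp: levy_dens_def besselK_nonneg intro!: mult_nonneg_nonneg divide_nonneg_nonneg Gamma_real_nonneg)

lemma levy_dens_measurable [measurable]: "levy_dens d m \<in> borel_measurable borel"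
  unfolding levy_dens_def[abs_def] by measurable

text \<open>One exponent d + 3/2 for all masses. For m > 0 it equals 2 \<nu> + 1/2 with \<nu> = (d +
  1) / 2: the part \<nu> comes from the denominator and \<nu> + 1/2 from \<open>besselK_le\<close>.
  For m = 0 the true order d + 1 is weakened, which is harmless for r \<le> 1.\<close>

lemma levy_dens_le:
  assumes m: "0 \<le> m"
  obtains C where "0 \<le> C" "\<And>r. 0 < r \<Longrightarrow> r \<le> 1 \<Longrightarrow> levy_dens d m r \<le> C * r powr (- (real d + 3/2))"
proof (cases "m = 0")
  case True
  define C where "C = Gamma ((real d + 1) / 2) / pi powr ((real d + 1) / 2)"
  have C: "0 \<le> C" by (simp add: C_def Gamma_real_nonneg)
  have "levy_dens d m r \<le> C * r powr (- (real d + 3/2))" if "0 < r" "r \<le> 1" for r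
  proof -
    have "r powr (- (real d + 1)) \<le> r powr (- (real d + 3/2))"
      using that by (intro powr_mono') auto
    then show ?thesis using True C by (simp add: levy_dens_def C_def[symmetric] mult_left_mono)
  qed
  then show thesis using C that by blast
next
  case False
  with m have m: "0 < m" by simp
  define \<nu> where "\<nu> = (real d + 1) / 2"
  define C where "C = 2 * (m / (2 * pi)) powr \<nu> * (2 * (2 * \<nu> + 1) powr (\<nu> + 1/2) * m powr (- (\<nu> + 1/2)))"
  have "levy_dens d m r \<le> C * r powr (- (real d + 3/2))" if r: "0 < r" "r \<le> 1" for r
  proof -
    have "levy_dens d m r = 2 * (m / (2 * pi)) powr \<nu> * besselK \<nu> (m * r) / r powr \<nu>"
      using m by (simp add: levy_dens_def \<nu>_def)
    also have "\<dots> \<le> 2 * (m / (2 * pi)) powr \<nu> * (2 * (2 * \<nu> + 1) powr (\<nu> + 1/2) * (m * r) powr (- (\<nu> + 1/2))) / r powr \<nu>"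
      using besselK_le[of \<nu> "m * r"] m r by (intro divide_right_mono mult_left_mono) (auto simp: \<nu>_def)
    also have "\<dots> = C * (r powr (- (\<nu> + 1/2)) / r powr \<nu>)"
      using m r by (simp add: C_def powr_mult)
    also have "r powr (- (\<nu> + 1/2)) / r powr \<nu> = r powr (- (real d + 3/2))"
    proof -
      have "- (\<nu> + 1/2) - \<nu> = - (real d + 3/2)" by (simp add: \<nu>_def field_simps)
      then show ?thesis by (simp only: powr_diff[symmetric])
    qed
    finally show ?thesis .
  qed
  moreover have "0 \<le> C" by (simp add: C_def)
  ultimately show thesis using that by blast
qed

text \<open>Domination by a sum over dyadic balls: the integrand is at most \<open>c k\<close> where
  |y| lies between 2^-(k+1) and 2^-k, and \<open>c k\<close> times the volume of the ball decays
  like 2^(-k/2).\<close>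

lemma nn_integral_norm_powr_ball_finite:
  "(\<integral>\<^sup>+ y. ennreal (indicator {y::'a::euclidean_space. 0 < norm y \<and> norm y < 1} y * norm y powr (1/2 - real DIM('a))) \<partial>lborel) < \<infinity>"
proof -
  define d where "d = real DIM('a)"
  have d1: "1 \<le> d" using DIM_positive[where 'a='a] by (simp add: d_def Suc_le_eq)
  define c where "c k = 2 powr ((real k + 1) * (d - 1/2))" for k
  have dom: "ennreal (indicator {y::'a. 0 < norm y \<and> norm y < 1} y * norm y powr (1/2 - d))
    \<le> (\<Sum>k. ennreal (c k) * indicator (ball 0 (2 powr (- real k))) y)" (is "?f y \<le> (\<Sum>k. ?h k y)") for y
  proof (cases "0 < norm y \<and> norm y < 1")
    case True
    \<comment> \<open>The dyadic shell of y, that is k < - log 2 |y| \<le> k + 1.\<close>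
    define k where "k = nat (\<lceil>- log 2 (norm y)\<rceil> - 1)"
    have l: "- log 2 (norm y) > 0" using True by (simp add: log_less_zero_cancel_iff)
    then have rk: "real k = of_int \<lceil>- log 2 (norm y)\<rceil> - 1" by (simp add: k_def)
    then have kk: "real k < - log 2 (norm y)" "- log 2 (norm y) \<le> real k + 1" by linarith+
    have eq: "norm y = 2 powr (log 2 (norm y))" using True by simp
    have "norm y < 2 powr (- real k)" using kk by (subst eq) (intro powr_less_mono, auto)
    then have yb: "y \<in> ball 0 (2 powr (- real k))" by simp
    have "norm y powr (1/2 - d) = 2 powr (- log 2 (norm y) * (d - 1/2))"
      by (subst eq) (simp add: powr_powr algebra_simps)
    also have "\<dots> \<le> c k" unfolding c_def using kk d1 by (intro powr_mono mult_right_mono) auto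
    finally have "?f y \<le> ?h k y" using True yb by (simp add: ennreal_leI)
    also have "?h k y = (\<Sum>j\<in>{k}. ?h j y)" by (simp only: sum.insert sum.empty finite.intros empty_iff not_False_eq_True add_0_right)
    also have "\<dots> \<le> (\<Sum>j. ?h j y)" by (intro sum_le_suminf) auto
    finally show ?thesis .
  qed simp
  have "(\<integral>\<^sup>+ y. ?f y \<partial>lborel) \<le> (\<integral>\<^sup>+ y. (\<Sum>k. ?h k y) \<partial>lborel)"
    by (intro nn_integral_mono dom)
  also have "\<dots> = (\<Sum>k. \<integral>\<^sup>+ y. ?h k y \<partial>lborel)"
    by (intro nn_integral_suminf borel_measurable_times_ennreal borel_measurable_const borel_measurable_indicator) simp
  also have "\<dots> = (\<Sum>k. ennreal (unit_ball_vol d * 2 powr (d - 1/2) * (2 powr (-1/2)) ^ k))"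
  proof (intro suminf_cong)
    fix k
    have "(\<integral>\<^sup>+ y. ?h k y \<partial>lborel) = ennreal (c k) * ennreal (unit_ball_vol d * (2 powr (- real k)) ^ DIM('a))"
      by (simp add: nn_integral_cmult_indicator emeasure_ball d_def)
    also have "\<dots> = ennreal (c k * (unit_ball_vol d * (2 powr (- real k)) powr d))"
      by (simp add: ennreal_mult' c_def d_def powr_realpow[symmetric] unit_ball_vol_nonneg)
    also have "c k * (unit_ball_vol d * (2 powr (- real k)) powr d) = unit_ball_vol d * (2 powr ((real k + 1) * (d - 1/2)) * 2 powr (- real k * d))"
      by (simp add: c_def powr_powr)
    also have "2 powr ((real k + 1) * (d - 1/2)) * 2 powr (- real k * d) = 2 powr (d - 1/2) * 2 powr (-1/2 * real k)"
      unfolding powr_add [symmetric] by (rule arg_cong[where f = "\<lambda>x. 2 powr x"]) (simp add: field_simps)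
    also have "2 powr (-1/2 * real k) = (2 powr (-1/2)) ^ k"
      unfolding powr_powr [symmetric] by (rule powr_realpow) simp
    finally show "(\<integral>\<^sup>+ y. ?h k y \<partial>lborel) = ennreal (unit_ball_vol d * 2 powr (d - 1/2) * (2 powr (-1/2)) ^ k)"
      by (simp add: mult.assoc)
  qed
  also have "\<dots> < \<infinity>"
  proof -
    have "2 powr (-1/2) < (2::real) powr 0" by (intro powr_less_mono) auto
    then have "summable (\<lambda>k. unit_ball_vol d * 2 powr (d - 1/2) * (2 powr (-1/2)) ^ k)"
      by (intro summable_mult summable_geometric) simp
    then show ?thesis
      by (subst suminf_ennreal2) (auto intro!: mult_nonneg_nonneg unit_ball_vol_nonneg simp: d_def)
  qed
  finally show ?thesis by (simp add: d_def)
qed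

text \<open>The factor |y|^2 lowers the order of the singularity from d + 3/2 to d - 1/2, which is
  integrable at the origin.\<close>

lemma nm_second_moment_integrable:
  assumes m: "0 \<le> m"
  shows "integrable lborel (\<lambda>y::'a::euclidean_space. indicator {y. 0 < norm y \<and> norm y < 1} y * ((norm y)\<^sup>2 * nm m y))"
proof -
  obtain C where C: "0 \<le> C" "\<And>r. 0 < r \<Longrightarrow> r \<le> 1 \<Longrightarrow> levy_dens DIM('a) m r \<le> C * r powr (- (real DIM('a) + 3/2))"
    using levy_dens_le[OF m, of "DIM('a)"] by metis
  let ?I = "\<lambda>y::'a. indicator {y. 0 < norm y \<and> norm y < 1} y * norm y powr (1/2 - real DIM('a)) :: real"
  have i: "integrable lborel ?I"
    using nn_integral_norm_powr_ball_finite[where 'a='a] by (intro integrableI_bounded) (auto simp: abs_mult)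
  show ?thesis
  proof (rule Bochner_Integration.integrable_bound[OF integrable_mult_right[OF i, of C]])
    have h: "(norm y)\<^sup>2 * nm m y \<le> C * norm y powr (1/2 - real DIM('a))" if "0 < norm y" "norm y < 1" for y :: 'a
    proof -
      have "(norm y)\<^sup>2 * nm m y \<le> (norm y)\<^sup>2 * (C * norm y powr (- (real DIM('a) + 3/2)))"
        using C(2)[of "norm y"] that by (intro mult_left_mono) auto
      also have "(norm y)\<^sup>2 = norm y powr 2" using that by simp
      also have "norm y powr 2 * (C * norm y powr (- (real DIM('a) + 3/2))) = C * norm y powr (2 + - (real DIM('a) + 3/2))"
        by (simp only: powr_add mult.left_commute)
      also have "2 + - (real DIM('a) + 3/2) = 1/2 - real DIM('a)" by simp
      finally show ?thesis using that by simp
    qed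
    show "AE y in lborel. norm (indicator {y::'a. 0 < norm y \<and> norm y < 1} y * ((norm y)\<^sup>2 * nm m y)) \<le> norm (C * ?I y)"
    proof (intro AE_I2)
      fix y :: 'a
      show "norm (indicator {y::'a. 0 < norm y \<and> norm y < 1} y * ((norm y)\<^sup>2 * nm m y)) \<le> norm (C * ?I y)"
      proof (cases "0 < norm y \<and> norm y < 1")
        case True
        then show ?thesis using h[of y] C(1) levy_dens_nonneg[OF m, of "DIM('a)" "norm y"]
          by (simp add: abs_mult)
      qed simp
    qed
  qed measurable
qed

lemma integral_odd_eq_0:
  fixes f :: "'a::euclidean_space \<Rightarrow> real"
  assumes "f \<in> borel_measurable borel" "\<And>y. f (- y) = - f y"
  shows "(LINT y|lborel. f y) = 0"
proof -
  have "lborel = distr lborel borel (uminus :: 'a \<Rightarrow> 'a)"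
    using lborel_affine[of "-1" "0::'a"] by (simp add: density_1)
  then have "(LINT y|lborel. f y) = (LINT y|distr lborel borel (uminus :: 'a \<Rightarrow> 'a). f y)" by simp
  also have "\<dots> = (LINT y|lborel. f (- y))" using assms(1) by (intro integral_distr) auto
  also have "\<dots> = - (LINT y|lborel. f y)" by (simp add: assms(2))
  finally show ?thesis by simp
qed

section \<open>The compensated small-jump integral\<close>

text \<open>Fatou's lemma for the squares; this is how mean-square bounds pass from grid sums to
  jump sums and on to their limits.\<close>

lemma nn_integral_square_le_of_tendsto:
  fixes f :: "nat \<Rightarrow> 's \<Rightarrow> real"
  assumes [measurable]: "\<And>n. f n \<in> borel_measurable M"
    and lim: "AE w in M. (\<lambda>n. f n w) \<longlonglongrightarrow> g w"
    and bd: "\<forall>\<^sub>F n in sequentially. (\<integral>\<^sup>+ w. ennreal ((f n w)\<^sup>2) \<partial>M) \<le> c"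
  shows "(\<integral>\<^sup>+ w. ennreal ((g w)\<^sup>2) \<partial>M) \<le> c"
proof -
  have "(\<integral>\<^sup>+ w. ennreal ((g w)\<^sup>2) \<partial>M) \<le> (\<integral>\<^sup>+ w. liminf (\<lambda>n. ennreal ((f n w)\<^sup>2)) \<partial>M)"
  proof (rule nn_integral_mono_AE, use lim in eventually_elim)
    case (elim w)
    have "(\<lambda>n. ennreal ((f n w)\<^sup>2)) \<longlonglongrightarrow> ennreal ((g w)\<^sup>2)" by (intro tendsto_ennrealI tendsto_power elim)
    from lim_imp_Liminf[OF sequentially_bot this] show ?case by simp
  qed
  also have "\<dots> \<le> liminf (\<lambda>n. \<integral>\<^sup>+ w. ennreal ((f n w)\<^sup>2) \<partial>M)"
    by (rule nn_integral_liminf) measurable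
  also have "\<dots> \<le> c"
    using Liminf_mono[OF bd] by (simp add: Liminf_const)
  finally show ?thesis .
qed

section \<open>Cutoffs in the jump size\<close>

definition ramp :: "real \<Rightarrow> real" where "ramp z = max 0 (min 1 z)"

lemma ramp_simps [simp]: "z \<le> 0 \<Longrightarrow> ramp z = 0" "1 \<le> z \<Longrightarrow> ramp z = 1" "0 \<le> ramp z" "ramp z \<le> 1"
  by (auto simp: ramp_def)

lemma ramp_continuous: "continuous_on S f \<Longrightarrow> continuous_on S (\<lambda>z. ramp (f z))"
  unfolding ramp_def by (intro continuous_intros)

text \<open>
  Continuous approximations of the indicators of r at least e and of r less than delta; the
  summand 2 / e makes all the former vanish below e / 2.
\<close>
definition lower_cut :: "real \<Rightarrow> nat \<Rightarrow> real \<Rightarrow> real" where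
  "lower_cut e j r = ramp ((real j + 2 / e) * (r - e) + 1)"

definition upper_cut :: "real \<Rightarrow> nat \<Rightarrow> real \<Rightarrow> real" where
  "upper_cut \<delta> j r = ramp (real j * (\<delta> - r))"

lemma cut_continuous: "continuous_on UNIV (lower_cut e j)" "continuous_on UNIV (upper_cut \<delta> j)"
  unfolding lower_cut_def[abs_def] upper_cut_def[abs_def] by (intro ramp_continuous continuous_intros)+

lemma cut_bounds: "0 \<le> lower_cut e j r" "lower_cut e j r \<le> 1" "0 \<le> upper_cut \<delta> j r" "upper_cut \<delta> j r \<le> 1"
  by (auto simp: lower_cut_def upper_cut_def)

lemma upper_cut_eq_0: "\<delta> \<le> r \<Longrightarrow> upper_cut \<delta> j r = 0"
  by (simp add: upper_cut_def mult_nonneg_nonpos)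

lemma lower_cut_eq_0:
  assumes "0 < e" "r < e / 2"
  shows "lower_cut e j r = 0"
proof -
  have "(real j + 2 / e) * (r - e) \<le> (2 / e) * (r - e)"
    using assms by (intro mult_right_mono_neg) auto
  also have "\<dots> \<le> (2 / e) * (- (e / 2))" using assms by (intro mult_left_mono) auto
  also have "\<dots> = - 1" using assms by simp
  finally show ?thesis by (simp add: lower_cut_def)
qed

lemma lower_cut_tendsto:
  assumes e: "0 < e"
  shows "(\<lambda>j. lower_cut e j r) \<longlonglongrightarrow> of_bool (e \<le> r)"
proof (cases "e \<le> r")
  case True
  then have "lower_cut e j r = 1" for j using e by (simp add: lower_cut_def)
  then show ?thesis using True by simp
next
  case False
  obtain N where N: "1 / (e - r) \<le> real N" using real_arch_simple by blast
  have "lower_cut e j r = 0" if "N \<le> j" for j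
  proof -
    have "1 / (e - r) \<le> real j + 2 / e" using N that e by (simp add: add_increasing2)
    then have "1 \<le> (real j + 2 / e) * (e - r)" using False by (simp add: divide_le_eq)
    moreover have "(real j + 2 / e) * (r - e) = - ((real j + 2 / e) * (e - r))" by (simp flip: mult_minus_right)
    ultimately show ?thesis unfolding lower_cut_def by (intro ramp_simps(1)) linarith
  qed
  then have "\<forall>\<^sub>F j in sequentially. lower_cut e j r = 0" by (auto simp: eventually_sequentially)
  then show ?thesis using False by (simp add: tendsto_eventually)
qed

lemma upper_cut_tendsto: "(\<lambda>j. upper_cut \<delta> j r) \<longlonglongrightarrow> of_bool (r < \<delta>)"
proof (cases "r < \<delta>")
  case True
  obtain N where N: "1 / (\<delta> - r) \<le> real N" using real_arch_simple by blast
  have "upper_cut \<delta> j r = 1" if "N \<le> j" for j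
  proof -
    have "1 / (\<delta> - r) \<le> real j" using N that by linarith
    then have "1 \<le> real j * (\<delta> - r)" using True by (simp add: divide_le_eq)
    then show ?thesis by (simp add: upper_cut_def)
  qed
  then have "\<forall>\<^sub>F j in sequentially. upper_cut \<delta> j r = 1" by (auto simp: eventually_sequentially)
  then show ?thesis using True by (simp add: tendsto_eventually)
qed (simp add: upper_cut_eq_0)

text \<open>The base threshold \<open>e\<close> makes the index set finite for paths in
  \<open>D0\<close>, while the selection by size is left to the weight \<kappa>. Sums with a common
  base can be added and subtracted, and \<open>Jsum_base\<close> changes the base as long as the
  weight vanishes below the larger of the two.\<close>

definition Jsum :: "real \<Rightarrow> ('a::euclidean_space \<Rightarrow> 'a) \<Rightarrow> 'a \<Rightarrow> real \<Rightarrow> (real \<Rightarrow> real) \<Rightarrow> (real \<Rightarrow> 'a) \<Rightarrow> real" where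
  "Jsum t A x e \<kappa> X = (\<Sum>s\<in>{s. 0 < s \<and> s \<le> t \<and> e \<le> norm (jump X s)}.
     \<kappa> (norm (jump X s)) * (A (x + left_lim X s + (1/2) *\<^sub>R jump X s) \<bullet> jump X s))"

lemma Jsum_base:
  assumes "X \<in> D0" "0 < e" "e \<le> e'" "\<And>r. r < e' \<Longrightarrow> \<kappa> r = 0"
  shows "Jsum t A x e \<kappa> X = Jsum t A x e' \<kappa> X"
  unfolding Jsum_def
proof (rule sum.mono_neutral_right)
  show "finite {s. 0 < s \<and> s \<le> t \<and> e \<le> norm (jump X s)}" by (rule D0_finite_jumps) (use assms in auto)
qed (use assms in \<open>auto intro: leI\<close>)

lemma Jsum_add: "X \<in> D0 \<Longrightarrow> Jsum t A x e \<kappa> X + Jsum t A x e \<kappa>' X = Jsum t A x e (\<lambda>r. \<kappa> r + \<kappa>' r) X"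
  by (simp add: Jsum_def sum.distrib distrib_right)

lemma Jsum_diff: "X \<in> D0 \<Longrightarrow> Jsum t A x e \<kappa> X - Jsum t A x e \<kappa>' X = Jsum t A x e (\<lambda>r. \<kappa> r - \<kappa>' r) X"
  by (simp add: Jsum_def sum_subtractf left_diff_distrib)

lemma Jsum_cong: "(\<And>r. e \<le> r \<Longrightarrow> \<kappa> r = \<kappa>' r) \<Longrightarrow> Jsum t A x e \<kappa> X = Jsum t A x e \<kappa>' X"
  by (auto simp: Jsum_def intro!: sum.cong)

lemma Ybig_eq_Jsum: "Ybig A x t X = Jsum t A x 1 (\<lambda>_. 1) X"
  by (simp add: Ybig_def Jsum_def)

text \<open>The lower bound is repeated in the weight so that the base can be lowered below
  \<open>e\<close> later on.\<close>

definition Jsmall :: "real \<Rightarrow> ('a::euclidean_space \<Rightarrow> 'a) \<Rightarrow> 'a \<Rightarrow> real \<Rightarrow> (real \<Rightarrow> 'a) \<Rightarrow> real" where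
  "Jsmall t A x e = Jsum t A x e (\<lambda>r. of_bool (e \<le> r \<and> r < 1))"

lemma sum_small_jumps_eq_Jsmall:
  assumes "X \<in> D0" "0 < e"
  shows "(\<Sum>s\<in>{s. 0 < s \<and> s \<le> t \<and> e \<le> norm (jump X s) \<and> norm (jump X s) < 1}.
     A (x + left_lim X s + (1/2) *\<^sub>R jump X s) \<bullet> jump X s) = Jsmall t A x e X"
  unfolding Jsmall_def Jsum_def
proof (rule sum.mono_neutral_cong_left)
  show "finite {s. 0 < s \<and> s \<le> t \<and> e \<le> norm (jump X s)}" by (rule D0_finite_jumps) (use assms in auto)
qed auto

context rel_levy_potential
begin

lemma Isum_tendsto_Jsum:
  assumes X: "X \<in> D0" and e: "0 < e" and \<kappa>: "continuous_on UNIV \<kappa>" "\<And>r. r < e \<Longrightarrow> \<kappa> r = 0"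
  shows "(\<lambda>n. Isum t A x \<kappa> n X) \<longlonglongrightarrow> Jsum t A x e \<kappa> X"
  unfolding Isum_def Jsum_def
  by (rule D0_jump_sum_limit[OF X t_nonneg e, where H = "\<lambda>v y. \<kappa> (norm y) * (A (x + v + (1/2) *\<^sub>R y) \<bullet> y)"])
    (auto intro!: continuous_intros continuous_on_compose2[OF \<kappa>(1)] continuous_on_compose2[OF A_cont] simp: \<kappa>(2))

text \<open>Two limits in succession: grid sums tend to the jump sum for a continuous weight, and
  continuous weights tend to the given one. Measurability and the bound of
  \<open>second_moment_Isum\<close> survive both, the latter by Fatou's lemma.\<close>

lemma Jsum_approx:
  assumes e: "0 < e" and c: "\<And>j. continuous_on UNIV (\<kappa> j)" and 0: "\<And>j r. r < e \<Longrightarrow> \<kappa> j r = 0"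
    and lim: "\<And>r. (\<lambda>j. \<kappa> j r) \<longlonglongrightarrow> \<kappa>' r"
  shows "Jsum t A x e \<kappa>' \<in> borel_measurable M"
    and "\<lbrakk>0 < \<delta>; \<delta> \<le> 1; \<And>j r. 0 \<le> \<kappa> j r; \<And>j r. \<kappa> j r \<le> 1; \<And>j r. \<delta> < r \<Longrightarrow> \<kappa> j r = 0\<rbrakk> \<Longrightarrow>
      (\<integral>\<^sup>+ X. ennreal ((Jsum t A x e \<kappa>' X)\<^sup>2) \<partial>M) \<le> ennreal (C_mom * \<delta>)"
proof -
  have \<kappa>m: "\<kappa> j \<in> borel_measurable borel" for j using c by (rule borel_measurable_continuous_onI)
  have m1: "Jsum t A x e (\<kappa> j) \<in> borel_measurable M" for j
    by (rule borel_measurable_LIMSEQ_metric[OF Isum_measurable[OF \<kappa>m]])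
      (rule Isum_tendsto_Jsum[OF _ e c 0], simp_all add: space_M)
  have l: "(\<lambda>j. Jsum t A x e (\<kappa> j) X) \<longlonglongrightarrow> Jsum t A x e \<kappa>' X" for X
    unfolding Jsum_def by (intro tendsto_intros lim)
  show "Jsum t A x e \<kappa>' \<in> borel_measurable M"
    by (rule borel_measurable_LIMSEQ_metric[OF m1]) (rule l)
  show "(\<integral>\<^sup>+ X. ennreal ((Jsum t A x e \<kappa>' X)\<^sup>2) \<partial>M) \<le> ennreal (C_mom * \<delta>)"
    if \<delta>: "0 < \<delta>" "\<delta> \<le> 1" and b: "\<And>j r. 0 \<le> \<kappa> j r" "\<And>j r. \<kappa> j r \<le> 1" "\<And>j r. \<delta> < r \<Longrightarrow> \<kappa> j r = 0"
  proof (rule nn_integral_square_le_of_tendsto[OF m1])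
    show "AE X in M. (\<lambda>j. Jsum t A x e (\<kappa> j) X) \<longlonglongrightarrow> Jsum t A x e \<kappa>' X" using l by simp
    have "(\<integral>\<^sup>+ X. ennreal ((Jsum t A x e (\<kappa> j) X)\<^sup>2) \<partial>M) \<le> ennreal (C_mom * \<delta>)" for j
    proof (rule nn_integral_square_le_of_tendsto[OF Isum_measurable[OF \<kappa>m]])
      show "AE X in M. (\<lambda>n. Isum t A x (\<kappa> j) n X) \<longlonglongrightarrow> Jsum t A x e (\<kappa> j) X"
        by (intro AE_I2 Isum_tendsto_Jsum[OF _ e c 0]) (simp_all add: space_M)
      show "\<forall>\<^sub>F n in sequentially. (\<integral>\<^sup>+ X. ennreal ((Isum t A x (\<kappa> j) n X)\<^sup>2) \<partial>M) \<le> ennreal (C_mom * \<delta>)"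
        by (intro always_eventually allI second_moment_Isum \<delta> \<kappa>m b)
    qed
    then show "\<forall>\<^sub>F j in sequentially. (\<integral>\<^sup>+ X. ennreal ((Jsum t A x e (\<kappa> j) X)\<^sup>2) \<partial>M) \<le> ennreal (C_mom * \<delta>)" by simp
  qed
qed

lemma Jsmall_measurable:
  assumes e: "0 < e"
  shows "Jsmall t A x e \<in> borel_measurable M"
proof -
  \<comment> \<open>The base is e/2 because that is the level below which the continuous
    approximations of the indicator of r \<ge> e all vanish.\<close>
  have "Jsum t A x (e/2) (\<lambda>r. of_bool (e \<le> r \<and> r < 1)) \<in> borel_measurable M"
  proof (rule Jsum_approx(1)[where \<kappa> = "\<lambda>j r. lower_cut e j r * upper_cut 1 j r"])
    show "(\<lambda>j. lower_cut e j r * upper_cut 1 j r) \<longlonglongrightarrow> of_bool (e \<le> r \<and> r < 1)" for r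
      using tendsto_mult[OF lower_cut_tendsto[OF e, of r] upper_cut_tendsto[of 1 r]] by (simp add: of_bool_conj)
  qed (use e in \<open>auto intro!: continuous_intros cut_continuous simp: lower_cut_eq_0\<close>)
  moreover have "Jsum t A x (e/2) (\<lambda>r. of_bool (e \<le> r \<and> r < 1)) X = Jsmall t A x e X" if "X \<in> space M" for X
    unfolding Jsmall_def by (rule Jsum_base) (use that e in \<open>auto simp: space_M\<close>)
  ultimately show ?thesis by (simp cong: measurable_cong)
qed

text \<open>The difference is the sum over the jumps of size in [e', e), so the mean-square bound
  applies with \<delta> = e. As e' does not enter the bound, this is the Cauchy property for e
  tending to 0.\<close>

lemma Jsmall_increment:
  assumes e: "0 < e'" "e' \<le> e" "e \<le> 1"
  shows "(\<integral>\<^sup>+ X. ennreal ((Jsmall t A x e' X - Jsmall t A x e X)\<^sup>2) \<partial>M) \<le> ennreal (C_mom * e)"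
proof -
  have "(\<integral>\<^sup>+ X. ennreal ((Jsum t A x (e'/2) (\<lambda>r. of_bool (e' \<le> r) * of_bool (r < e)) X)\<^sup>2) \<partial>M) \<le> ennreal (C_mom * e)"
  proof (rule Jsum_approx(2)[where \<kappa> = "\<lambda>j r. lower_cut e' j r * upper_cut e j r"])
    show "(\<lambda>j. lower_cut e' j r * upper_cut e j r) \<longlonglongrightarrow> of_bool (e' \<le> r) * of_bool (r < e)" for r
      by (intro tendsto_mult lower_cut_tendsto upper_cut_tendsto e)
    show "continuous_on UNIV (\<lambda>r. lower_cut e' j r * upper_cut e j r)" for j
      by (intro continuous_intros cut_continuous)
    show "lower_cut e' j r * upper_cut e j r \<le> 1" for j r
      by (intro mult_le_one cut_bounds)
  qed (use e in \<open>auto simp: lower_cut_eq_0 upper_cut_eq_0 cut_bounds\<close>)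
  moreover have "Jsum t A x (e'/2) (\<lambda>r. of_bool (e' \<le> r) * of_bool (r < e)) X = Jsmall t A x e' X - Jsmall t A x e X"
    if "X \<in> space M" for X
  proof -
    have X: "X \<in> D0" using that by (simp add: space_M)
    have b: "Jsum t A x (e'/2) (\<lambda>r. of_bool (u \<le> r \<and> r < 1)) X = Jsmall t A x u X" if "e' \<le> u" for u
      unfolding Jsmall_def by (rule Jsum_base) (use that e X in auto)
    show ?thesis
      using e unfolding b[OF order_refl, symmetric] b[OF e(2), symmetric] Jsum_diff[OF X]
      by (intro Jsum_cong) auto
  qed
  ultimately show ?thesis by (simp cong: nn_integral_cong)
qed

text \<open>Along the thresholds 4^-k the mean squares of the increments are at most
  \<open>C_mom\<close> 4^-k, so the increments are summable in mean and the sums converge almost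
  surely. Fatou's lemma then compares the limit with an arbitrary e.\<close>

lemma ex_Jsmall_limit:
  obtains Z where "Z \<in> borel_measurable M"
    "\<And>e. 0 < e \<Longrightarrow> e \<le> 1 \<Longrightarrow> (\<integral>\<^sup>+ X. ennreal ((Jsmall t A x e X - Z X)\<^sup>2) \<partial>M) \<le> ennreal (C_mom * e)"
proof -
  define q where "q k = (1/4 :: real) ^ k" for k
  define J where "J k = Jsmall t A x (q k)" for k
  have q: "0 < q k" "q (Suc k) \<le> q k" "q k \<le> 1" for k by (auto simp: q_def power_le_one)
  have qdec: "q k \<le> q j" if "j \<le> k" for j k using that by (simp add: q_def power_decreasing)
  have Jm[measurable]: "J k \<in> borel_measurable M" for k unfolding J_def by (intro Jsmall_measurable q)
  have inc: "(\<integral>\<^sup>+ X. ennreal ((J (Suc k) X - J k X)\<^sup>2) \<partial>M) \<le> ennreal (C_mom * q k)" for k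
    unfolding J_def by (intro Jsmall_increment q)
  have inc1: "(\<integral>\<^sup>+ X. ennreal \<bar>J (Suc k) X - J k X\<bar> \<partial>M) \<le> ennreal ((C_mom + 1) * (1/2)^k)" for k
  proof -
    \<comment> \<open>Arithmetic-geometric mean inequality, with 2^k balancing a mean square of
      order 4^-k.\<close>
    have "\<bar>u\<bar> \<le> 2 ^ k * u\<^sup>2 + (1/2)^k" for u :: real
    proof -
      have "0 \<le> (2 ^ k * \<bar>u\<bar> - 1)\<^sup>2" by simp
      then have "2 * (2 ^ k * \<bar>u\<bar>) \<le> (2 ^ k)\<^sup>2 * u\<^sup>2 + 1" by (simp add: power2_diff power_mult_distrib)
      then have "(1/2)^k * (2 * (2 ^ k * \<bar>u\<bar>)) \<le> (1/2)^k * ((2 ^ k)\<^sup>2 * u\<^sup>2 + 1)" by (intro mult_left_mono) auto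
      then have "2 * \<bar>u\<bar> \<le> 2 ^ k * u\<^sup>2 + (1/2)^k"
        by (simp add: distrib_left power_divide power2_eq_square)
      then show ?thesis by linarith
    qed
    then have "(\<integral>\<^sup>+ X. ennreal \<bar>J (Suc k) X - J k X\<bar> \<partial>M) \<le> (\<integral>\<^sup>+ X. ennreal (2^k) * ennreal ((J (Suc k) X - J k X)\<^sup>2) + ennreal ((1/2)^k) \<partial>M)"
      by (intro nn_integral_mono) (simp add: ennreal_mult'[symmetric] ennreal_plus[symmetric] del: ennreal_plus)
    also have "\<dots> = ennreal (2^k) * (\<integral>\<^sup>+ X. ennreal ((J (Suc k) X - J k X)\<^sup>2) \<partial>M) + ennreal ((1/2)^k)"
      by (simp add: nn_integral_add nn_integral_cmult emeasure_space_1)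
    also have "\<dots> \<le> ennreal (2^k) * ennreal (C_mom * q k) + ennreal ((1/2)^k)"
      by (intro add_right_mono mult_left_mono inc) simp
    also have "\<dots> = ennreal (2^k * (C_mom * q k) + (1/2)^k)"
      using C_mom_nonneg q(1)[of k] by (simp add: ennreal_mult'[symmetric] ennreal_plus[symmetric] less_imp_le del: ennreal_plus)
    also have "2^k * (C_mom * q k) + (1/2)^k = (C_mom + 1) * (1/2)^k"
    proof -
      have "2 ^ k * q k = (1/2)^k" unfolding q_def power_mult_distrib[symmetric] by simp
      then show ?thesis by (simp add: algebra_simps)
    qed
    finally show ?thesis .
  qed
  have "(\<integral>\<^sup>+ X. (\<Sum>k. ennreal \<bar>J (Suc k) X - J k X\<bar>) \<partial>M) = (\<Sum>k. \<integral>\<^sup>+ X. ennreal \<bar>J (Suc k) X - J k X\<bar> \<partial>M)"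
    by (intro nn_integral_suminf) measurable
  also have "\<dots> \<le> (\<Sum>k. ennreal ((C_mom + 1) * (1/2)^k))"
    by (intro suminf_le inc1) auto
  also have "\<dots> < \<infinity>"
    using C_mom_nonneg by (subst suminf_ennreal2) (auto intro!: summable_mult summable_geometric)
  finally have "AE X in M. (\<Sum>k. ennreal \<bar>J (Suc k) X - J k X\<bar>) \<noteq> \<infinity>"
    by (intro nn_integral_PInf_AE) auto
  then have conv: "AE X in M. convergent (\<lambda>k. J k X)"
  proof eventually_elim
    case (elim X)
    then have "summable (\<lambda>k. \<bar>J (Suc k) X - J k X\<bar>)"
      by (intro summable_suminf_not_top) (auto simp: infinity_ennreal_def)
    then have "summable (\<lambda>k. J (Suc k) X - J k X)" by (rule summable_rabs_cancel)
    then have "convergent (\<lambda>n. \<Sum>k<n. J (Suc k) X - J k X)" by (simp add: summable_iff_convergent)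
    then have "convergent (\<lambda>n. J n X - J 0 X)" by (simp only: sum_lessThan_telescope[of "\<lambda>k. J k X"])
    then have "convergent (\<lambda>n. (J n X - J 0 X) + J 0 X)" by (rule convergent_add) (rule convergent_const)
    then show ?case by simp
  qed
  \<comment> \<open>The value is unspecified where the sequence diverges, which is a null
    set.\<close>
  define Z where "Z X = lim (\<lambda>k. J k X)" for X
  have Zm[measurable]: "Z \<in> borel_measurable M" unfolding Z_def by (rule borel_measurable_lim_metric) simp
  have lim: "AE X in M. (\<lambda>k. J k X) \<longlonglongrightarrow> Z X"
    using conv by eventually_elim (simp add: Z_def convergent_LIMSEQ_iff)
  have "(\<integral>\<^sup>+ X. ennreal ((Jsmall t A x e X - Z X)\<^sup>2) \<partial>M) \<le> ennreal (C_mom * e)" if e: "0 < e" "e \<le> 1" for e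
  proof (rule nn_integral_square_le_of_tendsto[where f = "\<lambda>k X. Jsmall t A x e X - J k X"])
    show "(\<lambda>X. Jsmall t A x e X - J k X) \<in> borel_measurable M" for k
      by (intro borel_measurable_diff Jsmall_measurable e Jm)
    show "AE X in M. (\<lambda>k. Jsmall t A x e X - J k X) \<longlonglongrightarrow> Jsmall t A x e X - Z X"
      using lim by eventually_elim (intro tendsto_intros)
    have "q \<longlonglongrightarrow> 0" unfolding q_def by (intro LIMSEQ_power_zero) simp
    then have "\<forall>\<^sub>F k in sequentially. q k < e" using e(1) by (rule order_tendstoD(2))
    then show "\<forall>\<^sub>F k in sequentially. (\<integral>\<^sup>+ X. ennreal ((Jsmall t A x e X - J k X)\<^sup>2) \<partial>M) \<le> ennreal (C_mom * e)"
    proof eventually_elim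
      case (elim k)
      then show ?case using Jsmall_increment[of "q k" e] q e by (simp add: J_def power2_commute)
    qed
  qed
  then show thesis using that Zm by blast
qed

end

section \<open>Cancellation of the compensator against the drift\<close>

context rel_levy_potential
begin

text \<open>Subtracting A z makes the integrand quadratic in y, so that the integral exists down to
  y = 0; on symmetric shells away from 0 the subtracted term integrates to zero.\<close>

definition bint :: "'a set \<Rightarrow> 'a \<Rightarrow> real" where
  "bint S z = (LBINT y:S. ((A (z + (1/2) *\<^sub>R y) - A z) \<bullet> y) * nm m y)"

definition mom2 :: "'a set \<Rightarrow> real" where
  "mom2 S = (LBINT y:S. (norm y)\<^sup>2 * nm m y)"

lemma nm_measurable [measurable]: "(nm m :: 'a \<Rightarrow> real) \<in> borel_measurable borel"
  by measurable

lemma mom2_integrable: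
  assumes "S \<in> sets borel" "S \<subseteq> {y. 0 < norm y \<and> norm y < 1}"
  shows "set_integrable lborel S (\<lambda>y::'a. (norm y)\<^sup>2 * nm m y)"
proof -
  have "set_integrable lborel {y::'a. 0 < norm y \<and> norm y < 1} (\<lambda>y. (norm y)\<^sup>2 * nm m y)"
    unfolding set_integrable_def real_scaleR_def by (rule nm_second_moment_integrable[OF m_nonneg])
  moreover have "S \<in> sets lborel" using assms(1) by simp
  ultimately show ?thesis using assms(2) by (rule set_integrable_subset)
qed

lemma bint_integrand_bound:
  "\<bar>((A (z + (1/2) *\<^sub>R y) - A z) \<bullet> y) * nm m y\<bar> \<le> L / 2 * ((norm y)\<^sup>2 * nm m y)"
proof -
  have "\<bar>(A (z + (1/2) *\<^sub>R y) - A z) \<bullet> y\<bar> \<le> norm (A (z + (1/2) *\<^sub>R y) - A z) * norm y"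
    by (rule Cauchy_Schwarz_ineq2)
  also have "\<dots> \<le> (L * (norm y / 2)) * norm y"
    using A_lip[of "z + (1/2) *\<^sub>R y" z] by (intro mult_right_mono) auto
  also have "\<dots> = L / 2 * (norm y)\<^sup>2" by (simp add: power2_eq_square)
  finally have "\<bar>(A (z + (1/2) *\<^sub>R y) - A z) \<bullet> y\<bar> * nm m y \<le> L / 2 * (norm y)\<^sup>2 * nm m y"
    by (intro mult_right_mono levy_dens_nonneg m_nonneg)
  then show ?thesis by (simp add: abs_mult levy_dens_nonneg m_nonneg mult.assoc)
qed

lemma bint_integrand_measurable:
  assumes S: "S \<in> sets borel"
  shows "(\<lambda>y. indicat_real S y *\<^sub>R (((A (z + (1/2) *\<^sub>R y) - A z) \<bullet> y) * nm m y)) \<in> borel_measurable lborel"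
    "(\<lambda>y. indicat_real S y *\<^sub>R ((A z \<bullet> y) * nm m y)) \<in> borel_measurable borel"
proof -
  have [simp]: "(\<lambda>y. A (z + (1/2) *\<^sub>R y)) \<in> borel_measurable borel"
    by (rule measurable_compose[OF _ A_measurable]) simp
  show "(\<lambda>y. indicat_real S y *\<^sub>R (((A (z + (1/2) *\<^sub>R y) - A z) \<bullet> y) * nm m y)) \<in> borel_measurable lborel"
    "(\<lambda>y. indicat_real S y *\<^sub>R ((A z \<bullet> y) * nm m y)) \<in> borel_measurable borel"
    using S by (auto intro!: borel_measurable_scaleR borel_measurable_times borel_measurable_inner borel_measurable_diff
        borel_measurable_indicator)
qed

lemma bint_integrable:
  assumes S: "S \<in> sets borel" "S \<subseteq> {y. 0 < norm y \<and> norm y < 1}"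
  shows "set_integrable lborel S (\<lambda>y. ((A (z + (1/2) *\<^sub>R y) - A z) \<bullet> y) * nm m y)"
  unfolding set_integrable_def
proof (rule Bochner_Integration.integrable_bound)
  show "integrable lborel (\<lambda>y. L / 2 * (indicat_real S y *\<^sub>R ((norm y)\<^sup>2 * nm m y)))"
    using mom2_integrable[OF S] unfolding set_integrable_def by (rule integrable_mult_right)
  show "(\<lambda>y. indicat_real S y *\<^sub>R (((A (z + (1/2) *\<^sub>R y) - A z) \<bullet> y) * nm m y)) \<in> borel_measurable lborel"
    by (rule bint_integrand_measurable(1)[OF S(1)])
  show "AE y in lborel. norm (indicat_real S y *\<^sub>R (((A (z + (1/2) *\<^sub>R y) - A z) \<bullet> y) * nm m y))
    \<le> norm (L / 2 * (indicat_real S y *\<^sub>R ((norm y)\<^sup>2 * nm m y)))"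
  proof (intro AE_I2)
    fix y :: 'a
    show "norm (indicat_real S y *\<^sub>R (((A (z + (1/2) *\<^sub>R y) - A z) \<bullet> y) * nm m y))
      \<le> norm (L / 2 * (indicat_real S y *\<^sub>R ((norm y)\<^sup>2 * nm m y)))"
      using order_trans[OF bint_integrand_bound abs_ge_self, of z y] by (cases "y \<in> S") simp_all
  qed
qed

lemma bint_bound:
  assumes S: "S \<in> sets borel" "S \<subseteq> {y. 0 < norm y \<and> norm y < 1}"
  shows "\<bar>bint S z\<bar> \<le> L / 2 * mom2 S"
proof -
  have "\<bar>bint S z\<bar> \<le> (LINT y|lborel. \<bar>indicat_real S y *\<^sub>R (((A (z + (1/2) *\<^sub>R y) - A z) \<bullet> y) * nm m y)\<bar>)"
    unfolding bint_def set_lebesgue_integral_def by (rule integral_abs_bound)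
  also have "\<dots> \<le> (LINT y|lborel. L / 2 * (indicat_real S y *\<^sub>R ((norm y)\<^sup>2 * nm m y)))"
  proof (rule integral_mono')
    show "integrable lborel (\<lambda>y. L / 2 * (indicat_real S y *\<^sub>R ((norm y)\<^sup>2 * nm m y)))"
      using mom2_integrable[OF S] unfolding set_integrable_def by (rule integrable_mult_right)
    show "\<bar>indicat_real S y *\<^sub>R (((A (z + (1/2) *\<^sub>R y) - A z) \<bullet> y) * nm m y)\<bar> \<le> L / 2 * (indicat_real S y *\<^sub>R ((norm y)\<^sup>2 * nm m y))" for y
      using bint_integrand_bound[of z y] by (cases "y \<in> S") simp_all
    show "0 \<le> L / 2 * (indicat_real S y *\<^sub>R ((norm y)\<^sup>2 * nm m y))" for y
      using L_nonneg by (simp add: levy_dens_nonneg m_nonneg)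
  qed
  finally show ?thesis by (simp add: mom2_def set_lebesgue_integral_def)
qed

text \<open>By dominated convergence with the second moment as majorant. Continuity is what makes
  the integral of \<open>bint S\<close> along a path a limit of Riemann sums.\<close>

lemma bint_continuous:
  assumes S: "S \<in> sets borel" "S \<subseteq> {y. 0 < norm y \<and> norm y < 1}"
  shows "continuous_on UNIV (bint S)"
  unfolding continuous_on_sequentially
proof (intro allI ballI impI, elim conjE)
  fix u z assume u: "u \<longlonglongrightarrow> (z::'a)"
  have mm: "(\<lambda>y. indicat_real S y *\<^sub>R (((A (z + (1/2) *\<^sub>R y) - A z) \<bullet> y) * nm m y)) \<in> borel_measurable lborel" for z
    by (rule bint_integrand_measurable(1)[OF S(1)])
  show "(bint S \<circ> u) \<longlonglongrightarrow> bint S z"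
    unfolding bint_def set_lebesgue_integral_def comp_def
  proof (rule integral_dominated_convergence[OF mm mm])
    show "integrable lborel (\<lambda>y. L / 2 * (indicat_real S y *\<^sub>R ((norm y)\<^sup>2 * nm m y)))"
      using mom2_integrable[OF S] unfolding set_integrable_def by (rule integrable_mult_right)
    show "AE y in lborel. norm (indicat_real S y *\<^sub>R (((A (u i + (1/2) *\<^sub>R y) - A (u i)) \<bullet> y) * nm m y))
        \<le> L / 2 * (indicat_real S y *\<^sub>R ((norm y)\<^sup>2 * nm m y))" for i
    proof (intro AE_I2)
      fix y :: 'a
      show "norm (indicat_real S y *\<^sub>R (((A (u i + (1/2) *\<^sub>R y) - A (u i)) \<bullet> y) * nm m y))
        \<le> L / 2 * (indicat_real S y *\<^sub>R ((norm y)\<^sup>2 * nm m y))"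
        using bint_integrand_bound[of "u i" y] by (cases "y \<in> S") simp_all
    qed
    have Ac: "(\<lambda>n. A (v n)) \<longlonglongrightarrow> A w" if "v \<longlonglongrightarrow> w" for v w
      by (rule continuous_on_tendsto_compose[OF A_cont that]) auto
    show "AE y in lborel. (\<lambda>i. indicat_real S y *\<^sub>R (((A (u i + (1/2) *\<^sub>R y) - A (u i)) \<bullet> y) * nm m y))
       \<longlonglongrightarrow> indicat_real S y *\<^sub>R (((A (z + (1/2) *\<^sub>R y) - A z) \<bullet> y) * nm m y)"
      by (intro AE_I2 tendsto_scaleR tendsto_const tendsto_mult tendsto_inner tendsto_diff Ac tendsto_add u)
  qed
qed

text \<open>The integral over time is a limit of sums that involve finitely many coordinates of the
  path each.\<close>

lemma time_integral_measurable:
  fixes F :: "'a \<Rightarrow> real"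
  assumes F: "continuous_on UNIV F" "\<And>z. \<bar>F z\<bar> \<le> B"
  shows "(\<lambda>X. LBINT s:{0<..t}. F (x + X s)) \<in> borel_measurable M"
proof (rule borel_measurable_LIMSEQ_metric)
  have [measurable]: "F \<in> borel_measurable borel" using F(1) by (rule borel_measurable_continuous_onI)
  show "(\<lambda>X. \<Sum>k<n. t / real n * F (x + X (grid t n (Suc k)))) \<in> borel_measurable M" for n
    by measurable
  show "(\<lambda>n. \<Sum>k<n. t / real n * F (x + X (grid t n (Suc k)))) \<longlonglongrightarrow> (LBINT s:{0<..t}. F (x + X s))" if "X \<in> space M" for X
    using that by (intro D0_set_integral_limit(2)[OF _ t_nonneg F]) (simp add: space_M)
qed

lemma punctured_shell_sets:
  "{y::'a. e \<le> norm y \<and> norm y < 1} \<in> sets borel" "{y::'a. 0 < norm y \<and> norm y < e} \<in> sets borel"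
  by measurable

text \<open>The term A z . y times the Levy density is odd in y and the shell is symmetric, so
  subtracting it changes nothing.\<close>

lemma inner_compensator_eq:
  assumes e: "0 < e"
  shows "(LBINT y:{y. e \<le> norm y \<and> norm y < 1}. (A (z + (1/2) *\<^sub>R y) \<bullet> y) * nm m y)
     = bint {y. e \<le> norm y \<and> norm y < 1} z"
proof -
  let ?S = "{y::'a. e \<le> norm y \<and> norm y < 1}"
  have S: "?S \<in> sets borel" "?S \<subseteq> {y. 0 < norm y \<and> norm y < 1}"
    using e by (auto simp: punctured_shell_sets)
  have m1[measurable]: "(\<lambda>y. indicat_real ?S y *\<^sub>R ((A z \<bullet> y) * nm m y)) \<in> borel_measurable borel"
    by (rule bint_integrand_measurable(2)[OF S(1)])
  have i: "set_integrable lborel ?S (\<lambda>y. (A z \<bullet> y) * nm m y)"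
    unfolding set_integrable_def
  proof (rule Bochner_Integration.integrable_bound)
    show "integrable lborel (\<lambda>y. a / e * (indicat_real ?S y *\<^sub>R ((norm y)\<^sup>2 * nm m y)))"
      using mom2_integrable[OF S] unfolding set_integrable_def by (rule integrable_mult_right)
    show "AE y in lborel. norm (indicat_real ?S y *\<^sub>R ((A z \<bullet> y) * nm m y)) \<le> norm (a / e * (indicat_real ?S y *\<^sub>R ((norm y)\<^sup>2 * nm m y)))"
    proof (intro AE_I2)
      fix y :: 'a
      show "norm (indicat_real ?S y *\<^sub>R ((A z \<bullet> y) * nm m y)) \<le> norm (a / e * (indicat_real ?S y *\<^sub>R ((norm y)\<^sup>2 * nm m y)))"
      proof (cases "y \<in> ?S")
        case True
        have "\<bar>A z \<bullet> y\<bar> \<le> a * norm y"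
          by (rule order_trans[OF Cauchy_Schwarz_ineq2]) (intro mult_right_mono A_bound, simp)
        \<comment> \<open>On the shell \<open>norm y \<ge> e\<close>, which turns the first power of
          the norm into a second moment.\<close>
        also have "\<dots> \<le> a * (norm y * (norm y / e))"
          using True e by (intro mult_left_mono a_nonneg) (simp add: pos_le_divide_eq mult_left_mono)
        also have "\<dots> = a / e * (norm y)\<^sup>2" by (simp add: power2_eq_square)
        finally have "\<bar>A z \<bullet> y\<bar> * nm m y \<le> a / e * (norm y)\<^sup>2 * nm m y"
          by (intro mult_right_mono levy_dens_nonneg m_nonneg)
        then have "\<bar>(A z \<bullet> y) * nm m y\<bar> \<le> \<bar>a / e * ((norm y)\<^sup>2 * nm m y)\<bar>"
          unfolding abs_mult[of "A z \<bullet> y"] abs_of_nonneg[OF levy_dens_nonneg[OF m_nonneg]] mult.assoc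
          by (rule order_trans[OF _ abs_ge_self])
        then show ?thesis using True by (simp only: indicator_simps scaleR_one real_norm_def)
      qed simp
    qed
  qed simp
  have "(LBINT y:?S. (A z \<bullet> y) * nm m y) = 0"
    unfolding set_lebesgue_integral_def by (rule integral_odd_eq_0[OF m1]) (simp add: indicator_def)
  moreover have "(LBINT y:?S. (A (z + (1/2) *\<^sub>R y) \<bullet> y) * nm m y)
     = (LBINT y:?S. ((A (z + (1/2) *\<^sub>R y) - A z) \<bullet> y) * nm m y + (A z \<bullet> y) * nm m y)"
    by (simp add: inner_diff_left left_diff_distrib)
  ultimately show ?thesis
    using set_integral_add(2)[OF bint_integrable[OF S, of z] i] by (simp add: bint_def)
qed

lemma Ytrunc_eq:
  assumes X: "X \<in> D0" and e: "0 < e"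
  shows "Ytrunc m A x t e X = Jsmall t A x e X - (LBINT s:{0<..t}. bint {y. e \<le> norm y \<and> norm y < 1} (x + X s))"
proof -
  \<comment> \<open>Left limits may be replaced by values under the time integral, since a path in
    \<open>D0\<close> has only countably many jumps.\<close>
  have "(LBINT s:{0<..t}. bint {y. e \<le> norm y \<and> norm y < 1} (x + left_lim X s))
      = (LBINT s:{0<..t}. bint {y. e \<le> norm y \<and> norm y < 1} (x + X s))"
    unfolding set_lebesgue_integral_def
    by (rule integral_discrete_difference[OF D0_countable_jumps[OF X]]) (auto simp: indicator_def)
  then show ?thesis
    unfolding Ytrunc_def sum_small_jumps_eq_Jsmall[OF X e] inner_compensator_eq[OF e] by simp
qed

lemma Ydrift_eq: "Ydrift m A x t X = (LBINT s:{0<..t}. bint {y. 0 < norm y \<and> norm y < 1} (x + X s))"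
  by (simp add: Ydrift_def bint_def)

lemma Ydrift_measurable: "Ydrift m A x t \<in> borel_measurable M"
proof -
  have S: "{y::'a. 0 < norm y \<and> norm y < 1} \<in> sets borel" by (rule punctured_shell_sets)
  show ?thesis unfolding Ydrift_eq[abs_def]
    by (rule time_integral_measurable[OF bint_continuous[OF S order_refl] bint_bound[OF S order_refl]])
qed

lemma Ytrunc_measurable:
  assumes e: "0 < e"
  shows "Ytrunc m A x t e \<in> borel_measurable M"
proof -
  have S: "{y::'a. e \<le> norm y \<and> norm y < 1} \<in> sets borel" "{y::'a. e \<le> norm y \<and> norm y < 1} \<subseteq> {y. 0 < norm y \<and> norm y < 1}"
    using e by (auto simp: punctured_shell_sets)
  have "(\<lambda>X. Jsmall t A x e X - (LBINT s:{0<..t}. bint {y. e \<le> norm y \<and> norm y < 1} (x + X s))) \<in> borel_measurable M"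
    by (intro borel_measurable_diff Jsmall_measurable e time_integral_measurable[OF bint_continuous[OF S] bint_bound[OF S]])
  then show ?thesis
    by (subst measurable_cong[OF Ytrunc_eq[OF _ e]]) (simp_all add: space_M)
qed

text \<open>The compensator in \<open>Ytrunc\<close> integrates \<open>bint\<close> over e \<le> |y|
  < 1 and the drift over 0 < |y| < 1, so that only 0 < |y| < e is left; the Lipschitz bound for A
  controls this by the second moment of the Levy density there.\<close>

lemma Ytrunc_drift_diff:
  assumes X: "X \<in> D0" and e: "0 < e" "e \<le> 1"
  shows "\<bar>Jsmall t A x e X - Ydrift m A x t X - Ytrunc m A x t e X\<bar> \<le> t * (L / 2 * mom2 {y. 0 < norm y \<and> norm y < e})"
proof -
  let ?S = "{y::'a. e \<le> norm y \<and> norm y < 1}" and ?P = "{y::'a. 0 < norm y \<and> norm y < 1}" and ?R = "{y::'a. 0 < norm y \<and> norm y < e}"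
  have S: "?S \<in> sets borel" "?S \<subseteq> ?P" and R: "?R \<in> sets borel" "?R \<subseteq> ?P" and P: "?P \<in> sets borel"
    using e by (auto simp: punctured_shell_sets)
  have split: "bint ?P z = bint ?R z + bint ?S z" for z
  proof -
    have "?P = ?R \<union> ?S" using e by auto
    then have "bint ?P z = (LBINT y:?R \<union> ?S. ((A (z + (1/2) *\<^sub>R y) - A z) \<bullet> y) * nm m y)" by (simp only: bint_def)
    also have "\<dots> = bint ?R z + bint ?S z"
      unfolding bint_def by (rule set_integral_Un[OF _ bint_integrable[OF R] bint_integrable[OF S]]) auto
    finally show ?thesis .
  qed
  note iS = D0_set_integrable[OF X t_nonneg bint_continuous[OF S] bint_bound[OF S], of x]
    and iR = D0_set_integrable[OF X t_nonneg bint_continuous[OF R] bint_bound[OF R], of x]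
  have "Jsmall t A x e X - Ydrift m A x t X - Ytrunc m A x t e X = - (LBINT s:{0<..t}. bint ?R (x + X s))"
    unfolding Ytrunc_eq[OF X e(1)] Ydrift_eq split using set_integral_add(2)[OF iR iS] by simp
  also have "\<bar>\<dots>\<bar> = \<bar>LINT s|lborel. indicat_real {0<..t} s *\<^sub>R bint ?R (x + X s)\<bar>"
    by (simp add: set_lebesgue_integral_def)
  also have "\<dots> \<le> (LINT s|lborel. \<bar>indicat_real {0<..t} s *\<^sub>R bint ?R (x + X s)\<bar>)"
    by (rule integral_abs_bound)
  also have "\<dots> \<le> (LINT s|lborel. indicat_real {0<..t} s * (L / 2 * mom2 ?R))"
  proof (rule integral_mono')
    show "integrable lborel (\<lambda>s. indicat_real {0<..t} s * (L / 2 * mom2 ?R))"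
      using t_nonneg by (intro integrable_mult_left) simp
    have "0 \<le> L / 2 * mom2 ?R" using bint_bound[OF R, of 0] by linarith
    then show "0 \<le> indicat_real {0<..t} s * (L / 2 * mom2 ?R)" for s by simp
    show "\<bar>indicat_real {0<..t} s *\<^sub>R bint ?R (x + X s)\<bar> \<le> indicat_real {0<..t} s * (L / 2 * mom2 ?R)" for s
      using bint_bound[OF R, of "x + X s"] by (cases "s \<in> {0<..t}") simp_all
  qed
  also have "\<dots> = t * (L / 2 * mom2 ?R)" using t_nonneg by simp
  finally show ?thesis .
qed

lemma mom2_tendsto_0: "((\<lambda>e. mom2 {y. 0 < norm y \<and> norm y < e}) \<longlongrightarrow> 0) (at_right 0)"
proof (rule tendsto_at_right_sequentially[of 0 1])
  fix u :: "nat \<Rightarrow> real" assume u: "\<And>n. 0 < u n" "\<And>n. u n < 1" "decseq u" "u \<longlonglongrightarrow> 0"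
  have R: "{y::'a. 0 < norm y \<and> norm y < u n} \<in> sets borel" for n by (rule punctured_shell_sets)
  have "(\<lambda>n. LINT y|lborel. indicat_real {y::'a. 0 < norm y \<and> norm y < u n} y *\<^sub>R ((norm y)\<^sup>2 * nm m y)) \<longlonglongrightarrow> (LINT y|(lborel::'a measure). 0)"
  proof (rule integral_dominated_convergence)
    show "integrable lborel (\<lambda>y::'a. indicator {y. 0 < norm y \<and> norm y < 1} y * ((norm y)\<^sup>2 * nm m y))"
      by (rule nm_second_moment_integrable[OF m_nonneg])
    show "AE y in lborel. (\<lambda>n. indicat_real {y::'a. 0 < norm y \<and> norm y < u n} y *\<^sub>R ((norm y)\<^sup>2 * nm m y)) \<longlonglongrightarrow> 0"
    proof (intro AE_I2)
      fix y :: 'a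
      have "\<forall>\<^sub>F n in sequentially. indicat_real {y::'a. 0 < norm y \<and> norm y < u n} y *\<^sub>R ((norm y)\<^sup>2 * nm m y) = 0"
      proof (cases "y = 0")
        case False
        then have "\<forall>\<^sub>F n in sequentially. u n < norm y" using order_tendstoD(2)[OF u(4), of "norm y"] by simp
        then show ?thesis by eventually_elim (simp add: indicator_def)
      qed simp
      then show "(\<lambda>n. indicat_real {y::'a. 0 < norm y \<and> norm y < u n} y *\<^sub>R ((norm y)\<^sup>2 * nm m y)) \<longlonglongrightarrow> 0"
        by (rule tendsto_eventually)
    qed
    show "AE y in lborel. norm (indicat_real {y::'a. 0 < norm y \<and> norm y < u n} y *\<^sub>R ((norm y)\<^sup>2 * nm m y))
      \<le> indicator {y. 0 < norm y \<and> norm y < 1} y * ((norm y)\<^sup>2 * nm m y)" for n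
      using less_trans[OF _ u(2)] by (intro AE_I2) (auto simp: indicator_def abs_mult levy_dens_nonneg m_nonneg)
    show "(\<lambda>y. indicat_real {y::'a. 0 < norm y \<and> norm y < u n} y *\<^sub>R ((norm y)\<^sup>2 * nm m y)) \<in> borel_measurable lborel" for n
      using less_trans[OF _ u(2)]
      by (intro borel_measurable_integrable mom2_integrable[unfolded set_integrable_def] R) auto
  qed simp
  then show "(\<lambda>n. mom2 {y::'a. 0 < norm y \<and> norm y < u n}) \<longlonglongrightarrow> 0"
    by (simp add: mom2_def set_lebesgue_integral_def)
qed simp

lemma nn_integral_add_square_le:
  assumes [measurable]: "f \<in> borel_measurable M" "g \<in> borel_measurable M"
  shows "(\<integral>\<^sup>+ X. ennreal ((f X + g X)\<^sup>2) \<partial>M) \<le> 2 * (\<integral>\<^sup>+ X. ennreal ((f X)\<^sup>2) \<partial>M) + 2 * (\<integral>\<^sup>+ X. ennreal ((g X)\<^sup>2) \<partial>M)"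
proof -
  have "(u + v)\<^sup>2 \<le> 2 * u\<^sup>2 + 2 * v\<^sup>2" for u v :: real
    using sum_squares_bound[of u v] by (simp add: power2_sum)
  then have "(\<integral>\<^sup>+ X. ennreal ((f X + g X)\<^sup>2) \<partial>M) \<le> (\<integral>\<^sup>+ X. 2 * ennreal ((f X)\<^sup>2) + 2 * ennreal ((g X)\<^sup>2) \<partial>M)"
    by (intro nn_integral_mono) (simp add: ennreal_leI flip: ennreal_mult'' ennreal_plus ennreal_numeral)
  also have "\<dots> = 2 * (\<integral>\<^sup>+ X. ennreal ((f X)\<^sup>2) \<partial>M) + 2 * (\<integral>\<^sup>+ X. ennreal ((g X)\<^sup>2) \<partial>M)"
    by (simp add: nn_integral_add nn_integral_cmult)
  finally show ?thesis .
qed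

text \<open>\<open>Ysmall\<close> is an arbitrary choice among the mean-square limits of
  \<open>Ytrunc\<close>. One such limit is \<open>Z - Ydrift\<close>, where Z is the limit of the
  plain jump sums. Mean-square limits agree almost surely, so the drift cancels and
  \<open>Ybig + Z\<close> remains, in which the Levy density no longer occurs.\<close>

lemma Yfun_eq:
  obtains Z where "Z \<in> borel_measurable M"
    "\<And>e. 0 < e \<Longrightarrow> e \<le> 1 \<Longrightarrow> (\<integral>\<^sup>+ X. ennreal ((Jsmall t A x e X - Z X)\<^sup>2) \<partial>M) \<le> ennreal (C_mom * e)"
    "AE X in M. Yfun M m A t x X = Ybig A x t X + Z X"
    "Yfun M m A t x \<in> borel_measurable M"
proof -
  obtain Z where Z[measurable]: "Z \<in> borel_measurable M"
    and ZJ: "\<And>e. 0 < e \<Longrightarrow> e \<le> 1 \<Longrightarrow> (\<integral>\<^sup>+ X. ennreal ((Jsmall t A x e X - Z X)\<^sup>2) \<partial>M) \<le> ennreal (C_mom * e)"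
    by (rule ex_Jsmall_limit) blast
  note [measurable] = Ydrift_measurable
  \<comment> \<open>A deterministic bound, uniform over all paths, for what the cancellation leaves
    over.\<close>
  define \<beta> where "\<beta> e = t * (L / 2 * mom2 {y. 0 < norm y \<and> norm y < e})" for e
  let ?P = "\<lambda>Z'. Z' \<in> borel_measurable M \<and> ((\<lambda>e. \<integral>\<^sup>+ X. ennreal ((Ytrunc m A x t e X - Z' X)\<^sup>2) \<partial>M) \<longlongrightarrow> 0) (at_right 0)"
  have P: "?P (\<lambda>X. Z X - Ydrift m A x t X)"
  proof
    have bd: "(\<integral>\<^sup>+ X. ennreal ((Ytrunc m A x t e X - (Z X - Ydrift m A x t X))\<^sup>2) \<partial>M) \<le> ennreal (2 * (C_mom * e) + 2 * (\<beta> e)\<^sup>2)"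
      if e: "0 < e" "e \<le> 1" for e
    proof -
      note [measurable] = Jsmall_measurable[OF e(1)] Ytrunc_measurable[OF e(1)]
      have "(\<integral>\<^sup>+ X. ennreal ((Ytrunc m A x t e X - (Z X - Ydrift m A x t X))\<^sup>2) \<partial>M)
        = (\<integral>\<^sup>+ X. ennreal (((Jsmall t A x e X - Z X) + (Ytrunc m A x t e X + Ydrift m A x t X - Jsmall t A x e X))\<^sup>2) \<partial>M)"
        by (intro nn_integral_cong) (simp add: algebra_simps)
      also have "\<dots> \<le> 2 * (\<integral>\<^sup>+ X. ennreal ((Jsmall t A x e X - Z X)\<^sup>2) \<partial>M)
         + 2 * (\<integral>\<^sup>+ X. ennreal ((Ytrunc m A x t e X + Ydrift m A x t X - Jsmall t A x e X)\<^sup>2) \<partial>M)"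
        by (rule nn_integral_add_square_le) measurable
      also have "\<dots> \<le> 2 * ennreal (C_mom * e) + 2 * (\<integral>\<^sup>+ X. ennreal ((\<beta> e)\<^sup>2) \<partial>M)"
      proof (intro add_mono mult_left_mono ZJ e nn_integral_mono ennreal_leI)
        fix X assume "X \<in> space M"
        then have "\<bar>Ytrunc m A x t e X + Ydrift m A x t X - Jsmall t A x e X\<bar> \<le> \<beta> e"
          using Ytrunc_drift_diff[of X e] e unfolding \<beta>_def space_M by linarith
        then show "(Ytrunc m A x t e X + Ydrift m A x t X - Jsmall t A x e X)\<^sup>2 \<le> (\<beta> e)\<^sup>2"
          by (metis abs_ge_zero power2_abs power_mono)
      qed auto
      also have "\<dots> = ennreal (2 * (C_mom * e) + 2 * (\<beta> e)\<^sup>2)"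
        using C_mom_nonneg e by (simp add: emeasure_space_1 ennreal_mult ennreal_plus flip: ennreal_numeral)
      finally show ?thesis .
    qed
    have "((\<lambda>e. ennreal (2 * (C_mom * e) + 2 * (\<beta> e)\<^sup>2)) \<longlongrightarrow> ennreal (2 * (C_mom * 0) + 2 * (t * (L / 2 * 0))\<^sup>2)) (at_right 0)"
      unfolding \<beta>_def by (intro tendsto_intros mom2_tendsto_0)
    then have lim: "((\<lambda>e. ennreal (2 * (C_mom * e) + 2 * (\<beta> e)\<^sup>2)) \<longlongrightarrow> 0) (at_right 0)" by simp
    have ev: "\<forall>\<^sub>F e in at_right 0. e \<in> {0<..<1::real}" by (rule eventually_at_right_real) simp
    show "((\<lambda>e. \<integral>\<^sup>+ X. ennreal ((Ytrunc m A x t e X - (Z X - Ydrift m A x t X))\<^sup>2) \<partial>M) \<longlongrightarrow> 0) (at_right 0)"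
    proof (rule tendsto_sandwich[OF _ _ tendsto_const lim])
      show "\<forall>\<^sub>F e in at_right 0. (\<integral>\<^sup>+ X. ennreal ((Ytrunc m A x t e X - (Z X - Ydrift m A x t X))\<^sup>2) \<partial>M) \<le> ennreal (2 * (C_mom * e) + 2 * (\<beta> e)\<^sup>2)"
        using ev by eventually_elim (rule bd, auto)
    qed simp
  qed measurable
  \<comment> \<open>The existence of a limit is what gives the \<open>SOME\<close> term its defining
    property.\<close>
  then have P2: "?P (Ysmall M m A x t)"
    unfolding Ysmall_def by (rule someI[where P = ?P])
  then have [measurable]: "Ysmall M m A x t \<in> borel_measurable M" by simp
  have "(\<integral>\<^sup>+ X. ennreal ((Ysmall M m A x t X - (Z X - Ydrift m A x t X))\<^sup>2) \<partial>M) = 0"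
  proof -
    have ev: "\<forall>\<^sub>F e in at_right 0. e \<in> {0<..<1::real}" by (rule eventually_at_right_real) simp
    have "((\<lambda>e. 2 * (\<integral>\<^sup>+ X. ennreal ((Ytrunc m A x t e X - Ysmall M m A x t X)\<^sup>2) \<partial>M)
        + 2 * (\<integral>\<^sup>+ X. ennreal ((Ytrunc m A x t e X - (Z X - Ydrift m A x t X))\<^sup>2) \<partial>M)) \<longlongrightarrow> 2 * 0 + 2 * 0) (at_right 0)"
      using P P2 by (intro tendsto_add tendsto_mult_ennreal tendsto_const) auto
    moreover have "\<forall>\<^sub>F e in at_right 0. (\<integral>\<^sup>+ X. ennreal ((Ysmall M m A x t X - (Z X - Ydrift m A x t X))\<^sup>2) \<partial>M)
       \<le> 2 * (\<integral>\<^sup>+ X. ennreal ((Ytrunc m A x t e X - Ysmall M m A x t X)\<^sup>2) \<partial>M)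
        + 2 * (\<integral>\<^sup>+ X. ennreal ((Ytrunc m A x t e X - (Z X - Ydrift m A x t X))\<^sup>2) \<partial>M)"
      using ev
    proof eventually_elim
      case (elim e)
      then have [measurable]: "Ytrunc m A x t e \<in> borel_measurable M" by (intro Ytrunc_measurable) simp
      have "(\<integral>\<^sup>+ X. ennreal ((Ysmall M m A x t X - (Z X - Ydrift m A x t X))\<^sup>2) \<partial>M)
        = (\<integral>\<^sup>+ X. ennreal (((Ysmall M m A x t X - Ytrunc m A x t e X) + (Ytrunc m A x t e X - (Z X - Ydrift m A x t X)))\<^sup>2) \<partial>M)"
        by (intro nn_integral_cong) (simp add: algebra_simps)
      also have "\<dots> \<le> 2 * (\<integral>\<^sup>+ X. ennreal ((Ysmall M m A x t X - Ytrunc m A x t e X)\<^sup>2) \<partial>M)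
        + 2 * (\<integral>\<^sup>+ X. ennreal ((Ytrunc m A x t e X - (Z X - Ydrift m A x t X))\<^sup>2) \<partial>M)"
        by (rule nn_integral_add_square_le) measurable
      finally show ?case by (simp add: power2_commute)
    qed
    ultimately have "(\<integral>\<^sup>+ X. ennreal ((Ysmall M m A x t X - (Z X - Ydrift m A x t X))\<^sup>2) \<partial>M) \<le> 2 * 0 + 2 * 0"
      by (rule tendsto_lowerbound) simp
    then show ?thesis by simp
  qed
  then have "AE X in M. Ysmall M m A x t X - (Z X - Ydrift m A x t X) = 0"
    by (subst (asm) nn_integral_0_iff_AE) (auto simp: ennreal_eq_0_iff elim!: eventually_mono)
  then have AEY: "AE X in M. Yfun M m A t x X = Ybig A x t X + Z X"
    by eventually_elim (simp add: Yfun_def)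
  have "Ybig A x t \<in> borel_measurable M"
  proof -
    have "Jsum t A x (1/2) (\<lambda>r. of_bool (1 \<le> r)) \<in> borel_measurable M"
      by (rule Jsum_approx(1)[where \<kappa> = "lower_cut 1", OF _ cut_continuous(1) _ lower_cut_tendsto])
        (simp_all add: lower_cut_eq_0)
    moreover have "Jsum t A x (1/2) (\<lambda>r. of_bool (1 \<le> r)) X = Ybig A x t X" if "X \<in> space M" for X
    proof -
      have "Jsum t A x (1/2) (\<lambda>r. of_bool (1 \<le> r)) X = Jsum t A x 1 (\<lambda>r. of_bool (1 \<le> r)) X"
        by (rule Jsum_base) (use that in \<open>auto simp: space_M\<close>)
      also have "\<dots> = Ybig A x t X" unfolding Ybig_eq_Jsum by (rule Jsum_cong) simp
      finally show ?thesis .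
    qed
    ultimately show ?thesis by (simp cong: measurable_cong)
  qed
  then have "Yfun M m A t x \<in> borel_measurable M" unfolding Yfun_def[abs_def] by measurable
  with Z ZJ AEY show thesis by (rule that)
qed

end

section \<open>Discretization of the path functional\<close>

text \<open>Since \<open>h\<close> is integrable but perhaps unbounded, the integral is split at |h|
  = R: the part above R is small uniformly in n because u n \<le> K, and the part below is at most R
  times the integral of u n.\<close>

lemma nn_integral_mult_tendsto_0:
  fixes u :: "nat \<Rightarrow> 's \<Rightarrow> real" and h :: "'s \<Rightarrow> real"
  assumes [measurable]: "\<And>n. u n \<in> borel_measurable M"
    and u: "\<And>n w. w \<in> space M \<Longrightarrow> 0 \<le> u n w" "\<And>n w. w \<in> space M \<Longrightarrow> u n w \<le> K" and K: "0 \<le> K"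
    and lim: "(\<lambda>n. \<integral>\<^sup>+ w. ennreal (u n w) \<partial>M) \<longlonglongrightarrow> 0"
    and h: "integrable M h"
  shows "(\<lambda>n. \<integral>\<^sup>+ w. ennreal (u n w * \<bar>h w\<bar>) \<partial>M) \<longlonglongrightarrow> 0"
proof (rule tendsto_zero_ennreal)
  fix r :: real assume r: "0 < r"
  have [measurable]: "h \<in> borel_measurable M" using h by auto
  define tail where "tail R = (\<integral>\<^sup>+ w. ennreal (\<bar>h w\<bar> * indicator {w. real R < \<bar>h w\<bar>} w) \<partial>M)" for R :: nat
  have hfin: "(\<integral>\<^sup>+ w. ennreal \<bar>h w\<bar> \<partial>M) < \<infinity>"
    using h by (simp add: integrable_iff_bounded)
  have "tail \<longlonglongrightarrow> (\<integral>\<^sup>+ w. 0 \<partial>M)"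
    unfolding tail_def
  proof (rule nn_integral_dominated_convergence[where w = "\<lambda>w. ennreal \<bar>h w\<bar>"])
    show "AE w in M. (\<lambda>R. ennreal (\<bar>h w\<bar> * indicator {w. real R < \<bar>h w\<bar>} w)) \<longlonglongrightarrow> 0"
    proof (intro AE_I2)
      fix w
      obtain N where N: "\<bar>h w\<bar> \<le> real N" using real_arch_simple by blast
      have "ennreal (\<bar>h w\<bar> * indicator {w. real R < \<bar>h w\<bar>} w) = 0" if "N \<le> R" for R
        using that N by (simp add: indicator_def)
      then show "(\<lambda>R. ennreal (\<bar>h w\<bar> * indicator {w. real R < \<bar>h w\<bar>} w)) \<longlonglongrightarrow> 0"
        by (intro tendsto_eventually) (auto simp: eventually_sequentially)
    qed
    show "AE w in M. ennreal (\<bar>h w\<bar> * indicator {w. real R < \<bar>h w\<bar>} w) \<le> ennreal \<bar>h w\<bar>" for R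
      by (intro AE_I2 ennreal_leI) (simp add: indicator_def)
  qed (use hfin in auto)
  then have "(\<lambda>R. ennreal K * tail R) \<longlonglongrightarrow> ennreal K * 0"
    by (intro tendsto_mult_ennreal tendsto_const) auto
  then have "\<forall>\<^sub>F R in sequentially. ennreal K * tail R < ennreal r"
    using r by (intro order_tendstoD(2)) auto
  then obtain R where R: "ennreal K * tail R < ennreal r" by (auto simp: eventually_sequentially)
  have le: "(\<integral>\<^sup>+ w. ennreal (u n w * \<bar>h w\<bar>) \<partial>M) \<le> ennreal (real R) * (\<integral>\<^sup>+ w. ennreal (u n w) \<partial>M) + ennreal K * tail R" for n
  proof -
    have "(\<integral>\<^sup>+ w. ennreal (u n w * \<bar>h w\<bar>) \<partial>M)
      \<le> (\<integral>\<^sup>+ w. ennreal (real R) * ennreal (u n w) + ennreal K * ennreal (\<bar>h w\<bar> * indicator {w. real R < \<bar>h w\<bar>} w) \<partial>M)"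
    proof (rule nn_integral_mono)
      fix w assume w: "w \<in> space M"
      have "u n w * \<bar>h w\<bar> \<le> real R * u n w + K * (\<bar>h w\<bar> * indicator {w. real R < \<bar>h w\<bar>} w)"
      proof (cases "real R < \<bar>h w\<bar>")
        case True
        then show ?thesis using u[OF w, of n] by (simp add: add_increasing mult_right_mono)
      next
        case False
        then show ?thesis using u[OF w, of n] by (simp add: mult.commute[of "u n w"] mult_right_mono)
      qed
      then show "ennreal (u n w * \<bar>h w\<bar>) \<le> ennreal (real R) * ennreal (u n w) + ennreal K * ennreal (\<bar>h w\<bar> * indicator {w. real R < \<bar>h w\<bar>} w)"
        using u[OF w, of n] K by (simp add: ennreal_leI flip: ennreal_mult ennreal_plus)
    qed
    also have "\<dots> = ennreal (real R) * (\<integral>\<^sup>+ w. ennreal (u n w) \<partial>M) + ennreal K * tail R"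
      unfolding tail_def by (simp add: nn_integral_add nn_integral_cmult)
    finally show ?thesis .
  qed
  have "(\<lambda>n. ennreal (real R) * (\<integral>\<^sup>+ w. ennreal (u n w) \<partial>M) + ennreal K * tail R) \<longlonglongrightarrow> ennreal (real R) * 0 + ennreal K * tail R"
    by (intro tendsto_add tendsto_mult_ennreal tendsto_const lim) auto
  then have "\<forall>\<^sub>F n in sequentially. ennreal (real R) * (\<integral>\<^sup>+ w. ennreal (u n w) \<partial>M) + ennreal K * tail R < ennreal r"
    using R by (intro order_tendstoD(2)) auto
  then show "\<forall>\<^sub>F n in sequentially. (\<integral>\<^sup>+ w. ennreal (u n w * \<bar>h w\<bar>) \<partial>M) < ennreal r"
    by eventually_elim (rule le_less_trans[OF le])
qed

lemma cmod_cis_diff_le: "cmod (cis u - cis v) \<le> \<bar>u - v\<bar>"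
proof -
  have "cis u - cis v = cis v * (cis (u - v) - 1)"
    by (simp add: right_diff_distrib cis_mult)
  then show ?thesis
    using iexp_approx1[of "u - v" 0] by (simp add: norm_mult cis_conv_exp)
qed

lemma cmod_cis_diff_le_2: "cmod (cis u - cis v) \<le> 2"
  using norm_triangle_ineq4[of "cis u" "cis v"] by simp

text \<open>Integrating |v| \<le> v^2 / s + s turns a mean square of order s^2 into a first moment
  of order s.\<close>

lemma (in prob_space) nn_integral_abs_le_of_square:
  assumes [measurable]: "f \<in> borel_measurable M" and s: "0 < s" and C: "0 \<le> C"
    and le: "(\<integral>\<^sup>+ w. ennreal ((f w)\<^sup>2) \<partial>M) \<le> ennreal (C * s\<^sup>2)"
  shows "(\<integral>\<^sup>+ w. ennreal \<bar>f w\<bar> \<partial>M) \<le> ennreal ((C + 1) * s)"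
proof -
  have "\<bar>v\<bar> \<le> (1 / s) * v\<^sup>2 + s" for v :: real
  proof -
    have "0 \<le> (\<bar>v\<bar> - s)\<^sup>2" by simp
    then have "2 * (\<bar>v\<bar> * s) \<le> v\<^sup>2 + s\<^sup>2" by (simp add: power2_diff)
    then have "\<bar>v\<bar> * s \<le> v\<^sup>2 + s * s" using s by (simp add: power2_eq_square) (smt (verit) mult_nonneg_nonneg abs_ge_zero)
    then show ?thesis using s by (simp add: field_simps)
  qed
  then have "(\<integral>\<^sup>+ w. ennreal \<bar>f w\<bar> \<partial>M) \<le> (\<integral>\<^sup>+ w. ennreal (1 / s) * ennreal ((f w)\<^sup>2) + ennreal s \<partial>M)"
    using s by (intro nn_integral_mono) (simp add: ennreal_leI flip: ennreal_mult ennreal_plus)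
  also have "\<dots> = ennreal (1 / s) * (\<integral>\<^sup>+ w. ennreal ((f w)\<^sup>2) \<partial>M) + ennreal s"
    by (simp add: nn_integral_add nn_integral_cmult emeasure_space_1)
  also have "\<dots> \<le> ennreal (1 / s) * ennreal (C * s\<^sup>2) + ennreal s"
    by (intro add_right_mono mult_left_mono le) simp
  also have "\<dots> = ennreal (1 / s * (C * s\<^sup>2) + s)"
    using s C by (simp flip: ennreal_mult ennreal_plus)
  also have "1 / s * (C * s\<^sup>2) + s = (C + 1) * s" using s by (simp add: power2_eq_square algebra_simps)
  finally show ?thesis .
qed

text \<open>Values are taken at right endpoints, in accordance with the right continuity of the
  paths.\<close>

definition Vsum :: "real \<Rightarrow> ('a::euclidean_space \<Rightarrow> real) \<Rightarrow> 'a \<Rightarrow> nat \<Rightarrow> (real \<Rightarrow> 'a) \<Rightarrow> real" where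
  "Vsum t V x n X = (\<Sum>k<n. t / real n * V (x + X (grid t n (Suc k))))"

definition Phi :: "real \<Rightarrow> ('a::euclidean_space \<Rightarrow> 'a) \<Rightarrow> ('a \<Rightarrow> real) \<Rightarrow> 'a \<Rightarrow> nat \<Rightarrow> (real \<Rightarrow> 'a) \<Rightarrow> complex" where
  "Phi t A V x n X = complex_of_real (exp (- Vsum t V x n X)) * cis (- Isum t A x (\<lambda>_. 1) n X)"

section \<open>Convergence of the discretized expectations\<close>

locale rel_levy_functional = rel_levy_potential M m t A a L x
  for M :: "(real \<Rightarrow> 'a::euclidean_space) measure" and m t A a L x +
  fixes V :: "'a \<Rightarrow> real" and B :: real
  assumes V_cont: "continuous_on UNIV V" and V_bound: "\<bar>V z\<bar> \<le> B"
begin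

lemma V_measurable [measurable]: "V \<in> borel_measurable borel"
  using V_cont by (rule borel_measurable_continuous_onI)

lemma Vsum_measurable [measurable]: "Vsum t V x n \<in> borel_measurable M"
  unfolding Vsum_def[abs_def] by measurable

lemma Vsum_tendsto: "X \<in> D0 \<Longrightarrow> (\<lambda>n. Vsum t V x n X) \<longlonglongrightarrow> (LBINT s:{0<..t}. V (x + X s))"
  unfolding Vsum_def by (rule D0_set_integral_limit(2)[OF _ t_nonneg V_cont V_bound])

lemma Vint_measurable [measurable]: "(\<lambda>X. LBINT s:{0<..t}. V (x + X s)) \<in> borel_measurable M"
  by (rule time_integral_measurable[OF V_cont V_bound])

lemma B_nonneg: "0 \<le> B"
  using V_bound[of 0] by linarith

lemma Vsum_bound: "\<bar>Vsum t V x n X\<bar> \<le> t * B"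
proof (cases "n = 0")
  case False
  have "\<bar>Vsum t V x n X\<bar> \<le> (\<Sum>k<n. t / real n * B)"
    unfolding Vsum_def
  proof (rule order_trans[OF sum_abs], rule sum_mono)
    fix k
    show "\<bar>t / real n * V (x + X (grid t n (Suc k)))\<bar> \<le> t / real n * B"
      unfolding abs_mult using t_nonneg V_bound by (intro mult_mono) auto
  qed
  also have "\<dots> = t * B" using False by simp
  finally show ?thesis .
qed (simp add: Vsum_def t_nonneg B_nonneg)

lemma Vint_bound:
  assumes "X \<in> D0"
  shows "\<bar>LBINT s:{0<..t}. V (x + X s)\<bar> \<le> t * B"
  by (rule LIMSEQ_le_const2[OF tendsto_rabs[OF Vsum_tendsto[OF assms]]]) (auto simp: Vsum_bound)

lemma Phi_measurable [measurable]: "Phi t A V x n \<in> borel_measurable M"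
  unfolding Phi_def[abs_def] cis_conv_exp by measurable

lemma Phi_bound: "cmod (Phi t A V x n X) \<le> exp (t * B)"
  using Vsum_bound[of n X] by (simp add: Phi_def norm_mult abs_le_iff)

text \<open>Increments are split by size at about e = s^2. The large ones converge path by path to a
  jump sum \<open>J\<close>; the small ones, and the small jumps by which \<open>J\<close> differs
  from Y, have mean square of order e, hence first moment of order s. As \<open>cis\<close> is
  bounded and 1-Lipschitz, the limit superior is of order s, with s arbitrary.\<close>

lemma cis_Isum_tendsto:
  assumes Z[measurable]: "Z \<in> borel_measurable M"
    and ZJ: "\<And>e. 0 < e \<Longrightarrow> e \<le> 1 \<Longrightarrow> (\<integral>\<^sup>+ X. ennreal ((Jsmall t A x e X - Z X)\<^sup>2) \<partial>M) \<le> ennreal (C_mom * e)"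
    and Ym[measurable]: "Y \<in> borel_measurable M"
    and Y: "AE X in M. Y X = Ybig A x t X + Z X"
  shows "(\<lambda>n. \<integral>\<^sup>+ X. ennreal (cmod (cis (- Isum t A x (\<lambda>_. 1) n X) - cis (- Y X))) \<partial>M) \<longlonglongrightarrow> 0"
proof (rule tendsto_zero_ennreal)
  fix r :: real assume r: "0 < r"
  \<comment> \<open>The sum of the constants in \<open>I2b\<close> and \<open>Jb\<close>, which
    bound the first moments of the two errors.\<close>
  define C where "C = C_mom + 1 + (4 * C_mom + 1)"
  have C: "0 < C" using C_mom_nonneg by (simp add: C_def)
  define s where "s = min 1 (r / (2 * C))"
  have s: "0 < s" "s \<le> 1" "C * s < r"
  proof -
    show "0 < s" "s \<le> 1" using r C by (auto simp: s_def)
    have "C * s \<le> C * (r / (2 * C))" using C by (intro mult_left_mono) (auto simp: s_def)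
    then show "C * s < r" using C r by simp
  qed
  define e where "e = s\<^sup>2"
  have e: "0 < e" "e \<le> 1" using s by (auto simp: e_def power_le_one)
  \<comment> \<open>A continuous cutoff, as \<open>Isum_tendsto_Jsum\<close> asks for: it is 0 up to
    e/2 and 1 from e on.\<close>
  define c where "c r = ramp (2 * r / e - 1)" for r
  have cc: "continuous_on UNIV c" unfolding c_def[abs_def] using e by (intro ramp_continuous continuous_intros) auto
  have c1: "c r = 1" if "e \<le> r" for r using that e by (simp add: c_def le_divide_eq)
  have c0: "c r = 0" if "r < e / 2" for r using that e by (simp add: c_def divide_le_eq)
  have c01: "0 \<le> c r" "c r \<le> 1" for r by (auto simp: c_def)
  have cm[measurable]: "c \<in> borel_measurable borel" using cc by (rule borel_measurable_continuous_onI)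
  define J where "J = Jsum t A x (e/2) c"
  have Jm[measurable]: "J \<in> borel_measurable M" unfolding J_def
    by (rule Jsum_approx(1)[where \<kappa> = "\<lambda>_. c"]) (use e cc c0 in auto)
  define I1 where "I1 n = Isum t A x c n" for n
  define I2 where "I2 n = Isum t A x (\<lambda>r. 1 - c r) n" for n
  have [measurable]: "I1 n \<in> borel_measurable M" "I2 n \<in> borel_measurable M" "Isum t A x (\<lambda>_. 1) n \<in> borel_measurable M" for n
    unfolding I1_def I2_def by measurable
  have Isplit: "Isum t A x (\<lambda>_. 1) n X = I1 n X + I2 n X" for n X
    unfolding I1_def I2_def Isum_def sum.distrib[symmetric] by (intro sum.cong refl) (simp add: algebra_simps)
  have I2b: "(\<integral>\<^sup>+ X. ennreal \<bar>I2 n X\<bar> \<partial>M) \<le> ennreal ((C_mom + 1) * s)" for n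
  proof (rule nn_integral_abs_le_of_square)
    show "(\<integral>\<^sup>+ X. ennreal ((I2 n X)\<^sup>2) \<partial>M) \<le> ennreal (C_mom * s\<^sup>2)"
      unfolding I2_def e_def[symmetric] by (rule second_moment_Isum) (use e c01 c1 in auto)
  qed (use s C_mom_nonneg in auto)
  have Jb: "(\<integral>\<^sup>+ X. ennreal \<bar>J X - Y X\<bar> \<partial>M) \<le> ennreal ((4 * C_mom + 1) * s)"
  proof (rule nn_integral_abs_le_of_square)
    \<comment> \<open>The part of \<open>J\<close> that comes from jumps of size between e/2 and
      e.\<close>
    define K where "K = Jsum t A x (e/2) (\<lambda>r. c r * of_bool (r < e))"
    have Km[measurable]: "K \<in> borel_measurable M"
      and K2: "(\<integral>\<^sup>+ X. ennreal ((K X)\<^sup>2) \<partial>M) \<le> ennreal (C_mom * e)"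
    proof -
      have lim: "(\<lambda>j. c r * upper_cut e j r) \<longlonglongrightarrow> c r * of_bool (r < e)" for r
        by (intro tendsto_mult tendsto_const upper_cut_tendsto)
      have con: "continuous_on UNIV (\<lambda>r. c r * upper_cut e j r)" for j
        by (intro continuous_intros cc cut_continuous)
      show "K \<in> borel_measurable M" unfolding K_def
        by (rule Jsum_approx(1)[OF _ con _ lim]) (use e c0 in auto)
      show "(\<integral>\<^sup>+ X. ennreal ((K X)\<^sup>2) \<partial>M) \<le> ennreal (C_mom * e)" unfolding K_def
        by (rule Jsum_approx(2)[OF _ con _ lim]) (use e c0 c01 in \<open>auto simp: upper_cut_eq_0 cut_bounds intro!: mult_le_one\<close>)
    qed
    note [measurable] = Jsmall_measurable[OF e(1)]
    have JK: "J X - (Ybig A x t X + Z X) = K X + (Jsmall t A x e X - Z X)" if X: "X \<in> D0" for X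
    proof -
      have 1: "Ybig A x t X = Jsum t A x (e/2) (\<lambda>r. of_bool (1 \<le> r)) X"
      proof -
        have "Jsum t A x (e/2) (\<lambda>r. of_bool (1 \<le> r)) X = Jsum t A x 1 (\<lambda>r. of_bool (1 \<le> r)) X"
          by (rule Jsum_base) (use X e in auto)
        then show ?thesis unfolding Ybig_eq_Jsum by (simp add: Jsum_cong[of 1 "\<lambda>r. of_bool (1 \<le> r)" "\<lambda>_. 1"])
      qed
      have 2: "Jsmall t A x e X = Jsum t A x (e/2) (\<lambda>r. of_bool (e \<le> r \<and> r < 1)) X"
        unfolding Jsmall_def by (rule Jsum_base[symmetric]) (use X e in auto)
      have "J X - Ybig A x t X = K X + Jsmall t A x e X"
        unfolding J_def K_def 1 2 Jsum_diff[OF X] Jsum_add[OF X]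
        using e c1 by (intro Jsum_cong) (auto simp: of_bool_def)
      then show ?thesis by linarith
    qed
    have "(\<integral>\<^sup>+ X. ennreal ((J X - Y X)\<^sup>2) \<partial>M) = (\<integral>\<^sup>+ X. ennreal ((K X + (Jsmall t A x e X - Z X))\<^sup>2) \<partial>M)"
    proof (rule nn_integral_cong_AE, use Y AE_space in eventually_elim)
      case (elim X)
      then have "X \<in> D0" by (simp add: space_M)
      then show ?case by (simp only: elim(1) JK)
    qed
    also have "\<dots> \<le> 2 * (\<integral>\<^sup>+ X. ennreal ((K X)\<^sup>2) \<partial>M) + 2 * (\<integral>\<^sup>+ X. ennreal ((Jsmall t A x e X - Z X)\<^sup>2) \<partial>M)"
      by (rule nn_integral_add_square_le) measurable
    also have "\<dots> \<le> 2 * ennreal (C_mom * e) + 2 * ennreal (C_mom * e)"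
      by (intro add_mono mult_left_mono K2 ZJ e) auto
    also have "\<dots> = ennreal (4 * C_mom * s\<^sup>2)"
    proof -
      have "0 \<le> C_mom * e" using C_mom_nonneg e by simp
      then have "ennreal (4 * (C_mom * e)) = 4 * ennreal (C_mom * e)" by (simp only: ennreal_mult' ennreal_numeral)
      also have "\<dots> = 2 * ennreal (C_mom * e) + 2 * ennreal (C_mom * e)"
        unfolding distrib_right [symmetric] by simp
      finally show ?thesis by (simp only: e_def mult.assoc)
    qed
    finally show "(\<integral>\<^sup>+ X. ennreal ((J X - Y X)\<^sup>2) \<partial>M) \<le> ennreal (4 * C_mom * s\<^sup>2)" .
  qed (use s C_mom_nonneg in auto)
  have lim1: "(\<lambda>n. \<integral>\<^sup>+ X. ennreal (cmod (cis (- I1 n X) - cis (- J X))) \<partial>M) \<longlonglongrightarrow> (\<integral>\<^sup>+ X. 0 \<partial>M)"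
  proof (rule nn_integral_dominated_convergence[where w = "\<lambda>_. ennreal 2"])
    show "(\<lambda>X. ennreal (cmod (cis (- I1 n X) - cis (- J X)))) \<in> borel_measurable M" for n
      unfolding cis_conv_exp by measurable
    show "AE X in M. ennreal (cmod (cis (- I1 n X) - cis (- J X))) \<le> ennreal 2" for n
      by (intro AE_I2 ennreal_leI cmod_cis_diff_le_2)
    show "AE X in M. (\<lambda>n. ennreal (cmod (cis (- I1 n X) - cis (- J X)))) \<longlonglongrightarrow> 0"
    proof (intro AE_I2)
      fix X assume "X \<in> space M"
      then have I: "(\<lambda>n. I1 n X) \<longlonglongrightarrow> J X"
        unfolding I1_def J_def using e cc c0 by (intro Isum_tendsto_Jsum) (auto simp: space_M)
      have "(\<lambda>n. cmod (cis (- I1 n X) - cis (- J X))) \<longlonglongrightarrow> cmod (cis (- J X) - cis (- J X))"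
        unfolding cis_conv_exp by (intro tendsto_intros I)
      then show "(\<lambda>n. ennreal (cmod (cis (- I1 n X) - cis (- J X)))) \<longlonglongrightarrow> 0"
        using tendsto_ennrealI by fastforce
    qed
  qed (auto simp: emeasure_space_1)
  have tri: "cmod (p - v) \<le> cmod (p - q) + cmod (q - u) + cmod (u - v)" for p q u v
    using dist_triangle[of p v q] dist_triangle[of q v u] by (simp add: dist_norm)
  have le: "(\<integral>\<^sup>+ X. ennreal (cmod (cis (- Isum t A x (\<lambda>_. 1) n X) - cis (- Y X))) \<partial>M)
     \<le> ennreal (C * s) + (\<integral>\<^sup>+ X. ennreal (cmod (cis (- I1 n X) - cis (- J X))) \<partial>M)" for n
  proof -
    have "cmod (cis (- Isum t A x (\<lambda>_. 1) n X) - cis (- Y X)) \<le> \<bar>I2 n X\<bar> + \<bar>J X - Y X\<bar> + cmod (cis (- I1 n X) - cis (- J X))" for X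
    proof -
      have "cmod (cis (- Isum t A x (\<lambda>_. 1) n X) - cis (- I1 n X)) \<le> \<bar>I2 n X\<bar>"
        using cmod_cis_diff_le[of "- Isum t A x (\<lambda>_. 1) n X" "- I1 n X"] by (simp add: Isplit)
      moreover have "cmod (cis (- J X) - cis (- Y X)) \<le> \<bar>J X - Y X\<bar>"
        using cmod_cis_diff_le[of "- J X" "- Y X"] by (simp add: abs_minus_commute)
      moreover have "cmod (cis (- Isum t A x (\<lambda>_. 1) n X) - cis (- Y X)) \<le> cmod (cis (- Isum t A x (\<lambda>_. 1) n X) - cis (- I1 n X))
         + cmod (cis (- I1 n X) - cis (- J X)) + cmod (cis (- J X) - cis (- Y X))"
        by (rule tri)
      ultimately show ?thesis by linarith
    qed
    then have "(\<integral>\<^sup>+ X. ennreal (cmod (cis (- Isum t A x (\<lambda>_. 1) n X) - cis (- Y X))) \<partial>M)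
      \<le> (\<integral>\<^sup>+ X. ennreal \<bar>I2 n X\<bar> + ennreal \<bar>J X - Y X\<bar> + ennreal (cmod (cis (- I1 n X) - cis (- J X))) \<partial>M)"
      by (intro nn_integral_mono) (simp add: ennreal_leI flip: ennreal_plus)
    also have "\<dots> = (\<integral>\<^sup>+ X. ennreal \<bar>I2 n X\<bar> \<partial>M) + (\<integral>\<^sup>+ X. ennreal \<bar>J X - Y X\<bar> \<partial>M) + (\<integral>\<^sup>+ X. ennreal (cmod (cis (- I1 n X) - cis (- J X))) \<partial>M)"
    proof -
      have [measurable]: "(\<lambda>X. ennreal (cmod (cis (- I1 n X) - cis (- J X)))) \<in> borel_measurable M"
        unfolding cis_conv_exp by measurable
      have "(\<integral>\<^sup>+ X. ennreal \<bar>I2 n X\<bar> + ennreal \<bar>J X - Y X\<bar> + ennreal (cmod (cis (- I1 n X) - cis (- J X))) \<partial>M)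
        = (\<integral>\<^sup>+ X. ennreal \<bar>I2 n X\<bar> + ennreal \<bar>J X - Y X\<bar> \<partial>M) + (\<integral>\<^sup>+ X. ennreal (cmod (cis (- I1 n X) - cis (- J X))) \<partial>M)"
        by (rule nn_integral_add) measurable
      also have "(\<integral>\<^sup>+ X. ennreal \<bar>I2 n X\<bar> + ennreal \<bar>J X - Y X\<bar> \<partial>M) = (\<integral>\<^sup>+ X. ennreal \<bar>I2 n X\<bar> \<partial>M) + (\<integral>\<^sup>+ X. ennreal \<bar>J X - Y X\<bar> \<partial>M)"
        by (rule nn_integral_add) measurable
      finally show ?thesis .
    qed
    also have "\<dots> \<le> ennreal ((C_mom + 1) * s) + ennreal ((4 * C_mom + 1) * s) + (\<integral>\<^sup>+ X. ennreal (cmod (cis (- I1 n X) - cis (- J X))) \<partial>M)"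
      by (intro add_mono I2b Jb order_refl)
    also have "ennreal ((C_mom + 1) * s) + ennreal ((4 * C_mom + 1) * s) = ennreal (C * s)"
      using C_mom_nonneg s by (simp add: C_def distrib_right flip: ennreal_plus)
    finally show ?thesis .
  qed
  have "(\<lambda>n. ennreal (C * s) + (\<integral>\<^sup>+ X. ennreal (cmod (cis (- I1 n X) - cis (- J X))) \<partial>M)) \<longlonglongrightarrow> ennreal (C * s) + 0"
    using lim1 by (intro tendsto_add tendsto_const) simp
  then have "\<forall>\<^sub>F n in sequentially. ennreal (C * s) + (\<integral>\<^sup>+ X. ennreal (cmod (cis (- I1 n X) - cis (- J X))) \<partial>M) < ennreal r"
    using s r C by (intro order_tendstoD(2)) (auto simp: ennreal_lessI)
  then show "\<forall>\<^sub>F n in sequentially. (\<integral>\<^sup>+ X. ennreal (cmod (cis (- Isum t A x (\<lambda>_. 1) n X) - cis (- Y X))) \<partial>M) < ennreal r"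
    by eventually_elim (rule le_less_trans[OF le])
qed

lemma exp_Sfun: "exp (- Sfun M m A V t x X) = complex_of_real (exp (- (LBINT s:{0<..t}. V (x + X s)))) * cis (- Yfun M m A t x X)"
  unfolding Sfun_def cis_conv_exp exp_of_real[symmetric] exp_add[symmetric] by (rule arg_cong[where f = exp]) simp

text \<open>Both exponentials are bounded by exp (t B), so the convergence of their difference to 0
  in mean persists after multiplication by g(x + X(t)), which is merely integrable.\<close>

lemma ufun_limit:
  assumes g[measurable]: "g \<in> borel_measurable borel" and gi: "integrable M (\<lambda>X. cmod (g (x + X t)))"
  shows "(\<lambda>n. LINT X|M. Phi t A V x n X * g (x + X t)) \<longlonglongrightarrow> ufun M m A V g x t"
proof -
  obtain Z where Z: "Z \<in> borel_measurable M"
    "\<And>e. 0 < e \<Longrightarrow> e \<le> 1 \<Longrightarrow> (\<integral>\<^sup>+ X. ennreal ((Jsmall t A x e X - Z X)\<^sup>2) \<partial>M) \<le> ennreal (C_mom * e)"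
    "AE X in M. Yfun M m A t x X = Ybig A x t X + Z X" and Ym[measurable]: "Yfun M m A t x \<in> borel_measurable M"
    by (rule Yfun_eq) blast
  note cl = cis_Isum_tendsto[OF Z(1,2) Ym Z(3)]
  define W where "W X = (LBINT s:{0<..t}. V (x + X s))" for X
  have Wm[measurable]: "W \<in> borel_measurable M" unfolding W_def by measurable
  have Im[measurable]: "Isum t A x (\<lambda>_. 1) n \<in> borel_measurable M" for n by measurable
  define F where "F X = complex_of_real (exp (- W X)) * cis (- Yfun M m A t x X)" for X
  have Fm[measurable]: "F \<in> borel_measurable M" unfolding F_def cis_conv_exp by measurable
  have Fb: "cmod (F X) \<le> exp (t * B)" if "X \<in> space M" for X
    using Vint_bound[of X] that by (simp add: F_def W_def norm_mult space_M abs_le_iff)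
  define G where "G n X = cmod (Phi t A V x n X - F X)" for n X
  have Gm[measurable]: "G n \<in> borel_measurable M" for n unfolding G_def by measurable
  have G0: "(\<lambda>n. \<integral>\<^sup>+ X. ennreal (G n X) \<partial>M) \<longlonglongrightarrow> 0"
  proof -
    have le: "(\<integral>\<^sup>+ X. ennreal (G n X) \<partial>M) \<le> (\<integral>\<^sup>+ X. ennreal \<bar>exp (- Vsum t V x n X) - exp (- W X)\<bar> \<partial>M)
       + ennreal (exp (t * B)) * (\<integral>\<^sup>+ X. ennreal (cmod (cis (- Isum t A x (\<lambda>_. 1) n X) - cis (- Yfun M m A t x X))) \<partial>M)" for n
    proof -
      have "G n X \<le> \<bar>exp (- Vsum t V x n X) - exp (- W X)\<bar> + exp (t * B) * cmod (cis (- Isum t A x (\<lambda>_. 1) n X) - cis (- Yfun M m A t x X))"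
        if "X \<in> space M" for X
      proof -
        have "Phi t A V x n X - F X = complex_of_real (exp (- Vsum t V x n X) - exp (- W X)) * cis (- Isum t A x (\<lambda>_. 1) n X)
          + complex_of_real (exp (- W X)) * (cis (- Isum t A x (\<lambda>_. 1) n X) - cis (- Yfun M m A t x X))"
          by (simp add: Phi_def F_def algebra_simps)
        then have "G n X \<le> cmod (complex_of_real (exp (- Vsum t V x n X) - exp (- W X)) * cis (- Isum t A x (\<lambda>_. 1) n X))
          + cmod (complex_of_real (exp (- W X)) * (cis (- Isum t A x (\<lambda>_. 1) n X) - cis (- Yfun M m A t x X)))"
          unfolding G_def by (simp only: norm_triangle_ineq)
        also have "\<dots> = \<bar>exp (- Vsum t V x n X) - exp (- W X)\<bar> + exp (- W X) * cmod (cis (- Isum t A x (\<lambda>_. 1) n X) - cis (- Yfun M m A t x X))"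
          by (simp only: norm_mult norm_of_real norm_cis abs_exp_cancel mult_1_right)
        also have "exp (- W X) * cmod (cis (- Isum t A x (\<lambda>_. 1) n X) - cis (- Yfun M m A t x X))
           \<le> exp (t * B) * cmod (cis (- Isum t A x (\<lambda>_. 1) n X) - cis (- Yfun M m A t x X))"
          using Vint_bound[of X] that by (intro mult_right_mono) (auto simp: W_def space_M abs_le_iff)
        finally show ?thesis by simp
      qed
      then have "(\<integral>\<^sup>+ X. ennreal (G n X) \<partial>M) \<le> (\<integral>\<^sup>+ X. ennreal \<bar>exp (- Vsum t V x n X) - exp (- W X)\<bar>
         + ennreal (exp (t * B)) * ennreal (cmod (cis (- Isum t A x (\<lambda>_. 1) n X) - cis (- Yfun M m A t x X))) \<partial>M)"
        by (intro nn_integral_mono) (simp add: ennreal_leI flip: ennreal_plus ennreal_mult)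
      also have "\<dots> = (\<integral>\<^sup>+ X. ennreal \<bar>exp (- Vsum t V x n X) - exp (- W X)\<bar> \<partial>M)
       + ennreal (exp (t * B)) * (\<integral>\<^sup>+ X. ennreal (cmod (cis (- Isum t A x (\<lambda>_. 1) n X) - cis (- Yfun M m A t x X))) \<partial>M)"
      proof -
        have mes[measurable]: "(\<lambda>X. ennreal (cmod (cis (- Isum t A x (\<lambda>_. 1) n X) - cis (- Yfun M m A t x X)))) \<in> borel_measurable M"
          unfolding cis_conv_exp by measurable
        show ?thesis unfolding nn_integral_cmult[OF mes, symmetric]
          by (intro nn_integral_add) measurable
      qed
      finally show ?thesis .
    qed
    have "(\<lambda>n. \<integral>\<^sup>+ X. ennreal \<bar>exp (- Vsum t V x n X) - exp (- W X)\<bar> \<partial>M) \<longlonglongrightarrow> (\<integral>\<^sup>+ X. 0 \<partial>M)"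
    proof (rule nn_integral_dominated_convergence[where w = "\<lambda>_. ennreal (2 * exp (t * B))"])
      show "AE X in M. ennreal \<bar>exp (- Vsum t V x n X) - exp (- W X)\<bar> \<le> ennreal (2 * exp (t * B))" for n
      proof (intro AE_I2 ennreal_leI)
        fix X assume "X \<in> space M"
        then have "exp (- Vsum t V x n X) \<le> exp (t * B)" "exp (- W X) \<le> exp (t * B)"
          using Vsum_bound[of n X] Vint_bound[of X] by (auto simp: W_def space_M abs_le_iff)
        moreover have "0 < exp (- Vsum t V x n X)" "0 < exp (- W X)" by simp_all
        ultimately show "\<bar>exp (- Vsum t V x n X) - exp (- W X)\<bar> \<le> 2 * exp (t * B)" by linarith
      qed
      show "AE X in M. (\<lambda>n. ennreal \<bar>exp (- Vsum t V x n X) - exp (- W X)\<bar>) \<longlonglongrightarrow> 0"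
      proof (intro AE_I2)
        fix X assume "X \<in> space M"
        then have "(\<lambda>n. Vsum t V x n X) \<longlonglongrightarrow> W X" unfolding W_def by (intro Vsum_tendsto) (simp add: space_M)
        then have "(\<lambda>n. \<bar>exp (- Vsum t V x n X) - exp (- W X)\<bar>) \<longlonglongrightarrow> \<bar>exp (- W X) - exp (- W X)\<bar>"
          by (intro tendsto_intros)
        then show "(\<lambda>n. ennreal \<bar>exp (- Vsum t V x n X) - exp (- W X)\<bar>) \<longlonglongrightarrow> 0"
          using tendsto_ennrealI by fastforce
      qed
    qed (auto simp: emeasure_space_1)
    then have "(\<lambda>n. (\<integral>\<^sup>+ X. ennreal \<bar>exp (- Vsum t V x n X) - exp (- W X)\<bar> \<partial>M)
       + ennreal (exp (t * B)) * (\<integral>\<^sup>+ X. ennreal (cmod (cis (- Isum t A x (\<lambda>_. 1) n X) - cis (- Yfun M m A t x X))) \<partial>M)) \<longlonglongrightarrow> 0 + ennreal (exp (t * B)) * 0"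
      using cl by (intro tendsto_add tendsto_mult_ennreal tendsto_const) auto
    then have lim: "(\<lambda>n. (\<integral>\<^sup>+ X. ennreal \<bar>exp (- Vsum t V x n X) - exp (- W X)\<bar> \<partial>M)
       + ennreal (exp (t * B)) * (\<integral>\<^sup>+ X. ennreal (cmod (cis (- Isum t A x (\<lambda>_. 1) n X) - cis (- Yfun M m A t x X))) \<partial>M)) \<longlonglongrightarrow> 0" by simp
    show ?thesis by (rule tendsto_sandwich[OF _ _ tendsto_const lim]) (use le in auto)
  qed
  have gm[measurable]: "(\<lambda>X. g (x + X t)) \<in> borel_measurable M"
    by (rule measurable_compose[OF _ g]) measurable
  have Gg: "(\<lambda>n. \<integral>\<^sup>+ X. ennreal (G n X * \<bar>cmod (g (x + X t))\<bar>) \<partial>M) \<longlonglongrightarrow> 0"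
  proof (rule nn_integral_mult_tendsto_0[where K = "2 * exp (t * B)", OF Gm _ _ _ G0 gi])
    show "G n X \<le> 2 * exp (t * B)" if "X \<in> space M" for n X
      using norm_triangle_ineq4[of "Phi t A V x n X" "F X"] Phi_bound[of n X] Fb[OF that] by (simp add: G_def)
  qed (auto simp: G_def)
  have gi': "integrable M (\<lambda>X. g (x + X t))"
    using gi by (rule Bochner_Integration.integrable_bound) auto
  have iP: "integrable M (\<lambda>X. Phi t A V x n X * g (x + X t))" for n
    by (rule Bochner_Integration.integrable_bound[OF integrable_mult_right[OF gi, of "exp (t * B)"]])
       (auto simp: norm_mult intro!: mult_right_mono Phi_bound)
  have iF: "integrable M (\<lambda>X. F X * g (x + X t))"
    by (rule Bochner_Integration.integrable_bound[OF integrable_mult_right[OF gi, of "exp (t * B)"]])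
       (auto simp: norm_mult intro!: mult_right_mono Fb)
  have "(\<lambda>n. LINT X|M. Phi t A V x n X * g (x + X t)) \<longlonglongrightarrow> (LINT X|M. F X * g (x + X t))"
  proof (rule LIM_zero_cancel, rule tendsto_norm_zero_cancel)
    have "ennreal (cmod ((LINT X|M. Phi t A V x n X * g (x + X t)) - (LINT X|M. F X * g (x + X t)))) \<le> (\<integral>\<^sup>+ X. ennreal (G n X * \<bar>cmod (g (x + X t))\<bar>) \<partial>M)" for n
    proof -
      have "(LINT X|M. Phi t A V x n X * g (x + X t)) - (LINT X|M. F X * g (x + X t)) = (LINT X|M. (Phi t A V x n X - F X) * g (x + X t))"
        using iP iF by (simp add: left_diff_distrib)
      also have "ennreal (cmod \<dots>) \<le> (\<integral>\<^sup>+ X. ennreal (cmod ((Phi t A V x n X - F X) * g (x + X t))) \<partial>M)"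
        using iP iF by (intro integral_norm_bound_ennreal) (simp add: left_diff_distrib)
      finally show ?thesis by (simp add: G_def norm_mult)
    qed
    then have "(\<lambda>n. ennreal (cmod ((LINT X|M. Phi t A V x n X * g (x + X t)) - (LINT X|M. F X * g (x + X t))))) \<longlonglongrightarrow> 0"
      by (intro tendsto_sandwich[OF _ _ tendsto_const Gg]) auto
    then have "(\<lambda>n. ennreal (cmod ((LINT X|M. Phi t A V x n X * g (x + X t)) - (LINT X|M. F X * g (x + X t))))) \<longlonglongrightarrow> ennreal 0" by simp
    then show "(\<lambda>n. cmod ((LINT X|M. Phi t A V x n X * g (x + X t)) - (LINT X|M. F X * g (x + X t)))) \<longlonglongrightarrow> 0"
      by (subst (asm) tendsto_ennreal_iff) auto
  qed
  moreover have "ufun M m A V g x t = (LINT X|M. F X * g (x + X t))"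
    by (simp add: ufun_def exp_Sfun F_def W_def)
  ultimately show ?thesis by simp
qed

end

section \<open>Gaussian mixture coupling of the increments\<close>

text \<open>
  The space of the pairs (G, G'), with G given by its coordinates.  On the null set G' = 0 the
  quotient h G / G' has the junk value 0.
\<close>
definition KM :: "(('a::euclidean_space \<Rightarrow> real) \<times> real) measure" where
  "KM = (PiM Basis (\<lambda>_. std_normal_distribution)) \<Otimes>\<^sub>M std_normal_distribution"

text \<open>Under \<open>KM\<close> this is the isotropic Cauchy vector of scale h, the increment
  for mass 0.\<close>

definition kinc :: "real \<Rightarrow> (('a::euclidean_space \<Rightarrow> real) \<times> real) \<Rightarrow> 'a" where
  "kinc h p = (\<Sum>b\<in>Basis. (h * fst p b / snd p) *\<^sub>R b)"

text \<open>The density exp (m h - m^2 tau / 2), where tau = (h / v)^2 is the random variance of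
  \<open>kinc h\<close> and v the second component. At m = 0 it is 1, so mass 0 corresponds to the
  unweighted space.\<close>

definition kwt :: "real \<Rightarrow> real \<Rightarrow> (('a::euclidean_space \<Rightarrow> real) \<times> real) \<Rightarrow> real" where
  "kwt m h p = exp (m * h) * exp (- (h * m)\<^sup>2 / (2 * (snd p)\<^sup>2))"

lemma prob_space_std_normal: "prob_space std_normal_distribution"
  by (rule prob_space_normal_density) simp

lemma prob_space_KM: "prob_space (KM :: (('a::euclidean_space \<Rightarrow> real) \<times> real) measure)"
proof -
  interpret N: prob_space std_normal_distribution by (rule prob_space_std_normal)
  interpret P: prob_space "PiM (Basis::'a set) (\<lambda>_. std_normal_distribution)"
    by (intro prob_space_PiM prob_space_std_normal)
  interpret PN: pair_prob_space "PiM (Basis::'a set) (\<lambda>_. std_normal_distribution)" std_normal_distribution ..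
  show ?thesis unfolding KM_def by (rule PN.P.prob_space_axioms)
qed

lemma snd_measurable_KM [measurable]: "snd \<in> borel_measurable KM"
  unfolding KM_def by measurable

lemma kinc_measurable [measurable]: "kinc h \<in> borel_measurable (KM :: (('a::euclidean_space \<Rightarrow> real) \<times> real) measure)"
proof -
  have c: "(\<lambda>p. fst p b) \<in> borel_measurable (KM :: (('a::euclidean_space \<Rightarrow> real) \<times> real) measure)" if "b \<in> Basis" for b
  proof -
    have "(\<lambda>f. f b) \<in> borel_measurable (PiM (Basis::'a set) (\<lambda>_. std_normal_distribution))"
      using measurable_component_singleton[OF that, of "\<lambda>_. std_normal_distribution"] by simp
    then show ?thesis unfolding KM_def by (rule measurable_compose[OF measurable_fst])
  qed
  show ?thesis unfolding kinc_def[abs_def]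
    by (intro borel_measurable_sum borel_measurable_scaleR borel_measurable_divide borel_measurable_times c snd_measurable_KM borel_measurable_const)
qed

lemma kwt_measurable [measurable]: "kwt m h \<in> borel_measurable KM"
  unfolding kwt_def[abs_def] by measurable

lemma kwt_bounds:
  assumes "0 \<le> m" "0 \<le> h"
  shows "0 \<le> kwt m h p" "kwt m h p \<le> exp (m * h)"
  by (auto simp: kwt_def)

lemma kwt_0 [simp]: "kwt 0 h p = 1"
  by (simp add: kwt_def)

text \<open>Integrating the Gaussian vector first leaves exp (- h^2 |\<xi>|^2 / (2 v^2)), which
  merges with the weight into exp (- c^2 / (2 v^2)) for c = h sqrt (|\<xi>|^2 + m^2). The remaining
  integral over v is exp (- c), and the prefactor exp (m h) supplies the shift by m.\<close>

lemma char_fun_kinc: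
  fixes \<xi> :: "'a::euclidean_space"
  assumes m: "0 \<le> m" and h: "0 \<le> h"
  shows "(LINT p|KM. complex_of_real (kwt m h p) * cis (\<xi> \<bullet> kinc h p))
    = complex_of_real (exp (- h * (sqrt ((norm \<xi>)\<^sup>2 + m\<^sup>2) - m)))"
proof -
  let ?N = "std_normal_distribution" and ?P = "PiM (Basis::'a set) (\<lambda>_. std_normal_distribution)"
  interpret N: prob_space ?N by (rule prob_space_std_normal)
  interpret P: prob_space ?P by (intro prob_space_PiM prob_space_std_normal)
  interpret PN: pair_prob_space ?P ?N ..
  interpret K: prob_space "KM :: (('a \<Rightarrow> real) \<times> real) measure" by (rule prob_space_KM)
  interpret PS: product_prob_space "\<lambda>_::'a. ?N" "Basis :: 'a set" by standard
  define F where "F p = complex_of_real (kwt m h p) * cis (\<xi> \<bullet> kinc h p)" for p :: "('a \<Rightarrow> real) \<times> real"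
  have Fm: "F \<in> borel_measurable KM" unfolding F_def cis_conv_exp by measurable
  have Fi: "integrable (?P \<Otimes>\<^sub>M ?N) F"
    unfolding KM_def[symmetric]
    by (intro K.integrable_const_bound[OF _ Fm, of "exp (m * h)"] AE_I2) (simp add: F_def norm_mult kwt_bounds[OF m h])
  define c where "c = h * sqrt ((norm \<xi>)\<^sup>2 + m\<^sup>2)"
  have c: "0 \<le> c" using h by (simp add: c_def)
  have inner: "(LINT f|?P. F (f, v)) = complex_of_real (exp (m * h) * exp (- c\<^sup>2 / (2 * v\<^sup>2)))" for v
  proof -
    have "\<xi> \<bullet> kinc h (f, v) = (\<Sum>b\<in>Basis. (h * (\<xi> \<bullet> b) / v) * f b)" for f
      by (simp add: kinc_def inner_sum_right mult_ac)
    then have "cis (\<xi> \<bullet> kinc h (f, v)) = (\<Prod>b\<in>Basis. iexp ((h * (\<xi> \<bullet> b) / v) * f b))" for f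
      by (simp add: cis_conv_exp sum_distrib_left exp_sum)
    \<comment> \<open>\<open>kwt\<close> reads only the second component, so the first may be
      anything.\<close>
    then have "(LINT f|?P. F (f, v)) = complex_of_real (kwt m h (undefined, v)) * (LINT f|?P. (\<Prod>b\<in>Basis. iexp ((h * (\<xi> \<bullet> b) / v) * f b)))"
      by (simp add: F_def kwt_def)
    also have "(LINT f|?P. (\<Prod>b\<in>Basis. iexp ((h * (\<xi> \<bullet> b) / v) * f b))) = (\<Prod>b\<in>Basis. LINT z|?N. iexp ((h * (\<xi> \<bullet> b) / v) * z))"
      by (rule PS.product_integral_prod) (auto intro!: N.integrable_const_bound[where B=1])
    also have "\<dots> = (\<Prod>b\<in>Basis. complex_of_real (exp (- ((h * (\<xi> \<bullet> b) / v)\<^sup>2) / 2)))"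
      using char_std_normal_distribution unfolding char_def fun_eq_iff by (intro prod.cong refl) blast
    also have "\<dots> = complex_of_real (exp (\<Sum>b\<in>Basis. - ((h * (\<xi> \<bullet> b) / v)\<^sup>2) / 2))"
      by (simp only: exp_sum[OF finite_Basis] of_real_prod)
    also have "(\<Sum>b\<in>Basis. - ((h * (\<xi> \<bullet> b) / v)\<^sup>2) / 2) = - (h\<^sup>2 * (norm \<xi>)\<^sup>2) / (2 * v\<^sup>2)"
    proof -
      have "(norm \<xi>)\<^sup>2 = (\<Sum>b\<in>Basis. (\<xi> \<bullet> b)\<^sup>2)"
        unfolding power2_norm_eq_inner by (subst euclidean_inner) (simp add: power2_eq_square)
      then show ?thesis
        by (simp add: sum_negf sum_distrib_left sum_divide_distrib[symmetric] power_mult_distrib power_divide mult_ac)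
    qed
    also have "complex_of_real (kwt m h (undefined, v)) * complex_of_real (exp (- (h\<^sup>2 * (norm \<xi>)\<^sup>2) / (2 * v\<^sup>2)))
      = complex_of_real (exp (m * h) * (exp (- (h * m)\<^sup>2 / (2 * v\<^sup>2)) * exp (- (h\<^sup>2 * (norm \<xi>)\<^sup>2) / (2 * v\<^sup>2))))"
      by (simp only: kwt_def snd_conv of_real_mult mult.assoc)
    also have "exp (- (h * m)\<^sup>2 / (2 * v\<^sup>2)) * exp (- (h\<^sup>2 * (norm \<xi>)\<^sup>2) / (2 * v\<^sup>2)) = exp (- c\<^sup>2 / (2 * v\<^sup>2))"
    proof -
      have "c\<^sup>2 = (h * m)\<^sup>2 + h\<^sup>2 * (norm \<xi>)\<^sup>2"
        by (simp add: c_def power_mult_distrib algebra_simps)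
      then have "- (h * m)\<^sup>2 / (2 * v\<^sup>2) + - (h\<^sup>2 * (norm \<xi>)\<^sup>2) / (2 * v\<^sup>2) = - c\<^sup>2 / (2 * v\<^sup>2)"
        by (simp add: add_divide_distrib diff_divide_distrib)
      then show ?thesis by (simp only: mult_exp_exp)
    qed
    finally show ?thesis .
  qed
  have "(LINT p|KM. F p) = (LINT v|?N. LINT f|?P. F (f, v))"
    unfolding KM_def using PN.integral_snd[of "\<lambda>f v. F (f, v)"] Fi by (simp add: case_prod_beta')
  also have "\<dots> = complex_of_real (LINT v|?N. exp (m * h) * exp (- c\<^sup>2 / (2 * v\<^sup>2)))"
    unfolding inner by (rule integral_complex_of_real)
  also have "(LINT v|?N. exp (m * h) * exp (- c\<^sup>2 / (2 * v\<^sup>2))) = exp (m * h) * (LINT v|lborel. std_normal_density v * exp (- c\<^sup>2 / (2 * v\<^sup>2)))"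
    by (simp add: integral_density normal_density_nonneg)
  also have "\<dots> = exp (m * h) * exp (- c)"
    by (simp only: integral_std_normal_exp_inverse_square[OF c])
  also have "\<dots> = exp (- h * (sqrt ((norm \<xi>)\<^sup>2 + m\<^sup>2) - m))"
    by (simp add: mult_exp_exp c_def algebra_simps)
  finally show ?thesis by (simp add: F_def)
qed

section \<open>Products of the mixtures over a grid\<close>

definition GM :: "nat \<Rightarrow> (nat \<Rightarrow> ('a::euclidean_space \<Rightarrow> real) \<times> real) measure" where
  "GM n = PiM {..<n} (\<lambda>_. KM)"

definition gwt :: "real \<Rightarrow> real \<Rightarrow> nat \<Rightarrow> (nat \<Rightarrow> ('a::euclidean_space \<Rightarrow> real) \<times> real) \<Rightarrow> real" where
  "gwt m h n \<omega> = (\<Prod>k<n. kwt m h (\<omega> k))"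

lemma prob_space_GM: "prob_space (GM n :: (nat \<Rightarrow> ('a::euclidean_space \<Rightarrow> real) \<times> real) measure)"
  unfolding GM_def by (intro prob_space_PiM prob_space_KM)

lemma GM_component_measurable: "k < n \<Longrightarrow> f \<in> measurable KM N \<Longrightarrow> (\<lambda>\<omega>. f (\<omega> k)) \<in> measurable (GM n) N"
  unfolding GM_def by (rule measurable_compose[OF measurable_component_singleton]) auto

lemma gwt_measurable [measurable]: "gwt m h n \<in> borel_measurable (GM n)"
  unfolding gwt_def[abs_def] by (intro borel_measurable_prod GM_component_measurable kwt_measurable) auto

lemma gwt_bounds:
  assumes "0 \<le> m" "0 \<le> h"
  shows "0 \<le> gwt m h n \<omega>" "gwt m h n \<omega> \<le> exp (m * (real n * h))"
proof -
  show "0 \<le> gwt m h n \<omega>" unfolding gwt_def by (intro prod_nonneg) (simp add: kwt_bounds assms)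
  have "gwt m h n \<omega> \<le> (\<Prod>k<n. exp (m * h))" unfolding gwt_def by (intro prod_mono) (simp add: kwt_bounds assms)
  then show "gwt m h n \<omega> \<le> exp (m * (real n * h))" by (simp add: exp_of_nat_mult[symmetric] mult_ac)
qed

lemma gwt_0 [simp]: "gwt 0 h n \<omega> = 1"
  by (simp add: gwt_def)

lemma char_fun_GM:
  fixes \<xi> :: "nat \<Rightarrow> 'a::euclidean_space"
  assumes m: "0 \<le> m" and h: "0 \<le> h"
  shows "(LINT \<omega>|GM n. complex_of_real (gwt m h n \<omega>) * cis (\<Sum>k<n. \<xi> k \<bullet> kinc h (\<omega> k)))
    = (\<Prod>k<n. complex_of_real (exp (- h * (sqrt ((norm (\<xi> k))\<^sup>2 + m\<^sup>2) - m))))"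
proof -
  interpret K: prob_space "KM :: (('a \<Rightarrow> real) \<times> real) measure" by (rule prob_space_KM)
  interpret PS: product_prob_space "\<lambda>_::nat. KM :: (('a \<Rightarrow> real) \<times> real) measure" "{..<n}" by standard
  have "complex_of_real (gwt m h n \<omega>) * cis (\<Sum>k<n. \<xi> k \<bullet> kinc h (\<omega> k))
    = (\<Prod>k<n. complex_of_real (kwt m h (\<omega> k)) * cis (\<xi> k \<bullet> kinc h (\<omega> k)))" for \<omega>
    by (simp add: gwt_def cis_conv_exp sum_distrib_left exp_sum prod.distrib)
  then have "(LINT \<omega>|GM n. complex_of_real (gwt m h n \<omega>) * cis (\<Sum>k<n. \<xi> k \<bullet> kinc h (\<omega> k)))
    = (LINT \<omega>|PiM {..<n} (\<lambda>_. KM). (\<Prod>k<n. complex_of_real (kwt m h (\<omega> k)) * cis (\<xi> k \<bullet> kinc h (\<omega> k))))"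
    by (simp add: GM_def)
  also have "\<dots> = (\<Prod>k<n. LINT p|KM. complex_of_real (kwt m h p) * cis (\<xi> k \<bullet> kinc h p))"
  proof (rule PS.product_integral_prod)
    show "integrable KM (\<lambda>p. complex_of_real (kwt m h p) * cis (\<xi> k \<bullet> kinc h p))" for k
    proof (intro K.integrable_const_bound[where B = "exp (m * h)"] AE_I2)
      show "(\<lambda>p. complex_of_real (kwt m h p) * cis (\<xi> k \<bullet> kinc h p)) \<in> borel_measurable KM"
        unfolding cis_conv_exp by measurable
    qed (simp add: norm_mult kwt_bounds[OF m h])
  qed simp
  finally show ?thesis by (simp only: char_fun_kinc[OF m h])
qed

text \<open>This is \<open>char_fun_GM\<close> at frequency zero, where the exponent sqrt (m^2) - m
  vanishes because m \<ge> 0.\<close>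

lemma integral_gwt:
  assumes "0 \<le> m" "0 \<le> h"
  shows "(LINT \<omega>|(GM n :: (nat \<Rightarrow> ('a::euclidean_space \<Rightarrow> real) \<times> real) measure). gwt m h n \<omega>) = 1"
proof -
  let ?G = "GM n :: (nat \<Rightarrow> ('a \<Rightarrow> real) \<times> real) measure"
  have "complex_of_real (LINT \<omega>|?G. gwt m h n \<omega>) = (LINT \<omega>|?G. complex_of_real (gwt m h n \<omega>))"
    by (rule integral_complex_of_real[symmetric])
  also have "\<dots> = (LINT \<omega>|?G. complex_of_real (gwt m h n \<omega>) * cis (\<Sum>k<n. 0 \<bullet> kinc h (\<omega> k)))"
    by simp
  also have "\<dots> = (\<Prod>k<n. complex_of_real (exp (- h * (sqrt ((norm (0::'a))\<^sup>2 + m\<^sup>2) - m))))"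
    by (rule char_fun_GM[OF assms])
  also have "\<dots> = 1" using assms by simp
  finally have "complex_of_real (LINT \<omega>|?G. gwt m h n \<omega>) = 1" .
  then show ?thesis by (simp only: of_real_eq_1_iff)
qed

context rel_levy
begin

text \<open>Both sides have the same joint characteristic function. On the right only the density
  depends on m, which makes expectations for different masses comparable.\<close>

lemma distr_incr_eq:
  "distr M (PiM {..<n} (\<lambda>_. borel)) (\<lambda>X. \<lambda>k\<in>{..<n}. incr t n X k)
   = distr (density (GM n) (\<lambda>\<omega>. ennreal (gwt m (t / real n) n \<omega>))) (PiM {..<n} (\<lambda>_. borel)) (\<lambda>\<omega>. \<lambda>k\<in>{..<n}. kinc (t / real n) (\<omega> k))"
proof -
  define h where "h = t / real n"
  have h: "0 \<le> h" using t_nonneg by (simp add: h_def)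
  let ?D = "density (GM n) (\<lambda>\<omega>. ennreal (gwt m h n \<omega>)) :: (nat \<Rightarrow> ('a \<Rightarrow> real) \<times> real) measure"
  interpret G: prob_space "GM n :: (nat \<Rightarrow> ('a \<Rightarrow> real) \<times> real) measure" by (rule prob_space_GM)
  have inc: "(\<lambda>\<omega>. kinc h (\<omega> k) :: 'a) \<in> borel_measurable (GM n)" if "k < n" for k
    using that by (intro GM_component_measurable kinc_measurable)
  have fin: "finite_measure ?D"
  proof (rule finite_measureI)
    have "emeasure ?D (space ?D) = (\<integral>\<^sup>+ \<omega>. ennreal (gwt m h n \<omega>) \<partial>(GM n :: (nat \<Rightarrow> ('a \<Rightarrow> real) \<times> real) measure))"
      by (subst emeasure_density) (auto intro!: nn_integral_cong)
    also have "\<dots> \<le> (\<integral>\<^sup>+ \<omega>. ennreal (exp (m * (real n * h))) \<partial>(GM n :: (nat \<Rightarrow> ('a \<Rightarrow> real) \<times> real) measure))"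
      using m_nonneg h by (intro nn_integral_mono ennreal_leI gwt_bounds)
    also have "\<dots> < \<infinity>" by (simp add: G.emeasure_space_1)
    finally show "emeasure ?D (space ?D) \<noteq> \<infinity>" by simp
  qed
  show ?thesis
    unfolding h_def[symmetric]
  proof (rule distr_PiM_eqI_char_fun_euclidean)
    fix \<xi> :: "nat \<Rightarrow> 'a"
    have mc: "(\<lambda>\<omega>. cis (\<Sum>k<n. \<xi> k \<bullet> kinc h (\<omega> k))) \<in> borel_measurable (GM n)"
    proof -
      have "(\<lambda>\<omega>. \<Sum>k<n. \<xi> k \<bullet> kinc h (\<omega> k)) \<in> borel_measurable (GM n)"
        by (intro borel_measurable_sum borel_measurable_inner borel_measurable_const inc) simp
      then show ?thesis unfolding cis_conv_exp by measurable
    qed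
    have "(LINT \<omega>|?D. cis (\<Sum>k<n. \<xi> k \<bullet> kinc h (\<omega> k))) = (LINT \<omega>|GM n. gwt m h n \<omega> *\<^sub>R cis (\<Sum>k<n. \<xi> k \<bullet> kinc h (\<omega> k)))"
      using m_nonneg h by (intro integral_density mc gwt_measurable AE_I2 gwt_bounds)
    also have "\<dots> = (\<Prod>k<n. complex_of_real (exp (- h * (sqrt ((norm (\<xi> k))\<^sup>2 + m\<^sup>2) - m))))"
      using char_fun_GM[OF m_nonneg h, of n \<xi>] by (simp only: scaleR_conv_of_real)
    also have "\<dots> = (LINT X|M. cis (\<Sum>k<n. \<xi> k \<bullet> incr t n X k))"
      unfolding char_fun_incr symb_def h_def ..
    finally show "(LINT X|M. cis (\<Sum>k<n. \<xi> k \<bullet> incr t n X k)) = (LINT \<omega>|?D. cis (\<Sum>k<n. \<xi> k \<bullet> kinc h (\<omega> k)))" ..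
  qed (use inc fin in \<open>auto intro: finite_measure_axioms\<close>)
qed

lemma kinc_vector_measurable:
  "(\<lambda>\<omega>. \<lambda>k\<in>{..<n}. kinc h (\<omega> k) :: 'a) \<in> measurable (GM n) (PiM {..<n} (\<lambda>_. borel))"
  by (intro measurable_restrict GM_component_measurable kinc_measurable) simp

lemma incr_vector_measurable:
  "(\<lambda>X. \<lambda>k\<in>{..<n}. incr t n X k) \<in> measurable M (PiM {..<n} (\<lambda>_. borel))"
  by (intro measurable_restrict) simp

lemma integral_incr_eq:
  fixes \<Psi> :: "(nat \<Rightarrow> 'a) \<Rightarrow> complex"
  assumes \<Psi>: "\<Psi> \<in> borel_measurable (PiM {..<n} (\<lambda>_. borel))"
  shows "(LINT X|M. \<Psi> (\<lambda>k\<in>{..<n}. incr t n X k))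
    = (LINT \<omega>|GM n. gwt m (t / real n) n \<omega> *\<^sub>R \<Psi> (\<lambda>k\<in>{..<n}. kinc (t / real n) (\<omega> k)))"
proof -
  let ?D = "density (GM n) (\<lambda>\<omega>. ennreal (gwt m (t / real n) n \<omega>)) :: (nat \<Rightarrow> ('a \<Rightarrow> real) \<times> real) measure"
  have kD: "(\<lambda>\<omega>. \<lambda>k\<in>{..<n}. kinc (t / real n) (\<omega> k) :: 'a) \<in> measurable ?D (PiM {..<n} (\<lambda>_. borel))"
    using kinc_vector_measurable by simp
  have "(LINT X|M. \<Psi> (\<lambda>k\<in>{..<n}. incr t n X k)) = (LINT f|distr M (PiM {..<n} (\<lambda>_. borel)) (\<lambda>X. \<lambda>k\<in>{..<n}. incr t n X k). \<Psi> f)"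
    by (rule integral_distr[symmetric, OF incr_vector_measurable \<Psi>])
  also have "\<dots> = (LINT \<omega>|?D. \<Psi> (\<lambda>k\<in>{..<n}. kinc (t / real n) (\<omega> k)))"
    unfolding distr_incr_eq by (rule integral_distr[OF kD \<Psi>])
  also have "\<dots> = (LINT \<omega>|GM n. gwt m (t / real n) n \<omega> *\<^sub>R \<Psi> (\<lambda>k\<in>{..<n}. kinc (t / real n) (\<omega> k)))"
    using m_nonneg t_nonneg
    by (intro integral_density measurable_compose[OF kinc_vector_measurable \<Psi>] gwt_measurable AE_I2 gwt_bounds) auto
  finally show ?thesis .
qed

lemma nn_integral_incr_eq:
  fixes \<Psi> :: "(nat \<Rightarrow> 'a) \<Rightarrow> ennreal"
  assumes \<Psi>: "\<Psi> \<in> borel_measurable (PiM {..<n} (\<lambda>_. borel))"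
  shows "(\<integral>\<^sup>+ X. \<Psi> (\<lambda>k\<in>{..<n}. incr t n X k) \<partial>M)
    = (\<integral>\<^sup>+ \<omega>. ennreal (gwt m (t / real n) n \<omega>) * \<Psi> (\<lambda>k\<in>{..<n}. kinc (t / real n) (\<omega> k)) \<partial>GM n)"
proof -
  let ?D = "density (GM n) (\<lambda>\<omega>. ennreal (gwt m (t / real n) n \<omega>)) :: (nat \<Rightarrow> ('a \<Rightarrow> real) \<times> real) measure"
  have kD: "(\<lambda>\<omega>. \<lambda>k\<in>{..<n}. kinc (t / real n) (\<omega> k) :: 'a) \<in> measurable ?D (PiM {..<n} (\<lambda>_. borel))"
    using kinc_vector_measurable by simp
  have "(\<integral>\<^sup>+ X. \<Psi> (\<lambda>k\<in>{..<n}. incr t n X k) \<partial>M) = (\<integral>\<^sup>+ f. \<Psi> f \<partial>distr M (PiM {..<n} (\<lambda>_. borel)) (\<lambda>X. \<lambda>k\<in>{..<n}. incr t n X k))"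
    using \<Psi> by (intro nn_integral_distr[symmetric] incr_vector_measurable) simp
  also have "\<dots> = (\<integral>\<^sup>+ \<omega>. \<Psi> (\<lambda>k\<in>{..<n}. kinc (t / real n) (\<omega> k)) \<partial>?D)"
    unfolding distr_incr_eq using \<Psi> by (intro nn_integral_distr kD) simp
  also have "\<dots> = (\<integral>\<^sup>+ \<omega>. ennreal (gwt m (t / real n) n \<omega>) * \<Psi> (\<lambda>k\<in>{..<n}. kinc (t / real n) (\<omega> k)) \<partial>GM n)"
    by (intro nn_integral_density measurable_compose[OF kinc_vector_measurable \<Psi>] measurable_compose[OF gwt_measurable]) auto
  finally show ?thesis .
qed

end

text \<open>With E = exp (m n h), the weight w and the number 1 are both at most E, hence |w - 1|
  \<le> (E - w) + (E - 1). Both summands have mean E - 1, as w has mean 1.\<close>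

lemma nn_integral_abs_gwt_minus_1_le:
  assumes m: "0 \<le> m" and h: "0 \<le> h"
  shows "(\<integral>\<^sup>+ \<omega>. ennreal \<bar>gwt m h n \<omega> - 1\<bar> \<partial>(GM n :: (nat \<Rightarrow> ('a::euclidean_space \<Rightarrow> real) \<times> real) measure))
    \<le> ennreal (2 * (exp (m * (real n * h)) - 1))"
proof -
  let ?G = "GM n :: (nat \<Rightarrow> ('a \<Rightarrow> real) \<times> real) measure"
  define E where "E = exp (m * (real n * h))"
  interpret G: prob_space ?G by (rule prob_space_GM)
  have E1: "1 \<le> E" using m h by (simp add: E_def)
  have gi: "integrable ?G (gwt m h n)"
    by (intro G.integrable_const_bound[where B=E] AE_I2) (simp_all add: E_def gwt_bounds[OF m h])
  have "(\<integral>\<^sup>+ \<omega>. ennreal \<bar>gwt m h n \<omega> - 1\<bar> \<partial>?G) \<le> (\<integral>\<^sup>+ \<omega>. ennreal ((E - gwt m h n \<omega>) + (E - 1)) \<partial>?G)"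
  proof (intro nn_integral_mono ennreal_leI)
    fix \<omega> show "\<bar>gwt m h n \<omega> - 1\<bar> \<le> (E - gwt m h n \<omega>) + (E - 1)"
      using gwt_bounds(2)[OF m h, of n \<omega>] E1 unfolding E_def[symmetric] by linarith
  qed
  also have "\<dots> = ennreal (LINT \<omega>|?G. (E - gwt m h n \<omega>) + (E - 1))"
  proof (intro nn_integral_eq_integral AE_I2)
    show "0 \<le> (E - gwt m h n \<omega>) + (E - 1)" for \<omega> :: "nat \<Rightarrow> ('a \<Rightarrow> real) \<times> real"
      using gwt_bounds(2)[OF m h, of n \<omega>] E1 unfolding E_def[symmetric] by linarith
  qed (use gi in simp)
  also have "(LINT \<omega>|?G. (E - gwt m h n \<omega>) + (E - 1)) = 2 * (E - 1)"
    using gi integral_gwt[OF m h, of n, where 'a='a] by (simp add: G.prob_space)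
  finally show ?thesis by (simp add: E_def)
qed

section \<open>The zero-mass limit\<close>

lemma nn_integral_lborel_translate:
  fixes F :: "'a::euclidean_space \<Rightarrow> ennreal"
  assumes "F \<in> borel_measurable borel"
  shows "(\<integral>\<^sup>+ x. F (x + c) \<partial>lborel) = (\<integral>\<^sup>+ x. F x \<partial>lborel)"
proof -
  have "(\<integral>\<^sup>+ x. F x \<partial>lborel) = (\<integral>\<^sup>+ x. F x \<partial>distr lborel borel ((+) c))" by (simp add: lborel_distr_plus)
  also have "\<dots> = (\<integral>\<^sup>+ x. F (c + x) \<partial>lborel)" using assms by (intro nn_integral_distr) auto
  finally show ?thesis by (simp add: add.commute)
qed

text \<open>Tonelli's theorem and translation invariance of Lebesgue measure: integrating over x
  first makes the shift \<open>S\<close> disappear.\<close>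

lemma nn_integral_convolve:
  fixes F :: "'a::euclidean_space \<Rightarrow> ennreal"
  assumes N: "prob_space N" and F: "F \<in> borel_measurable borel" and S: "S \<in> borel_measurable N" and w: "w \<in> borel_measurable N"
  shows "(\<lambda>x. \<integral>\<^sup>+ \<omega>. w \<omega> * F (x + S \<omega>) \<partial>N) \<in> borel_measurable borel"
    and "(\<integral>\<^sup>+ x. (\<integral>\<^sup>+ \<omega>. w \<omega> * F (x + S \<omega>) \<partial>N) \<partial>lborel) = (\<integral>\<^sup>+ \<omega>. w \<omega> \<partial>N) * (\<integral>\<^sup>+ x. F x \<partial>lborel)"
proof -
  interpret N: prob_space N by (rule N)
  interpret PS: pair_sigma_finite "lborel :: 'a measure" N ..
  have sm: "(\<lambda>p. fst p + S (snd p)) \<in> borel_measurable (lborel \<Otimes>\<^sub>M N)"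
    by (intro borel_measurable_add measurable_compose[OF measurable_snd S]) simp
  have fm: "(\<lambda>(x, \<omega>). w \<omega> * F (x + S \<omega>)) \<in> borel_measurable (lborel \<Otimes>\<^sub>M N)"
    unfolding case_prod_beta'
    by (intro borel_measurable_times_ennreal measurable_compose[OF measurable_snd w] measurable_compose[OF sm F])
  show "(\<lambda>x. \<integral>\<^sup>+ \<omega>. w \<omega> * F (x + S \<omega>) \<partial>N) \<in> borel_measurable borel"
    using N.borel_measurable_nn_integral[OF fm] by simp
  have "(\<integral>\<^sup>+ x. (\<integral>\<^sup>+ \<omega>. w \<omega> * F (x + S \<omega>) \<partial>N) \<partial>lborel) = (\<integral>\<^sup>+ \<omega>. (\<integral>\<^sup>+ x. w \<omega> * F (x + S \<omega>) \<partial>lborel) \<partial>N)"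
    using PS.Fubini'[OF fm] by simp
  also have "\<dots> = (\<integral>\<^sup>+ \<omega>. w \<omega> * (\<integral>\<^sup>+ x. F x \<partial>lborel) \<partial>N)"
  proof (rule nn_integral_cong)
    fix \<omega>
    have "(\<lambda>x. F (x + S \<omega>)) \<in> borel_measurable lborel"
      using measurable_compose[OF _ F, of "\<lambda>x. x + S \<omega>" lborel] by simp
    then show "(\<integral>\<^sup>+ x. w \<omega> * F (x + S \<omega>) \<partial>lborel) = w \<omega> * (\<integral>\<^sup>+ x. F x \<partial>lborel)"
      by (simp add: nn_integral_cmult nn_integral_lborel_translate[OF F])
  qed
  also have "\<dots> = (\<integral>\<^sup>+ \<omega>. w \<omega> \<partial>N) * (\<integral>\<^sup>+ x. F x \<partial>lborel)"
    using w by (rule nn_integral_multc)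
  finally show "(\<integral>\<^sup>+ x. (\<integral>\<^sup>+ \<omega>. w \<omega> * F (x + S \<omega>) \<partial>N) \<partial>lborel) = (\<integral>\<^sup>+ \<omega>. w \<omega> \<partial>N) * (\<integral>\<^sup>+ x. F x \<partial>lborel)" .
qed

text \<open>The expectation of g(x + \<open>S\<close>) need not exist for every x. That of |g|^2 is
  integrable in x by \<open>nn_integral_convolve\<close>, hence finite for almost every x, and |g|
  \<le> 1 + |g|^2 gives the claim there.\<close>

lemma AE_integrable_translate:
  fixes g :: "'a::euclidean_space \<Rightarrow> complex"
  assumes N: "prob_space N" and g: "L2_fun g" and S: "S \<in> borel_measurable N"
  shows "AE x in lborel. integrable N (\<lambda>\<omega>. cmod (g (x + S \<omega>)))"
proof -
  interpret N: prob_space N by (rule N)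
  have gm[measurable]: "g \<in> borel_measurable borel" and g2: "integrable lborel (\<lambda>x. (cmod (g x))\<^sup>2)"
    using g by (auto simp: L2_fun_def)
  define F where "F x = ennreal ((cmod (g x))\<^sup>2)" for x
  have F: "F \<in> borel_measurable borel" unfolding F_def by measurable
  have Ffin: "(\<integral>\<^sup>+ x. F x \<partial>lborel) < \<infinity>"
    using g2 unfolding F_def by (simp add: integrable_iff_bounded)
  note cv = nn_integral_convolve[OF N F S, of "\<lambda>_. 1", simplified]
  have "(\<integral>\<^sup>+ x. (\<integral>\<^sup>+ \<omega>. F (x + S \<omega>) \<partial>N) \<partial>lborel) \<noteq> \<infinity>"
    using cv(2) Ffin by (simp add: N.emeasure_space_1)
  then have "AE x in lborel. (\<integral>\<^sup>+ \<omega>. F (x + S \<omega>) \<partial>N) \<noteq> \<infinity>"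
    using cv(1) by (intro nn_integral_PInf_AE) auto
  then show ?thesis
  proof eventually_elim
    case (elim x)
    have m: "(\<lambda>\<omega>. g (x + S \<omega>)) \<in> borel_measurable N"
      using S by (intro measurable_compose[OF _ gm] borel_measurable_add) auto
    have "integrable N (\<lambda>\<omega>. (cmod (g (x + S \<omega>)))\<^sup>2)"
      using elim m by (intro integrableI_bounded) (auto simp: F_def less_top)
    then have i: "integrable N (\<lambda>\<omega>. 1 + (cmod (g (x + S \<omega>)))\<^sup>2)" by simp
    show ?case
    proof (rule Bochner_Integration.integrable_bound[OF i])
      have "r \<le> 1 + r\<^sup>2" for r :: real
      proof -
        have "0 \<le> (r - 1/2)\<^sup>2" by simp
        then show ?thesis by (simp add: power2_diff) (simp add: power2_eq_square)
      qed
      then show "AE \<omega> in N. norm (cmod (g (x + S \<omega>))) \<le> norm (1 + (cmod (g (x + S \<omega>)))\<^sup>2)" by simp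
    qed (use m in measurable)
  qed
qed

text \<open>\<open>Phi\<close> times g, written as a function of the vector of increments alone by
  replacing path values with partial sums; in this form only the law of that vector matters.\<close>

definition path_functional :: "real \<Rightarrow> ('a::euclidean_space \<Rightarrow> 'a) \<Rightarrow> ('a \<Rightarrow> real) \<Rightarrow> ('a \<Rightarrow> complex) \<Rightarrow> 'a \<Rightarrow> nat \<Rightarrow> (nat \<Rightarrow> 'a) \<Rightarrow> complex" where
  "path_functional t A V g x n f = complex_of_real (exp (- (\<Sum>k<n. t / real n * V (x + (\<Sum>j<Suc k. f j)))))
     * cis (- (\<Sum>k<n. A (x + (\<Sum>j<k. f j) + (1/2) *\<^sub>R f k) \<bullet> f k)) * g (x + (\<Sum>j<n. f j))"

lemma path_functional_measurable:
  fixes g :: "'a::euclidean_space \<Rightarrow> complex"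
  assumes A: "A \<in> borel_measurable borel" and V: "V \<in> borel_measurable borel" and g: "g \<in> borel_measurable borel"
  shows "path_functional t A V g x n \<in> borel_measurable (PiM {..<n} (\<lambda>_. borel))"
proof -
  have c: "(\<lambda>f. f l) \<in> borel_measurable (PiM {..<n} (\<lambda>_. borel :: 'a measure))" if "l < n" for l
    using that by (intro measurable_component_singleton) simp
  have s: "(\<lambda>f. \<Sum>j<k. f j) \<in> borel_measurable (PiM {..<n} (\<lambda>_. borel :: 'a measure))" if "k \<le> n" for k
    using that by (intro borel_measurable_sum c) simp
  have 1: "(\<lambda>f. - (\<Sum>k<n. t / real n * V (x + (\<Sum>j<Suc k. f j)))) \<in> borel_measurable (PiM {..<n} (\<lambda>_. borel :: 'a measure))"
    by (intro borel_measurable_uminus borel_measurable_sum borel_measurable_times borel_measurable_const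
        measurable_compose[OF _ V] borel_measurable_add c) auto
  have 2: "(\<lambda>f. - (\<Sum>k<n. A (x + (\<Sum>j<k. f j) + (1/2) *\<^sub>R f k) \<bullet> f k)) \<in> borel_measurable (PiM {..<n} (\<lambda>_. borel :: 'a measure))"
    by (intro borel_measurable_uminus borel_measurable_sum borel_measurable_inner borel_measurable_const
        measurable_compose[OF _ A] borel_measurable_add borel_measurable_scaleR c) auto
  have 3: "(\<lambda>f. g (x + (\<Sum>j<n. f j))) \<in> borel_measurable (PiM {..<n} (\<lambda>_. borel :: 'a measure))"
    by (intro measurable_compose[OF _ g] borel_measurable_add borel_measurable_const s) simp
  show ?thesis
    unfolding path_functional_def[abs_def] cis_conv_exp using 1 2 3 by measurable
qed

section \<open>Comparison of the solutions for two masses\<close>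

context rel_levy_functional
begin

lemma path_functional_incr:
  assumes X: "X \<in> D0" and n: "0 < n"
  shows "path_functional t A V g x n (\<lambda>k\<in>{..<n}. incr t n X k) = Phi t A V x n X * g (x + X t)"
proof -
  have s: "(\<Sum>j<k. (\<lambda>k\<in>{..<n}. incr t n X k) j) = X (grid t n k)" if "k \<le> n" for k
    unfolding path_eq_sum_incr[OF X] using that by (intro sum.cong) auto
  have "grid t n n = t" using n by (simp add: grid_def)
  then have gg: "(\<Sum>j<n. (\<lambda>k\<in>{..<n}. incr t n X k) j) = X t" using s[of n] by simp
  have 1: "(\<Sum>k<n. t / real n * V (x + (\<Sum>j<Suc k. (\<lambda>k\<in>{..<n}. incr t n X k) j))) = Vsum t V x n X"
    unfolding Vsum_def by (intro sum.cong refl) (simp only: s lessThan_iff Suc_leI)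
  have 2: "(\<Sum>k<n. A (x + (\<Sum>j<k. (\<lambda>k\<in>{..<n}. incr t n X k) j) + (1/2) *\<^sub>R (\<lambda>k\<in>{..<n}. incr t n X k) k) \<bullet> (\<lambda>k\<in>{..<n}. incr t n X k) k) = Isum t A x (\<lambda>_. 1) n X"
    unfolding Isum_def by (intro sum.cong refl) (simp only: s lessThan_iff less_imp_le restrict_apply' mult_1_left)
  show ?thesis
    unfolding path_functional_def Phi_def 1 2 gg by simp
qed

lemma path_functional_bound:
  "cmod (path_functional t A V g x n f) \<le> exp (t * B) * cmod (g (x + (\<Sum>j<n. f j)))"
proof -
  have "\<bar>\<Sum>k<n. t / real n * V (x + (\<Sum>j<Suc k. f j))\<bar> \<le> t * B"
  proof (cases "n = 0")
    case False
    have "\<bar>\<Sum>k<n. t / real n * V (x + (\<Sum>j<Suc k. f j))\<bar> \<le> (\<Sum>k<n. t / real n * B)"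
    proof (rule order_trans[OF sum_abs], rule sum_mono)
      show "\<bar>t / real n * V (x + (\<Sum>j<Suc k. f j))\<bar> \<le> t / real n * B" for k
        unfolding abs_mult using t_nonneg V_bound by (intro mult_mono) auto
    qed
    then show ?thesis using False by simp
  qed (simp add: t_nonneg B_nonneg)
  then have "exp (- (\<Sum>k<n. t / real n * V (x + (\<Sum>j<Suc k. f j)))) \<le> exp (t * B)" by (simp only: exp_le_cancel_iff abs_le_iff)
  then show ?thesis
    unfolding path_functional_def norm_mult norm_of_real norm_cis abs_exp_cancel mult_1_right by (rule mult_right_mono) simp
qed

end

text \<open>Over \<open>GM\<close> the difference is the mean of (w - 1) times one and the same
  functional. With |w - 1| written as a product of two square roots, the Cauchy-Schwarz inequality
  leaves one factor whose mean is already small and one that still carries |w - 1| and becomes small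
  once integrated over x.\<close>

lemma ufun_approx_difference:
  fixes M M0 :: "(real \<Rightarrow> 'a::euclidean_space) measure" and g :: "'a \<Rightarrow> complex"
  assumes F: "rel_levy_functional M m t A a L V B" and F0: "rel_levy_functional M0 0 t A a L V B"
    and g: "g \<in> borel_measurable borel" and i0: "integrable M0 (\<lambda>X. cmod (g (x + X t)))" and n: "0 < n"
  shows "ennreal ((cmod ((LINT X|M. Phi t A V x n X * g (x + X t)) - (LINT X|M0. Phi t A V x n X * g (x + X t))))\<^sup>2)
    \<le> ennreal ((exp (t * B))\<^sup>2 * (2 * (exp (m * t) - 1)))
       * (\<integral>\<^sup>+ \<omega>. ennreal \<bar>gwt m (t / real n) n \<omega> - 1\<bar> * ennreal ((cmod (g (x + (\<Sum>k<n. kinc (t / real n) (\<omega> k)))))\<^sup>2) \<partial>GM n)"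
proof -
  interpret Q: rel_levy_functional M m t A a L x V B by (rule F)
  interpret Q0: rel_levy_functional M0 0 t A a L x V B by (rule F0)
  define h where "h = t / real n"
  have h: "0 \<le> h" using Q.t_nonneg by (simp add: h_def)
  let ?G = "GM n :: (nat \<Rightarrow> ('a \<Rightarrow> real) \<times> real) measure"
  interpret G: prob_space ?G by (rule prob_space_GM)
  define \<Psi> where "\<Psi> = path_functional t A V g x n"
  define k where "k \<omega> = (\<lambda>j\<in>{..<n}. kinc h (\<omega> j) :: 'a)" for \<omega> :: "nat \<Rightarrow> ('a \<Rightarrow> real) \<times> real"
  define S where "S \<omega> = (\<Sum>j<n. kinc h (\<omega> j) :: 'a)" for \<omega> :: "nat \<Rightarrow> ('a \<Rightarrow> real) \<times> real"
  define w where "w = (gwt m h n :: (nat \<Rightarrow> ('a \<Rightarrow> real) \<times> real) \<Rightarrow> real)"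
  have wm[measurable]: "w \<in> borel_measurable ?G" unfolding w_def by measurable
  have w: "0 \<le> w \<omega>" "w \<omega> \<le> exp (m * t)" for \<omega>
    using gwt_bounds[OF Q.m_nonneg h, of n \<omega>] n by (auto simp: w_def h_def)
  have \<Psi>m: "\<Psi> \<in> borel_measurable (PiM {..<n} (\<lambda>_. borel))"
    unfolding \<Psi>_def by (rule path_functional_measurable[OF Q.A_measurable Q.V_measurable g])
  have km: "k \<in> measurable ?G (PiM {..<n} (\<lambda>_. borel))"
    unfolding k_def by (rule Q.kinc_vector_measurable)
  have \<Psi>k[measurable]: "(\<lambda>\<omega>. \<Psi> (k \<omega>)) \<in> borel_measurable ?G"
    by (rule measurable_compose[OF km \<Psi>m])
  have Sm: "S \<in> borel_measurable ?G" unfolding S_def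
    by (intro borel_measurable_sum GM_component_measurable kinc_measurable) simp
  have gS[measurable]: "(\<lambda>\<omega>. g (x + S \<omega>)) \<in> borel_measurable ?G"
    by (intro measurable_compose[OF _ g] borel_measurable_add Sm) simp
  have Sk: "(\<Sum>j<n. k \<omega> j) = S \<omega>" for \<omega> unfolding k_def S_def by (intro sum.cong) auto
  have \<Psi>b: "cmod (\<Psi> (k \<omega>)) \<le> exp (t * B) * cmod (g (x + S \<omega>))" for \<omega>
    unfolding \<Psi>_def Sk[symmetric] by (rule Q.path_functional_bound)
  have e: "(LINT X|M. Phi t A V x n X * g (x + X t)) = (LINT \<omega>|?G. w \<omega> *\<^sub>R \<Psi> (k \<omega>))"
  proof -
    have "(LINT X|M. Phi t A V x n X * g (x + X t)) = (LINT X|M. \<Psi> (\<lambda>k\<in>{..<n}. incr t n X k))"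
      unfolding \<Psi>_def by (intro Bochner_Integration.integral_cong refl Q.path_functional_incr[symmetric] n) (simp add: Q.space_M)
    then show ?thesis unfolding Q.integral_incr_eq[OF \<Psi>m] by (simp only: w_def k_def h_def)
  qed
  have e0: "(LINT X|M0. Phi t A V x n X * g (x + X t)) = (LINT \<omega>|?G. \<Psi> (k \<omega>))"
  proof -
    have "(LINT X|M0. Phi t A V x n X * g (x + X t)) = (LINT X|M0. \<Psi> (\<lambda>k\<in>{..<n}. incr t n X k))"
      unfolding \<Psi>_def by (intro Bochner_Integration.integral_cong refl Q0.path_functional_incr[symmetric] n) (simp add: Q0.space_M)
    then show ?thesis unfolding Q0.integral_incr_eq[OF \<Psi>m] by (simp only: gwt_0 scaleR_one k_def h_def)
  qed
  \<comment> \<open>Integrability under mass 0, where the weight is 1, is enough: for mass m the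
    weight is at most exp (m t).\<close>
  have ig: "integrable ?G (\<lambda>\<omega>. cmod (g (x + S \<omega>)))"
  proof -
    define \<Theta> where "\<Theta> f = ennreal (cmod (g (x + (\<Sum>j<n. f j))))" for f :: "nat \<Rightarrow> 'a"
    have \<Theta>m: "\<Theta> \<in> borel_measurable (PiM {..<n} (\<lambda>_. borel))"
    proof -
      have "(\<lambda>f. \<Sum>j<n. f j) \<in> borel_measurable (PiM {..<n} (\<lambda>_. borel :: 'a measure))"
        by (intro borel_measurable_sum measurable_component_singleton) simp
      then have "(\<lambda>f. g (x + (\<Sum>j<n. f j))) \<in> borel_measurable (PiM {..<n} (\<lambda>_. borel :: 'a measure))"
        by (intro measurable_compose[OF _ g] borel_measurable_add) auto
      then show ?thesis unfolding \<Theta>_def by measurable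
    qed
    have "(\<integral>\<^sup>+ \<omega>. ennreal (cmod (g (x + S \<omega>))) \<partial>?G) = (\<integral>\<^sup>+ X. \<Theta> (\<lambda>k\<in>{..<n}. incr t n X k) \<partial>M0)"
      unfolding Q0.nn_integral_incr_eq[OF \<Theta>m] using Sk by (simp add: \<Theta>_def k_def h_def)
    also have "\<dots> = (\<integral>\<^sup>+ X. ennreal (cmod (g (x + X t))) \<partial>M0)"
    proof (rule nn_integral_cong)
      fix X assume "X \<in> space M0"
      then have X: "X \<in> D0" by (simp add: Q0.space_M)
      have "(\<Sum>j<n. (\<lambda>k\<in>{..<n}. incr t n X k) j) = X (grid t n n)"
        unfolding Q0.path_eq_sum_incr[OF X] by (intro sum.cong) auto
      moreover have "grid t n n = t" using n by (simp add: grid_def)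
      ultimately show "\<Theta> (\<lambda>k\<in>{..<n}. incr t n X k) = ennreal (cmod (g (x + X t)))" by (simp only: \<Theta>_def)
    qed
    also have "\<dots> < \<infinity>" using i0 by (simp add: integrable_iff_bounded)
    finally show ?thesis by (intro integrableI_bounded) auto
  qed
  have i1: "integrable ?G (\<lambda>\<omega>. \<Psi> (k \<omega>))"
    by (rule Bochner_Integration.integrable_bound[OF integrable_mult_right[OF ig, of "exp (t * B)"] \<Psi>k])
      (intro AE_I2, simp add: \<Psi>b)
  have i2: "integrable ?G (\<lambda>\<omega>. w \<omega> *\<^sub>R \<Psi> (k \<omega>))"
  proof (rule Bochner_Integration.integrable_bound[OF integrable_mult_right[OF integrable_norm[OF i1], of "exp (m * t)"]])
    show "AE \<omega> in ?G. norm (w \<omega> *\<^sub>R \<Psi> (k \<omega>)) \<le> norm (exp (m * t) * norm (\<Psi> (k \<omega>)))"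
      by (intro AE_I2) (simp add: abs_mult w mult_right_mono)
  qed measurable
  have d: "(LINT X|M. Phi t A V x n X * g (x + X t)) - (LINT X|M0. Phi t A V x n X * g (x + X t)) = (LINT \<omega>|?G. (w \<omega> - 1) *\<^sub>R \<Psi> (k \<omega>))"
    unfolding e e0 using i1 i2 by (simp add: scaleR_diff_left)
  define P where "P \<omega> = ennreal (sqrt \<bar>w \<omega> - 1\<bar>)" for \<omega>
  define R where "R \<omega> = ennreal (sqrt \<bar>w \<omega> - 1\<bar> * cmod (g (x + S \<omega>)))" for \<omega>
  have [measurable]: "P \<in> borel_measurable ?G" "R \<in> borel_measurable ?G" unfolding P_def R_def by measurable
  have "ennreal (cmod (LINT \<omega>|?G. (w \<omega> - 1) *\<^sub>R \<Psi> (k \<omega>))) \<le> (\<integral>\<^sup>+ \<omega>. ennreal (cmod ((w \<omega> - 1) *\<^sub>R \<Psi> (k \<omega>))) \<partial>?G)"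
    using i1 i2 by (intro integral_norm_bound_ennreal) (simp add: scaleR_diff_left)
  also have "\<dots> \<le> (\<integral>\<^sup>+ \<omega>. ennreal (exp (t * B)) * (P \<omega> * R \<omega>) \<partial>?G)"
  proof (rule nn_integral_mono)
    fix \<omega>
    have "cmod ((w \<omega> - 1) *\<^sub>R \<Psi> (k \<omega>)) \<le> exp (t * B) * (sqrt \<bar>w \<omega> - 1\<bar> * (sqrt \<bar>w \<omega> - 1\<bar> * cmod (g (x + S \<omega>))))"
      using mult_left_mono[OF \<Psi>b, of "\<bar>w \<omega> - 1\<bar>" \<omega>] by (simp add: mult.left_commute mult.assoc[symmetric])
    then show "ennreal (cmod ((w \<omega> - 1) *\<^sub>R \<Psi> (k \<omega>))) \<le> ennreal (exp (t * B)) * (P \<omega> * R \<omega>)"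
      unfolding P_def R_def by (simp add: ennreal_leI flip: ennreal_mult)
  qed
  also have "\<dots> = ennreal (exp (t * B)) * (\<integral>\<^sup>+ \<omega>. P \<omega> * R \<omega> \<partial>?G)"
    by (rule nn_integral_cmult) measurable
  finally have "ennreal (cmod (LINT \<omega>|?G. (w \<omega> - 1) *\<^sub>R \<Psi> (k \<omega>)))^2 \<le> (ennreal (exp (t * B)) * (\<integral>\<^sup>+ \<omega>. P \<omega> * R \<omega> \<partial>?G))^2"
    by (rule power_mono) simp
  also have "\<dots> = ennreal (exp (t * B))^2 * (\<integral>\<^sup>+ \<omega>. P \<omega> * R \<omega> \<partial>?G)^2"
    by (rule power_mult_distrib)
  also have "\<dots> \<le> ennreal (exp (t * B))^2 * ((\<integral>\<^sup>+ \<omega>. (P \<omega>)^2 \<partial>?G) * (\<integral>\<^sup>+ \<omega>. (R \<omega>)^2 \<partial>?G))"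
    by (intro mult_left_mono Cauchy_Schwarz_nn_integral) auto
  also have "(\<integral>\<^sup>+ \<omega>. (P \<omega>)^2 \<partial>?G) = (\<integral>\<^sup>+ \<omega>. ennreal \<bar>w \<omega> - 1\<bar> \<partial>?G)"
    by (simp add: P_def ennreal_power)
  also have "(\<integral>\<^sup>+ \<omega>. (R \<omega>)^2 \<partial>?G) = (\<integral>\<^sup>+ \<omega>. ennreal \<bar>w \<omega> - 1\<bar> * ennreal ((cmod (g (x + S \<omega>)))\<^sup>2) \<partial>?G)"
    by (simp add: R_def ennreal_power power_mult_distrib ennreal_mult)
  also have "ennreal (exp (t * B))^2 * ((\<integral>\<^sup>+ \<omega>. ennreal \<bar>w \<omega> - 1\<bar> \<partial>?G) * (\<integral>\<^sup>+ \<omega>. ennreal \<bar>w \<omega> - 1\<bar> * ennreal ((cmod (g (x + S \<omega>)))\<^sup>2) \<partial>?G))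
    \<le> ennreal (exp (t * B))^2 * (ennreal (2 * (exp (m * t) - 1)) * (\<integral>\<^sup>+ \<omega>. ennreal \<bar>w \<omega> - 1\<bar> * ennreal ((cmod (g (x + S \<omega>)))\<^sup>2) \<partial>?G))"
  proof (intro mult_left_mono mult_right_mono)
    have "real n * h = t" using n by (simp add: h_def)
    then show "(\<integral>\<^sup>+ \<omega>. ennreal \<bar>w \<omega> - 1\<bar> \<partial>?G) \<le> ennreal (2 * (exp (m * t) - 1))"
      using nn_integral_abs_gwt_minus_1_le[OF Q.m_nonneg h, of n, where 'a='a] by (simp add: w_def)
  qed auto
  also have "\<dots> = ennreal ((exp (t * B))\<^sup>2 * (2 * (exp (m * t) - 1))) * (\<integral>\<^sup>+ \<omega>. ennreal \<bar>w \<omega> - 1\<bar> * ennreal ((cmod (g (x + S \<omega>)))\<^sup>2) \<partial>?G)"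
    by (simp add: ennreal_power ennreal_mult' mult.assoc)
  finally show ?thesis
    unfolding d by (simp add: ennreal_power w_def S_def h_def)
qed

text \<open>Integrating \<open>ufun_approx_difference\<close> over x yields the second factor 2 (exp
  (m t) - 1), whatever n. At almost every x the discretized expectations converge for both masses,
  so Fatou's lemma carries the bound over to the solutions.\<close>

lemma ufun_difference_bound:
  fixes M M0 :: "(real \<Rightarrow> 'a::euclidean_space) measure" and g :: "'a \<Rightarrow> complex"
  assumes F: "rel_levy_functional M m t A a L V B" and F0: "rel_levy_functional M0 0 t A a L V B"
    and g: "L2_fun g"
  shows "(\<integral>\<^sup>+ x. ennreal ((cmod (ufun M m A V g x t - ufun M0 0 A V g x t))\<^sup>2) \<partial>lborel)
    \<le> ennreal ((exp (t * B))\<^sup>2 * (2 * (exp (m * t) - 1))\<^sup>2 * (LINT x|lborel. (cmod (g x))\<^sup>2))"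
proof -
  \<comment> \<open>The base point is a dummy: only facts that do not involve it are taken from the
    two interpretations.\<close>
  interpret Q: rel_levy_functional M m t A a L undefined V B by (rule F)
  interpret Q0: rel_levy_functional M0 0 t A a L undefined V B by (rule F0)
  have gm[measurable]: "g \<in> borel_measurable borel" and g2: "integrable lborel (\<lambda>x. (cmod (g x))\<^sup>2)"
    using g by (auto simp: L2_fun_def)
  define E where "E = 2 * (exp (m * t) - 1)"
  have E: "0 \<le> E" using Q.m_nonneg Q.t_nonneg by (simp add: E_def)
  define G2 where "G2 = (LINT x|lborel. (cmod (g x))\<^sup>2)"
  have G2: "0 \<le> G2" unfolding G2_def by (intro Bochner_Integration.integral_nonneg) simp
  define S where "S n \<omega> = (\<Sum>k<n. kinc (t / real n) (\<omega> k) :: 'a)" for n and \<omega> :: "nat \<Rightarrow> ('a \<Rightarrow> real) \<times> real"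
  define I where "I n x = (\<integral>\<^sup>+ \<omega>. ennreal \<bar>gwt m (t / real n) n \<omega> - 1\<bar> * ennreal ((cmod (g (x + S n \<omega>)))\<^sup>2) \<partial>GM n)" for n x
  define H where "H n x = ennreal ((exp (t * B))\<^sup>2 * E) * I n x" for n x
  have Sm: "S n \<in> borel_measurable (GM n)" for n unfolding S_def
    by (intro borel_measurable_sum GM_component_measurable kinc_measurable) simp
  have Fm: "(\<lambda>x. ennreal ((cmod (g x))\<^sup>2)) \<in> borel_measurable borel" by measurable
  have wm: "(\<lambda>\<omega>. ennreal \<bar>gwt m (t / real n) n \<omega> - 1\<bar>) \<in> borel_measurable (GM n)" for n
    by (intro measurable_compose[OF _ measurable_ennreal] borel_measurable_abs borel_measurable_diff gwt_measurable) auto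
  note cv = nn_integral_convolve[OF prob_space_GM Fm Sm wm, folded I_def]
  have Hm: "H n \<in> borel_measurable lborel" for n
    unfolding H_def using cv(1) by simp
  have HI: "(\<integral>\<^sup>+ x. H n x \<partial>lborel) \<le> ennreal ((exp (t * B))\<^sup>2 * E\<^sup>2 * G2)" if n: "0 < n" for n
  proof -
    have "(\<integral>\<^sup>+ x. H n x \<partial>lborel) = ennreal ((exp (t * B))\<^sup>2 * E) * (\<integral>\<^sup>+ x. I n x \<partial>lborel)"
      unfolding H_def using cv(1) by (intro nn_integral_cmult) simp
    also have "(\<integral>\<^sup>+ x. I n x \<partial>lborel) = (\<integral>\<^sup>+ \<omega>. ennreal \<bar>gwt m (t / real n) n \<omega> - 1\<bar> \<partial>(GM n :: (nat \<Rightarrow> ('a \<Rightarrow> real) \<times> real) measure)) * (\<integral>\<^sup>+ x. ennreal ((cmod (g x))\<^sup>2) \<partial>lborel)"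
      by (rule cv(2))
    also have "(\<integral>\<^sup>+ x. ennreal ((cmod (g x))\<^sup>2) \<partial>lborel) = ennreal G2"
      unfolding G2_def using g2 by (intro nn_integral_eq_integral) auto
    also have "ennreal ((exp (t * B))\<^sup>2 * E) * ((\<integral>\<^sup>+ \<omega>. ennreal \<bar>gwt m (t / real n) n \<omega> - 1\<bar> \<partial>(GM n :: (nat \<Rightarrow> ('a \<Rightarrow> real) \<times> real) measure)) * ennreal G2)
      \<le> ennreal ((exp (t * B))\<^sup>2 * E) * (ennreal E * ennreal G2)"
    proof (intro mult_left_mono mult_right_mono)
      have "real n * (t / real n) = t" using n by simp
      then show "(\<integral>\<^sup>+ \<omega>. ennreal \<bar>gwt m (t / real n) n \<omega> - 1\<bar> \<partial>(GM n :: (nat \<Rightarrow> ('a \<Rightarrow> real) \<times> real) measure)) \<le> ennreal E"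
        using nn_integral_abs_gwt_minus_1_le[OF Q.m_nonneg, of "t / real n" n, where 'a='a] Q.t_nonneg by (simp add: E_def)
    qed auto
    also have "\<dots> = ennreal ((exp (t * B))\<^sup>2 * E\<^sup>2 * G2)"
      using E G2 by (simp add: power2_eq_square mult.assoc flip: ennreal_mult)
    finally show ?thesis .
  qed
  have "AE x in lborel. integrable M (\<lambda>X. cmod (g (x + X t)))"
    by (rule AE_integrable_translate[OF Q.prob_space_axioms g Q.t_measurable])
  moreover have "AE x in lborel. integrable M0 (\<lambda>X. cmod (g (x + X t)))"
    by (rule AE_integrable_translate[OF Q0.prob_space_axioms g Q0.t_measurable])
  ultimately have "AE x in lborel. ennreal ((cmod (ufun M m A V g x t - ufun M0 0 A V g x t))\<^sup>2) \<le> liminf (\<lambda>n. H (Suc n) x)"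
  proof eventually_elim
    case (elim x)
    define u where "u n = (LINT X|M. Phi t A V x n X * g (x + X t)) - (LINT X|M0. Phi t A V x n X * g (x + X t))" for n
    have "u \<longlonglongrightarrow> ufun M m A V g x t - ufun M0 0 A V g x t"
      unfolding u_def by (intro tendsto_diff rel_levy_functional.ufun_limit[OF F gm elim(1)] rel_levy_functional.ufun_limit[OF F0 gm elim(2)])
    then have "(\<lambda>n. ennreal ((cmod (u (Suc n)))\<^sup>2)) \<longlonglongrightarrow> ennreal ((cmod (ufun M m A V g x t - ufun M0 0 A V g x t))\<^sup>2)"
      by (intro tendsto_ennrealI tendsto_power tendsto_norm LIMSEQ_Suc)
    from lim_imp_Liminf[OF sequentially_bot this]
    have "ennreal ((cmod (ufun M m A V g x t - ufun M0 0 A V g x t))\<^sup>2) = liminf (\<lambda>n. ennreal ((cmod (u (Suc n)))\<^sup>2))" by simp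
    also have "\<dots> \<le> liminf (\<lambda>n. H (Suc n) x)"
    proof (intro Liminf_mono always_eventually allI)
      show "ennreal ((cmod (u (Suc n)))\<^sup>2) \<le> H (Suc n) x" for n
        unfolding u_def H_def I_def S_def E_def by (rule ufun_approx_difference[OF F F0 gm elim(2) zero_less_Suc])
    qed
    finally show ?case .
  qed
  then have "(\<integral>\<^sup>+ x. ennreal ((cmod (ufun M m A V g x t - ufun M0 0 A V g x t))\<^sup>2) \<partial>lborel) \<le> (\<integral>\<^sup>+ x. liminf (\<lambda>n. H (Suc n) x) \<partial>lborel)"
    by (rule nn_integral_mono_AE)
  also have "\<dots> \<le> liminf (\<lambda>n. \<integral>\<^sup>+ x. H (Suc n) x \<partial>lborel)"
    by (rule nn_integral_liminf) (rule Hm)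
  also have "\<dots> \<le> liminf (\<lambda>n::nat. ennreal ((exp (t * B))\<^sup>2 * E\<^sup>2 * G2))"
    by (intro Liminf_mono always_eventually allI HI) simp
  also have "\<dots> = ennreal ((exp (t * B))\<^sup>2 * E\<^sup>2 * G2)" by (simp add: Liminf_const)
  finally show ?thesis by (simp only: E_def G2_def)
qed

text \<open>Squared norms are taken in the extended nonnegative reals; their supremum tends to 0
  exactly when the supremum of the norms does.\<close>

theorem theorem2:
  fixes lam :: "real \<Rightarrow> (real \<Rightarrow> 'a::euclidean_space) measure"
    and A :: "'a \<Rightarrow> 'a" and V :: "'a \<Rightarrow> real" and g :: "'a \<Rightarrow> complex"
  assumes lam: "\<And>m. m \<ge> 0 \<Longrightarrow> rel_levy_law (lam m) m"
    and g: "L2_fun g"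
    and A: "smooth_fun A" "compact_support A"
    and V: "C0_fun V"
    and T: "0 < T"
  shows "((\<lambda>m. SUP t\<in>{0..T}. \<integral>\<^sup>+ x. ennreal ((cmod (ufun (lam m) m A V g x t
                                                  - ufun (lam 0) 0 A V g x t))\<^sup>2) \<partial>lborel)
           \<longlongrightarrow> 0) (at_right 0)"
proof -
  obtain a L where AL: "continuous_on UNIV A" "0 \<le> a" "\<And>x. norm (A x) \<le> a"
    "0 \<le> L" "\<And>x y. norm (A x - A y) \<le> L * norm (x - y)"
    by (rule smooth_compact_support_bounds[OF A]) blast
  obtain B where B: "0 \<le> B" "\<And>x. \<bar>V x\<bar> \<le> B"
    by (rule C0_fun_bounded[OF V]) blast
  have Vc: "continuous_on UNIV V" using V by (simp add: C0_fun_def)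
  have loc: "rel_levy_functional (lam m) m t A a L V B" if "0 \<le> m" "0 \<le> t" for m t
    by unfold_locales (use that lam AL B Vc in auto)
  define G2 where "G2 = (LINT x|lborel. (cmod (g x))\<^sup>2)"
  have G2: "0 \<le> G2" unfolding G2_def by (intro Bochner_Integration.integral_nonneg) simp
  \<comment> \<open>The bound of \<open>ufun_difference_bound\<close> at t = T; it dominates the
    bounds for all t \<le> T since m and B are nonnegative.\<close>
  define c where "c m = (exp (T * B))\<^sup>2 * (2 * (exp (m * T) - 1))\<^sup>2 * G2" for m
  have bound: "(SUP t\<in>{0..T}. \<integral>\<^sup>+ x. ennreal ((cmod (ufun (lam m) m A V g x t - ufun (lam 0) 0 A V g x t))\<^sup>2) \<partial>lborel) \<le> ennreal (c m)"
    if m: "0 < m" for m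
  proof (rule SUP_least)
    fix t assume t: "t \<in> {0..T}"
    have "(\<integral>\<^sup>+ x. ennreal ((cmod (ufun (lam m) m A V g x t - ufun (lam 0) 0 A V g x t))\<^sup>2) \<partial>lborel)
      \<le> ennreal ((exp (t * B))\<^sup>2 * (2 * (exp (m * t) - 1))\<^sup>2 * G2)"
      unfolding G2_def by (rule ufun_difference_bound[OF loc loc g]) (use m t in auto)
    also have "\<dots> \<le> ennreal (c m)"
      unfolding c_def using m t B(1) G2
      by (intro ennreal_leI mult_right_mono mult_mono power_mono mult_left_mono diff_right_mono) (auto intro!: mult_left_mono mult_right_mono)
    finally show "(\<integral>\<^sup>+ x. ennreal ((cmod (ufun (lam m) m A V g x t - ufun (lam 0) 0 A V g x t))\<^sup>2) \<partial>lborel) \<le> ennreal (c m)" .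
  qed
  have "((\<lambda>m. ennreal (c m)) \<longlongrightarrow> ennreal ((exp (T * B))\<^sup>2 * (2 * (exp (0 * T) - 1))\<^sup>2 * G2)) (at_right 0)"
    unfolding c_def by (intro tendsto_intros)
  then have lim: "((\<lambda>m. ennreal (c m)) \<longlongrightarrow> 0) (at_right 0)" by simp
  show ?thesis
  proof (rule tendsto_sandwich[OF _ _ tendsto_const lim])
    show "\<forall>\<^sub>F m in at_right 0. (SUP t\<in>{0..T}. \<integral>\<^sup>+ x. ennreal ((cmod (ufun (lam m) m A V g x t - ufun (lam 0) 0 A V g x t))\<^sup>2) \<partial>lborel) \<le> ennreal (c m)"
      using eventually_at_right_less[of 0] by eventually_elim (rule bound)
  qed simp
qed

end
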